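(* Let $K$ be a differential field (of characteristic $0$, in $m$ commuting derivations) that is large as a field. Then $K$ is differentially large if and only if it satisfies the axiom scheme $\mathrm{UC}$.
   Context: All fields have characteristic $0$; a differential field is a field with $m\ge1$ commuting derivations $\delta_1,\dots,\delta_m$. For a (differential) field extension $L/K$, $K$ is existentially closed (e.c.) in $L$ as a field (as a differential field) if every finite system of polynomial (differential polynomial) equations over $K$ with a solution in $L$ has a solution in $K$. A field $K$ is large if every irreducible affine algebraic variety over $K$ with a smooth $K$-point has a Zariski-dense set of $K$-points. $K$ is differentially large if it is large as a field and for every differential field extension $L/K$, if $K$ is e.c. in $L$ as a field then $K$ is e.c. in $L$ as a differential field. Characteristic sets. Let $K\{x\}$, $x=(x_1,\dots,x_n)$, be the differential polynomial ring. Order the indeterminates $\delta^\xi x_i$ ($\xi\in\mathbb N^m$) by $\delta^\xi x_i<\delta^\zeta x_j$ iff $(\sum\xi_k,i,\xi_1,\dots,\xi_m)<_{\mathrm{lex}}(\sum\zeta_k,j,\zeta_1,\dots,\zeta_m)$. For $f\in K\{x\}\setminus K$: the leader $v_f$ is the highest indeterminate appearing in $f$; $d_f$ is the degree of $f$ in $v_f$; the rank is $(v_f,d_f)$, ordered lexicographically; the separant $S_f$ is $\partial f/\partial v_f$; the initial $I_f$ is the leading coefficient of $f$ as a polynomial in $v_f$. $g$ is reduced with respect to $f$ if no proper derivative of $v_f$ appears in $g$ and the degree of $v_f$ in $g$ is $<d_f$. A set $\Lambda\subseteq K\{x\}\setminus K$ is autoreduced if any two distinct elements are reduced with respect to each other;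 autoreduced sets are finite and listed in increasing rank. Autoreduced sets are ranked by: $\{g_1,\dots,g_r\}<\{f_1,\dots,f_s\}$ iff either there is $i\le r,s$ with $\mathrm{rk}(g_j)=\mathrm{rk}(f_j)$ for $j<i$ and $\mathrm{rk}(g_i)<\mathrm{rk}(f_i)$, or $r>s$ and $\mathrm{rk}(g_j)=\mathrm{rk}(f_j)$ for all $j\le s$. A characteristic set of a prime differential ideal $P$ is a minimal autoreduced subset of $P$. Put $H_\Lambda=\prod_{f\in\Lambda}I_fS_f$. $K\{x\}_{\le r}$ is the set of differential polynomials of order at most $r$, and $\Lambda^{(r)}$ is the set of all $\delta^\xi f$ with $f\in\Lambda$, $\xi\in\mathbb N^m$, that have order at most $r$. For $\Sigma\subseteq K\{x\}_{\le r}$, $\mathcal V_r(\Sigma)$ is the algebraic zero set obtained by treating the $\delta^\xi x_i$ with $|\xi|\le r$ as independent algebraic variables, while $\mathcal V(\Sigma)$ is the set of differential zeros in $n$-space (both over a universal differentially closed field containing $K$). $K$ satisfies $\mathrm{UC}$ if for all $n$ and every characteristic set $\Lambda$ of a prime differential ideal of $K\{x_1,\dots,x_n\}$: if $\mathcal V_r(\Lambda^{(r)})\setminus\mathcal V_r(H_\Lambda)$ has a smooth $K$-point for some $r$ with $\Lambda\subseteq K\{x\}_{\le r}$, then $\mathcal V(\Lambda)\setminus\mathcal V(H_\Lambda)$ has a differential $K$-point (a point in $K^n$). *)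

theory Defs
  imports
    "HOL-Algebra.Algebraic_Closure_Type"
    "HOL-Library.Extended_Nat"
    "HOL-Library.FuncSet"
    "HOL-Library.Poly_Mapping"
begin

section \<open>Polynomials in arbitrarily many indeterminates\<close>

text \<open>
  A polynomial maps monomials (exponent vectors with finite support) to coefficients.
  The ring structure is the convolution product of \<^theory>\<open>HOL-Library.Poly_Mapping\<close>.
\<close>

type_synonym ('v, 'a) mpoly = "('v \<Rightarrow>\<^sub>0 nat) \<Rightarrow>\<^sub>0 'a"

definition vars :: "('v, 'a::zero) mpoly \<Rightarrow> 'v set" where
  "vars f = (\<Union>t \<in> Poly_Mapping.keys f. Poly_Mapping.keys t)"

definition polys :: "'a set \<Rightarrow> 'v set \<Rightarrow> ('v, 'a::zero) mpoly set" where
  "polys F V = {f. vars f \<subseteq> V \<and> (\<forall>t. Poly_Mapping.lookup f t \<in> F)}"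

text \<open>The ring \<open>F[V]\<close>, for a subfield \<open>F\<close> of the coefficient type.\<close>

definition mpoly_ring :: "'a set \<Rightarrow> 'v set \<Rightarrow> ('v, 'a::comm_ring_1) mpoly ring" where
  "mpoly_ring F V =
     \<lparr>carrier = polys F V, monoid.mult = (*), one = 1, ring.zero = 0, add = (+)\<rparr>"

text \<open>Evaluation at \<open>b\<close> after mapping the coefficients by \<open>h\<close>, with values in a type and in
  a ring given by a record, respectively.\<close>

definition poly_eval ::
  "('a::zero \<Rightarrow> 'c::comm_semiring_1) \<Rightarrow> ('v \<Rightarrow> 'c) \<Rightarrow> ('v, 'a) mpoly \<Rightarrow> 'c" where
  "poly_eval h b f =
     (\<Sum>t\<in>Poly_Mapping.keys f. h (Poly_Mapping.lookup f t) * (\<Prod>v\<in>Poly_Mapping.keys t. b v ^ Poly_Mapping.lookup t v))"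

definition poly_eval_in ::
  "'b ring \<Rightarrow> ('a::zero \<Rightarrow> 'b) \<Rightarrow> ('v \<Rightarrow> 'b) \<Rightarrow> ('v, 'a) mpoly \<Rightarrow> 'b" where
  "poly_eval_in L h b f =
     finsum L (\<lambda>t. h (Poly_Mapping.lookup f t) \<otimes>\<^bsub>L\<^esub>
       finprod L (\<lambda>v. b v [^]\<^bsub>L\<^esub> Poly_Mapping.lookup t v) (Poly_Mapping.keys t)) (Poly_Mapping.keys f)"

definition pvar :: "'v \<Rightarrow> ('v, 'a::comm_ring_1) mpoly" where
  "pvar v = Poly_Mapping.single (Poly_Mapping.single v 1) 1"

text \<open>Where \<open>v\<close> does not occur in \<open>t\<close> the exponent subtraction truncates, but the coefficient is zero.\<close>

definition partial :: "'v \<Rightarrow> ('v, 'a::comm_ring_1) mpoly \<Rightarrow> ('v, 'a) mpoly" where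
  "partial v f =
     (\<Sum>t\<in>Poly_Mapping.keys f. Poly_Mapping.single (t - Poly_Mapping.single v 1)
                     (of_nat (Poly_Mapping.lookup t v) * Poly_Mapping.lookup f t))"

definition deg_in :: "'v \<Rightarrow> ('v, 'a::zero) mpoly \<Rightarrow> nat" where
  "deg_in v f = Max (insert 0 ((\<lambda>t. Poly_Mapping.lookup t v) ` Poly_Mapping.keys f))"

text \<open>The coefficient of \<open>v ^ e\<close> in \<open>f\<close> viewed as a polynomial in \<open>v\<close>.\<close>

definition coeff_in :: "'v \<Rightarrow> nat \<Rightarrow> ('v, 'a::comm_ring_1) mpoly \<Rightarrow> ('v, 'a) mpoly" where
  "coeff_in v e f =
     (\<Sum>t\<in>{t \<in> Poly_Mapping.keys f. Poly_Mapping.lookup t v = e}.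
        Poly_Mapping.single (t - Poly_Mapping.single v e) (Poly_Mapping.lookup f t))"


section \<open>Smooth rational points and large fields\<close>

text \<open>
  A point \<open>a\<close> over the field \<open>'a\<close> is only relevant on the finite set \<open>V\<close> of coordinates.
  For an ideal \<open>I\<close> of \<open>'a[V]\<close> vanishing at \<open>a\<close>, \<open>local_dim V I a\<close> is the Krull dimension
  of the local ring of \<open>'a[V]/I\<close> at \<open>a\<close>: its primes are the primes of \<open>'a[V]\<close> between \<open>I\<close>
  and the maximal ideal of \<open>a\<close>.
\<close>

definition local_dim :: "'v set \<Rightarrow> ('v, 'a::field) mpoly set \<Rightarrow> ('v \<Rightarrow> 'a) \<Rightarrow> enat" where
  "local_dim V I a =
     Sup {enat l | l. \<exists>p.
       (\<forall>i\<le>l. primeideal (p i) (mpoly_ring UNIV V) \<and> I \<subseteq> p i \<and>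
              p i \<subseteq> {f. poly_eval (\<lambda>c. c) a f = 0}) \<and>
       (\<forall>i<l. p i \<subset> p (Suc i))}"

definition gradient :: "('v \<Rightarrow> 'a) \<Rightarrow> ('v, 'a::field) mpoly \<Rightarrow> ('v \<Rightarrow>\<^sub>0 'a)" where
  "gradient a f =
     (\<Sum>v\<in>vars f. Poly_Mapping.single v (poly_eval (\<lambda>c. c) a (partial v f)))"

definition jacobian_rank :: "('v, 'a::field) mpoly set \<Rightarrow> ('v \<Rightarrow> 'a) \<Rightarrow> nat" where
  "jacobian_rank I a =
     vector_space.dim (\<lambda>c :: 'a. Poly_Mapping.map ((*) c)) (gradient a ` I)"

text \<open>
  The Zariski tangent space at \<open>a\<close> has dimension \<open>card V - jacobian_rank I a\<close>; smoothness
  says that this is the local dimension. No irreducibility is assumed.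
\<close>

definition smooth_at :: "'v set \<Rightarrow> ('v, 'a::field) mpoly set \<Rightarrow> ('v \<Rightarrow> 'a) \<Rightarrow> bool" where
  "smooth_at V I a \<longleftrightarrow>
     (\<forall>f\<in>I. poly_eval (\<lambda>c. c) a f = 0) \<and>
     enat (card V) = enat (jacobian_rank I a) + local_dim V I a"

text \<open>
  An irreducible affine variety over \<open>'a\<close> is given by a prime ideal \<open>P\<close> of
  \<open>'a[x\<^sub>0, \<dots>, x\<^bsub>N-1\<^esub>]\<close>; a set of points is dense in it iff
  every polynomial vanishing on the set belongs to \<open>P\<close>.
\<close>

definition large_field :: "'a::field itself \<Rightarrow> bool" where
  "large_field (_ :: 'a itself) \<longleftrightarrow>
     (\<forall>(N :: nat) (P :: (nat, 'a) mpoly set).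
        primeideal P (mpoly_ring UNIV {..<N}) \<longrightarrow>
        (\<exists>a. smooth_at {..<N} P a) \<longrightarrow>
        (\<forall>g \<in> polys UNIV {..<N}.
           (\<forall>a. (\<forall>f\<in>P. poly_eval (\<lambda>c. c) a f = 0) \<longrightarrow> poly_eval (\<lambda>c. c) a g = 0)
           \<longrightarrow> g \<in> P))"

text \<open>The zero set of \<open>S\<close> in affine \<open>V\<close>-space over \<open>'u\<close>, coefficients being mapped by \<open>h\<close>.\<close>

definition alg_zeros ::
  "('a::field \<Rightarrow> 'u::field) \<Rightarrow> 'v set \<Rightarrow> ('v, 'a) mpoly set \<Rightarrow> ('v \<Rightarrow> 'u) set" where
  "alg_zeros h V S = {b \<in> V \<rightarrow>\<^sub>E UNIV. \<forall>f\<in>S. poly_eval h b f = 0}"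

definition vanishing_ideal ::
  "('a::field \<Rightarrow> 'u::field) \<Rightarrow> 'v set \<Rightarrow> ('v \<Rightarrow> 'u) set \<Rightarrow> ('v, 'a) mpoly set" where
  "vanishing_ideal h V Z = {f \<in> polys UNIV V. \<forall>b\<in>Z. poly_eval h b f = 0}"

text \<open>
  For a locally closed \<open>Z\<close> (over \<open>'a\<close>), smoothness of a point of \<open>Z\<close> is local, so it is
  smoothness on the Zariski closure, whose ideal is the vanishing ideal of \<open>Z\<close>.
\<close>

definition smooth_rational_point ::
  "('a::field \<Rightarrow> 'u::field) \<Rightarrow> 'v set \<Rightarrow> ('v \<Rightarrow> 'u) set \<Rightarrow> ('v \<Rightarrow> 'a) \<Rightarrow> bool" where
  "smooth_rational_point h V Z a \<longleftrightarrow>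
     restrict (\<lambda>v. h (a v)) V \<in> Z \<and> smooth_at V (vanishing_ideal h V Z) a"


section \<open>Differential fields and extensions\<close>

text \<open>The derivations are indexed by a nonempty finite type \<open>'m\<close>, so \<open>m = CARD('m)\<close>.\<close>

definition differential_field :: "('m \<Rightarrow> 'a::field_char_0 \<Rightarrow> 'a) \<Rightarrow> bool" where
  "differential_field d \<longleftrightarrow>
     (\<forall>k x y. d k (x + y) = d k x + d k y) \<and>
     (\<forall>k x y. d k (x * y) = d k x * y + x * d k y) \<and>
     (\<forall>k l x. d k (d l x) = d l (d k x))"

text \<open>
  A differential field extension of \<open>('a, d)\<close>: a field \<open>L\<close> with commuting derivations \<open>D\<close>
  and an embedding \<open>h\<close> of differential fields.
\<close>

definition differential_extension ::
  "('m \<Rightarrow> 'a::field_char_0 \<Rightarrow> 'a) \<Rightarrow> 'b ring \<Rightarrow> ('m \<Rightarrow> 'b \<Rightarrow> 'b) \<Rightarrow> ('a \<Rightarrow> 'b) \<Rightarrow> bool"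
where
  "differential_extension d L D h \<longleftrightarrow>
     Ring.field L \<and>
     (\<forall>k. \<forall>x\<in>carrier L. D k x \<in> carrier L) \<and>
     (\<forall>k. \<forall>x\<in>carrier L. \<forall>y\<in>carrier L. D k (x \<oplus>\<^bsub>L\<^esub> y) = D k x \<oplus>\<^bsub>L\<^esub> D k y) \<and>
     (\<forall>k. \<forall>x\<in>carrier L. \<forall>y\<in>carrier L.
        D k (x \<otimes>\<^bsub>L\<^esub> y) = (D k x \<otimes>\<^bsub>L\<^esub> y) \<oplus>\<^bsub>L\<^esub> (x \<otimes>\<^bsub>L\<^esub> D k y)) \<and>
     (\<forall>k l. \<forall>x\<in>carrier L. D k (D l x) = D l (D k x)) \<and>
     h \<in> ring_hom ring_of_type_algebra L \<and>
     (\<forall>k x. h (d k x) = D k (h x))"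

text \<open>The operator \<open>\<delta>\<^sup>\<xi>\<close> for a multi-index \<open>\<xi>\<close>. As the derivations commute, the
  order of composition is immaterial.\<close>

definition iter_deriv ::
  "('m::{finite,linorder} \<Rightarrow> 'x \<Rightarrow> 'x) \<Rightarrow> ('m \<Rightarrow>\<^sub>0 nat) \<Rightarrow> 'x \<Rightarrow> 'x" where
  "iter_deriv d \<xi> x =
     foldr (\<lambda>k. d k ^^ Poly_Mapping.lookup \<xi> k) (sorted_list_of_set (UNIV :: 'm set)) x"

text \<open>\<open>(i, \<xi>)\<close> stands for the indeterminate \<open>\<delta>\<^sup>\<xi> x\<^sub>i\<close>, where \<open>i\<close> starts at \<open>0\<close>.\<close>

type_synonym 'm ind = "nat \<times> ('m \<Rightarrow>\<^sub>0 nat)"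

type_synonym ('m, 'a) dpoly = "('m ind, 'a) mpoly"

definition jet ::
  "('m::{finite,linorder} \<Rightarrow> 'x \<Rightarrow> 'x) \<Rightarrow> (nat \<Rightarrow> 'x) \<Rightarrow> 'm ind \<Rightarrow> 'x" where
  "jet d a = (\<lambda>(i, \<xi>). iter_deriv d \<xi> (a i))"

definition index_order :: "('m::finite \<Rightarrow>\<^sub>0 nat) \<Rightarrow> nat" where
  "index_order \<xi> = (\<Sum>k\<in>UNIV. Poly_Mapping.lookup \<xi> k)"

definition inds :: "nat \<Rightarrow> 'm ind set" where
  "inds n = {(i, \<xi>). i < n}"

definition inds_upto :: "nat \<Rightarrow> nat \<Rightarrow> 'm::finite ind set" where
  "inds_upto n r = {(i, \<xi>). i < n \<and> index_order \<xi> \<le> r}"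

definition ind_deriv :: "'m \<Rightarrow> 'm ind \<Rightarrow> 'm ind" where
  "ind_deriv k v = (fst v, snd v + Poly_Mapping.single k 1)"

text \<open>The derivation of \<open>K{x}\<close> extending \<open>d k\<close> and mapping \<open>\<delta>\<^sup>\<xi> x\<^sub>i\<close> to
  \<open>\<delta>\<^sub>k \<delta>\<^sup>\<xi> x\<^sub>i\<close>.\<close>

definition dpoly_deriv ::
  "('m \<Rightarrow> 'a::field_char_0 \<Rightarrow> 'a) \<Rightarrow> 'm \<Rightarrow> ('m, 'a) dpoly \<Rightarrow> ('m, 'a) dpoly" where
  "dpoly_deriv d k f =
     (\<Sum>t\<in>Poly_Mapping.keys f. Poly_Mapping.single t (d k (Poly_Mapping.lookup f t))) +
     (\<Sum>v\<in>vars f. partial v f * pvar (ind_deriv k v))"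

definition ec_field_in :: "'b ring \<Rightarrow> ('a::field \<Rightarrow> 'b) \<Rightarrow> bool" where
  "ec_field_in L h \<longleftrightarrow>
     (\<forall>(n :: nat) (S :: (nat, 'a) mpoly set).
        finite S \<longrightarrow> S \<subseteq> polys UNIV {..<n} \<longrightarrow>
        (\<exists>b \<in> {..<n} \<rightarrow> carrier L. \<forall>f\<in>S. poly_eval_in L h b f = \<zero>\<^bsub>L\<^esub>) \<longrightarrow>
        (\<exists>a. \<forall>f\<in>S. poly_eval (\<lambda>c. c) a f = 0))"

definition ec_differential_in ::
  "('m::{finite,linorder} \<Rightarrow> 'a::field_char_0 \<Rightarrow> 'a) \<Rightarrow>
   'b ring \<Rightarrow> ('m \<Rightarrow> 'b \<Rightarrow> 'b) \<Rightarrow> ('a \<Rightarrow> 'b) \<Rightarrow> bool" where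
  "ec_differential_in d L D h \<longleftrightarrow>
     (\<forall>(n :: nat) (S :: ('m, 'a) dpoly set).
        finite S \<longrightarrow> S \<subseteq> polys UNIV (inds n) \<longrightarrow>
        (\<exists>b \<in> {..<n} \<rightarrow> carrier L. \<forall>f\<in>S. poly_eval_in L h (jet D b) f = \<zero>\<^bsub>L\<^esub>) \<longrightarrow>
        (\<exists>a. \<forall>f\<in>S. poly_eval (\<lambda>c. c) (jet d a) f = 0))"

text \<open>
  HOL cannot quantify over extensions living in all types at once, so the type \<open>'b\<close>
  containing the carriers of the extensions is a parameter. As soon as \<open>'a\<close> injects into
  \<open>'b\<close> the notion does not depend on \<open>'b\<close>: a failure is witnessed by finitely many elements
  of an extension, and the differential subfield they generate over \<open>'a\<close> has the
  cardinality of \<open>'a\<close>. Extensions come with an embedding, so they need not contain \<open>'a\<close>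
  as a set.
\<close>

definition differentially_large ::
  "'b itself \<Rightarrow> ('m::{finite,linorder} \<Rightarrow> 'a::field_char_0 \<Rightarrow> 'a) \<Rightarrow> bool" where
  "differentially_large (_ :: 'b itself) d \<longleftrightarrow>
     large_field TYPE('a) \<and>
     (\<forall>(L :: 'b ring) D h.
        differential_extension d L D h \<longrightarrow> ec_field_in L h \<longrightarrow> ec_differential_in d L D h)"


section \<open>Prime differential ideals and characteristic sets\<close>

text \<open>Prime differential ideals of \<open>F{x\<^sub>0, \<dots>, x\<^bsub>n-1\<^esub>}\<close>, where \<open>F\<close> is a
  differential subfield of \<open>'a\<close>.\<close>

definition prime_differential_ideal ::
  "'a set \<Rightarrow> ('m \<Rightarrow> 'a::field_char_0 \<Rightarrow> 'a) \<Rightarrow> nat \<Rightarrow> ('m, 'a) dpoly set \<Rightarrow> bool" where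
  "prime_differential_ideal F d n P \<longleftrightarrow>
     primeideal P (mpoly_ring F (inds n)) \<and> (\<forall>k. \<forall>f\<in>P. dpoly_deriv d k f \<in> P)"

definition ind_key :: "'m::{finite,linorder} ind \<Rightarrow> nat list" where
  "ind_key v = index_order (snd v) # fst v #
     map (Poly_Mapping.lookup (snd v)) (sorted_list_of_set (UNIV :: 'm set))"

definition ind_less :: "'m::{finite,linorder} ind \<Rightarrow> 'm ind \<Rightarrow> bool" where
  "ind_less v w \<longleftrightarrow> (ind_key v, ind_key w) \<in> lexord {(x, y). x < y}"

definition leader :: "('m::{finite,linorder}, 'a::zero) dpoly \<Rightarrow> 'm ind" where
  "leader f = (THE v. v \<in> vars f \<and> (\<forall>w\<in>vars f. w \<noteq> v \<longrightarrow> ind_less w v))"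

definition leader_deg :: "('m::{finite,linorder}, 'a::zero) dpoly \<Rightarrow> nat" where
  "leader_deg f = deg_in (leader f) f"

definition dpoly_rank :: "('m::{finite,linorder}, 'a::zero) dpoly \<Rightarrow> 'm ind \<times> nat" where
  "dpoly_rank f = (leader f, leader_deg f)"

definition rank_less ::
  "('m::{finite,linorder}, 'a::zero) dpoly \<Rightarrow> ('m, 'a) dpoly \<Rightarrow> bool" where
  "rank_less f g \<longleftrightarrow>
     ind_less (leader f) (leader g) \<or> leader f = leader g \<and> leader_deg f < leader_deg g"

definition separant ::
  "('m::{finite,linorder}, 'a::comm_ring_1) dpoly \<Rightarrow> ('m, 'a) dpoly" where
  "separant f = partial (leader f) f"

definition initial ::
  "('m::{finite,linorder}, 'a::comm_ring_1) dpoly \<Rightarrow> ('m, 'a) dpoly" where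
  "initial f = coeff_in (leader f) (leader_deg f) f"

definition proper_derivatives :: "'m ind \<Rightarrow> 'm ind set" where
  "proper_derivatives v = {(fst v, snd v + \<eta>) | \<eta>. \<eta> \<noteq> 0}"

definition reduced_wrt ::
  "('m::{finite,linorder}, 'a::zero) dpoly \<Rightarrow> ('m, 'a) dpoly \<Rightarrow> bool" where
  "reduced_wrt g f \<longleftrightarrow>
     vars g \<inter> proper_derivatives (leader f) = {} \<and> deg_in (leader f) g < leader_deg f"

definition autoreduced ::
  "nat \<Rightarrow> ('m::{finite,linorder}, 'a::zero) dpoly set \<Rightarrow> bool" where
  "autoreduced n \<Lambda> \<longleftrightarrow>
     \<Lambda> \<subseteq> polys UNIV (inds n) \<and> (\<forall>f\<in>\<Lambda>. vars f \<noteq> {}) \<and>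
     (\<forall>f\<in>\<Lambda>. \<forall>g\<in>\<Lambda>. f \<noteq> g \<longrightarrow> reduced_wrt f g)"

definition autoreduced_less ::
  "('m::{finite,linorder}, 'a::zero) dpoly set \<Rightarrow> ('m, 'a) dpoly set \<Rightarrow> bool" where
  "autoreduced_less \<Gamma> \<Lambda> \<longleftrightarrow>
     (\<exists>gs fs. set gs = \<Gamma> \<and> sorted_wrt rank_less gs \<and> set fs = \<Lambda> \<and> sorted_wrt rank_less fs \<and>
        ((\<exists>i. i < length gs \<and> i < length fs \<and>
              (\<forall>j<i. dpoly_rank (gs ! j) = dpoly_rank (fs ! j)) \<and> rank_less (gs ! i) (fs ! i)) \<or>
         (length gs > length fs \<and> (\<forall>j<length fs. dpoly_rank (gs ! j) = dpoly_rank (fs ! j)))))"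

definition characteristic_set ::
  "nat \<Rightarrow> ('m::{finite,linorder}, 'a::zero) dpoly set \<Rightarrow> ('m, 'a) dpoly set \<Rightarrow> bool" where
  "characteristic_set n P \<Lambda> \<longleftrightarrow>
     autoreduced n \<Lambda> \<and> \<Lambda> \<subseteq> P \<and>
     \<not> (\<exists>\<Gamma>. autoreduced n \<Gamma> \<and> \<Gamma> \<subseteq> P \<and> autoreduced_less \<Gamma> \<Lambda>)"

definition H_prod ::
  "('m::{finite,linorder}, 'a::comm_ring_1) dpoly set \<Rightarrow> ('m, 'a) dpoly" where
  "H_prod \<Lambda> = (\<Prod>f\<in>\<Lambda>. initial f * separant f)"


section \<open>Universal differential fields\<close>

definition differential_subfield :: "('m \<Rightarrow> 'u::field_char_0 \<Rightarrow> 'u) \<Rightarrow> 'u set \<Rightarrow> bool" where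
  "differential_subfield d F \<longleftrightarrow>
     subfield F ring_of_type_algebra \<and> (\<forall>k. \<forall>x\<in>F. d k x \<in> F)"

definition diff_generated :: "('m \<Rightarrow> 'u::field_char_0 \<Rightarrow> 'u) \<Rightarrow> 'u set \<Rightarrow> 'u set" where
  "diff_generated d A = \<Inter>{F. differential_subfield d F \<and> A \<subseteq> F}"

text \<open>Existential closedness in all extensions; those with carrier in \<open>'u\<close> itself suffice,
  for the cardinality reason given for differentially large fields.\<close>

definition differentially_closed ::
  "('m::{finite,linorder} \<Rightarrow> 'u::field_char_0 \<Rightarrow> 'u) \<Rightarrow> bool" where
  "differentially_closed d \<longleftrightarrow>
     (\<forall>(L :: 'u ring) D h. differential_extension d L D h \<longrightarrow> ec_differential_in d L D h)"

text \<open>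
  Universality in the sense of Kolchin: over each differential field \<open>F\<close> that is finitely
  generated over the image of \<open>'a\<close>, every prime differential ideal has a generic zero.
\<close>

definition universal_extension ::
  "('m::{finite,linorder} \<Rightarrow> 'a::field_char_0 \<Rightarrow> 'a) \<Rightarrow>
   ('m \<Rightarrow> 'u::field_char_0 \<Rightarrow> 'u) \<Rightarrow> ('a \<Rightarrow> 'u) \<Rightarrow> bool" where
  "universal_extension d dU \<iota> \<longleftrightarrow>
     differential_field dU \<and>
     \<iota> \<in> ring_hom ring_of_type_algebra ring_of_type_algebra \<and>
     (\<forall>k x. \<iota> (d k x) = dU k (\<iota> x)) \<and>
     differentially_closed dU \<and>
     (\<forall>A n P. finite A \<longrightarrow>
        prime_differential_ideal (diff_generated dU (Set.range \<iota> \<union> A)) dU n P \<longrightarrow>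
        (\<exists>b. \<forall>f \<in> polys (diff_generated dU (Set.range \<iota> \<union> A)) (inds n).
           poly_eval (\<lambda>c. c) (jet dU b) f = 0 \<longleftrightarrow> f \<in> P))"


section \<open>The axiom scheme UC\<close>

text \<open>\<open>prolongation d n r \<Lambda>\<close> is the set \<open>\<Lambda>\<^sup>(\<^sup>r\<^sup>)\<close>.\<close>

definition prolongation ::
  "('m::{finite,linorder} \<Rightarrow> 'a::field_char_0 \<Rightarrow> 'a) \<Rightarrow> nat \<Rightarrow> nat \<Rightarrow>
   ('m, 'a) dpoly set \<Rightarrow> ('m, 'a) dpoly set" where
  "prolongation d n r \<Lambda> =
     {iter_deriv (dpoly_deriv d) \<xi> f | \<xi> f. f \<in> \<Lambda>} \<inter> polys UNIV (inds_upto n r)"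

definition diff_zeros ::
  "('m::{finite,linorder} \<Rightarrow> 'u::field_char_0 \<Rightarrow> 'u) \<Rightarrow> ('a::field_char_0 \<Rightarrow> 'u) \<Rightarrow> nat \<Rightarrow>
   ('m, 'a) dpoly set \<Rightarrow> (nat \<Rightarrow> 'u) set" where
  "diff_zeros dU \<iota> n S =
     {b \<in> {..<n} \<rightarrow>\<^sub>E UNIV. \<forall>f\<in>S. poly_eval \<iota> (jet dU b) f = 0}"

definition UC ::
  "('m::{finite,linorder} \<Rightarrow> 'a::field_char_0 \<Rightarrow> 'a) \<Rightarrow>
   ('m \<Rightarrow> 'u::field_char_0 \<Rightarrow> 'u) \<Rightarrow> ('a \<Rightarrow> 'u) \<Rightarrow> bool" where
  "UC d dU \<iota> \<longleftrightarrow>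
     (\<forall>n P \<Lambda>. prime_differential_ideal UNIV d n P \<longrightarrow> characteristic_set n P \<Lambda> \<longrightarrow>
        (\<exists>r. \<Lambda> \<subseteq> polys UNIV (inds_upto n r) \<and>
             (\<exists>a. smooth_rational_point \<iota> (inds_upto n r)
                (alg_zeros \<iota> (inds_upto n r) (prolongation d n r \<Lambda>)
                  - alg_zeros \<iota> (inds_upto n r) {H_prod \<Lambda>}) a)) \<longrightarrow>
        (\<exists>a. restrict (\<lambda>i. \<iota> (a i)) {..<n} \<in>
               diff_zeros dU \<iota> n \<Lambda> - diff_zeros dU \<iota> n {H_prod \<Lambda>}))"

end

theory Submission
  imports Defs "HOL-Computational_Algebra.Formal_Power_Series"
begin

text \<open>
  Let \<open>\<Lambda>\<close> be a characteristic set of a prime differential ideal \<open>P\<close>. For each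
  derivative \<open>v\<close> of a leader fix one derivative \<open>\<theta>\<^sub>v\<close> of an element of \<open>\<Lambda>\<close> with
  leader \<open>v\<close>. Up to order \<open>r\<close> these form a triangular system, and as reduced elements of \<open>P\<close>
  vanish, every \<open>f \<in> P\<close> of order at most \<open>r\<close> satisfies \<open>s f \<in> (\<theta>\<^sub>v)\<close> with \<open>s\<close> a product
  of initials and separants. Hence, where \<open>H\<^bsub>\<Lambda>\<^esub>\<close> does not vanish, the zeros of the \<open>\<theta>\<^sub>v\<close> are those
  of \<open>P\<close>, and all of them are smooth, because the Jacobian matrix of the \<open>\<theta>\<^sub>v\<close> is triangular with
  the separants on the diagonal.

  If UC holds and \<open>K\<close> is e.c. in \<open>L\<close> as a field, take for \<open>P\<close> the differential ideal of a
  solution in \<open>L\<close>: the system \<open>\<theta>\<^sub>v = 0\<close>, \<open>H\<^bsub>\<Lambda>\<^esub> \<noteq> 0\<close> has a point in \<open>K\<close>, which is smooth, and the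
  differential point provided by UC is a zero of \<open>P\<close>.

  Conversely, a \<open>K\<close>-point with \<open>H\<^bsub>\<Lambda>\<^esub> \<noteq> 0\<close> extends to every higher order, where the equations
  \<open>\<theta>\<^sub>v = 0\<close> are linear in \<open>v\<close>. By largeness the \<open>K\<close>-points are then dense at every order, so \<open>K\<close> is
  e.c. as a field in the differential field generated by a generic zero of \<open>P\<close>, hence also as a
  differential field.
\<close>

text \<open>Smoothness is measured by chains of primes between the ideal and the maximal ideal of
  the point, so for \<open>s\<close> equations in the set \<open>V\<close> of indeterminates the
  dimension \<open>card V - s\<close> has to be read off from such chains. Upper bound: contraction
  to the ring without a main indeterminate keeps inclusions strict, because the separant stays
  outside the primes of the chain; after \<open>s\<close> contractions a counting argument bounds
  the length by the number of remaining indeterminates. Lower bound: Hensel's lemma gives a power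
  series point through the given one with \<open>card V - s\<close> free parameters, and setting
  these to zero one at a time yields a strict chain of kernels.

  The vanishing ideal in UC is the part of \<open>P\<close> of order at most \<open>r\<close>, since
  a generic zero of \<open>P\<close>, truncated at order \<open>r\<close>, belongs to the zero set.

  Reduction takes place inside \<open>P\<close>, so remainders lie in \<open>P\<close> and
  derivatives not chosen as \<open>theta v\<close> need no coherence condition. Cardinality enters
  once: the field generated by a generic zero must be carried into the type \<open>'b\<close> over
  which differential largeness quantifies.\<close>

abbreviation "lookup \<equiv> Poly_Mapping.lookup"
abbreviation "keys \<equiv> Poly_Mapping.keys"
abbreviation "single \<equiv> Poly_Mapping.single"
abbreviation pconst :: "'a \<Rightarrow> ('v, 'a::zero) mpoly" where "pconst c \<equiv> single 0 c"

subsection \<open>Ring homomorphisms\<close>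

text \<open>Unital ring homomorphisms between whole types. Evaluation, substitution, renaming and
  change of coefficients are all instances of \<open>poly_eval\<close> along such maps.\<close>

definition rhom :: "('a::comm_ring_1 \<Rightarrow> 'c::comm_ring_1) \<Rightarrow> bool" where
  "rhom h \<longleftrightarrow> h 1 = 1 \<and> (\<forall>x y. h (x + y) = h x + h y) \<and> (\<forall>x y. h (x * y) = h x * h y)"

lemma rhomD:
  assumes "rhom h"
  shows rhom_1: "h 1 = 1" and rhom_add: "h (x + y) = h x + h y" and rhom_mult: "h (x * y) = h x * h y"
  using assms by (auto simp: rhom_def)

lemma rhom_0: "rhom h \<Longrightarrow> h 0 = 0"
  using rhom_add[of h 0 0] by simp

lemma rhom_uminus: "rhom h \<Longrightarrow> h (- x) = - h x"
  using rhom_add[of h x "-x"] rhom_0[of h] by (simp add: eq_neg_iff_add_eq_0 add.commute)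

lemma rhom_diff: "rhom h \<Longrightarrow> h (x - y) = h x - h y"
  using rhom_add[of h x "-y"] rhom_uminus[of h y] by simp

lemma rhom_sum: "rhom h \<Longrightarrow> h (sum g A) = (\<Sum>x\<in>A. h (g x))"
  by (induction A rule: infinite_finite_induct) (auto simp: rhom_0 rhom_add)

lemma rhom_prod: "rhom h \<Longrightarrow> h (prod g A) = (\<Prod>x\<in>A. h (g x))"
  by (induction A rule: infinite_finite_induct) (auto simp: rhom_1 rhom_mult)

lemma rhom_power: "rhom h \<Longrightarrow> h (x ^ n) = h x ^ n"
  by (induction n) (auto simp: rhom_1 rhom_mult)

lemma rhom_id: "rhom (\<lambda>c. c)"
  by (simp add: rhom_def)

lemma rhom_comp: "rhom g \<Longrightarrow> rhom h \<Longrightarrow> rhom (\<lambda>x. g (h x))"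
  by (simp add: rhom_def)

lemma rhom_pconst: "rhom (pconst :: 'a::comm_ring_1 \<Rightarrow> ('v, 'a) mpoly)"
  by (simp add: rhom_def single_add mult_single)

lemma rhom_field_eq_0_iff:
  fixes h :: "'a::field \<Rightarrow> 'c::field"
  assumes "rhom h"
  shows "h x = 0 \<longleftrightarrow> x = 0"
proof
  assume "h x = 0"
  then have "x = 0 \<or> (1::'c) = 0"
    using rhom_mult[OF assms, of x "inverse x"] rhom_1[OF assms] by (cases "x = 0") auto
  then show "x = 0" by simp
qed (simp add: rhom_0 assms)

lemma rhom_inj:
  fixes h :: "'a::field \<Rightarrow> 'c::field"
  assumes "rhom h"
  shows "inj h"
proof (rule injI)
  fix x y assume "h x = h y"
  then have "h (x - y) = 0" by (simp add: rhom_diff[OF assms])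
  then show "x = y" by (simp add: rhom_field_eq_0_iff[OF assms])
qed


subsection \<open>Monomials, variables and evaluation\<close>

lemma mpoly_sum_single: "f = (\<Sum>t\<in>keys f. single t (lookup f t))"
proof (rule poly_mapping_eqI)
  fix s
  show "lookup f s = lookup (\<Sum>t\<in>keys f. single t (lookup f t)) s"
    by (simp add: lookup_sum lookup_single when_def in_keys_iff)
qed

lemma mpoly_single_induct [case_names zero single add]:
  fixes f :: "'k \<Rightarrow>\<^sub>0 'b::comm_monoid_add"
  assumes "Q 0" "\<And>t c. Q (single t c)" "\<And>f g. Q f \<Longrightarrow> Q g \<Longrightarrow> Q (f + g)"
  shows "Q f"
proof -
  have "Q (\<Sum>t\<in>A. single t (lookup f t))" for A
    by (induction A rule: infinite_finite_induct) (auto intro: assms)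
  then show ?thesis by (metis mpoly_sum_single)
qed

lemma single_eq_prod_pvar:
  "single t (c::'a::comm_ring_1) = pconst c * (\<Prod>v\<in>keys t. pvar v ^ lookup t v)"
proof -
  have 1: "pvar v ^ n = single (single v n) (1::'a)" for v :: 'b and n
    by (induction n) (auto simp: pvar_def mult_single single_add[symmetric])
  have "(\<Prod>v\<in>A. single (single v (lookup t v)) (1::'a)) = single (\<Sum>v\<in>A. single v (lookup t v)) 1" for A
    by (induction A rule: infinite_finite_induct) (auto simp: mult_single)
  then have "(\<Prod>v\<in>keys t. single (single v (lookup t v)) (1::'a)) = single t 1"
    using mpoly_sum_single[of t] by metis
  then show ?thesis by (simp add: 1 mult_single)
qed

definition mon_eval :: "('v \<Rightarrow> 'c::comm_ring_1) \<Rightarrow> ('v \<Rightarrow>\<^sub>0 nat) \<Rightarrow> 'c" where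
  "mon_eval b t = (\<Prod>v\<in>keys t. b v ^ lookup t v)"

lemma mon_eval_superset: "finite B \<Longrightarrow> keys t \<subseteq> B \<Longrightarrow> mon_eval b t = (\<Prod>v\<in>B. b v ^ lookup t v)"
  unfolding mon_eval_def by (rule prod.mono_neutral_left) (auto simp: in_keys_iff)

lemma mon_eval_add: "mon_eval b (s + t) = mon_eval b s * mon_eval b t"
proof -
  let ?B = "keys s \<union> keys t"
  have "mon_eval b (s + t) = (\<Prod>v\<in>?B. b v ^ lookup (s + t) v)"
    by (rule mon_eval_superset) (use Poly_Mapping.keys_add[of s t] in auto)
  also have "\<dots> = mon_eval b s * mon_eval b t"
    by (simp add: mon_eval_superset[of ?B s] mon_eval_superset[of ?B t] lookup_add power_add prod.distrib)
  finally show ?thesis .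
qed

lemma mon_eval_0 [simp]: "mon_eval b 0 = 1"
  by (simp add: mon_eval_def)

lemma poly_eval_superset:
  assumes "h 0 = 0" "finite B" "keys f \<subseteq> B"
  shows "poly_eval h b f = (\<Sum>t\<in>B. h (lookup f t) * mon_eval b t)"
  unfolding poly_eval_def mon_eval_def[symmetric]
  by (rule sum.mono_neutral_left) (use assms in \<open>auto simp: in_keys_iff\<close>)

lemma poly_eval_0 [simp]: "poly_eval h b 0 = 0"
  by (simp add: poly_eval_def)

lemma poly_eval_add:
  assumes "rhom h"
  shows "poly_eval h b (f + g) = poly_eval h b f + poly_eval h b g"
proof -
  let ?B = "keys f \<union> keys g"
  note s = poly_eval_superset[of h ?B, OF rhom_0[OF assms]]
  show ?thesis
    using Poly_Mapping.keys_add[of f g]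
    by (simp add: s lookup_add rhom_add[OF assms] algebra_simps sum.distrib)
qed

lemma poly_eval_single:
  assumes "rhom h"
  shows "poly_eval h b (single t c) = h c * mon_eval b t"
  by (subst poly_eval_superset[of h "{t}"]) (auto simp: rhom_0 assms)

lemma poly_eval_mult:
  assumes "rhom h"
  shows "poly_eval h b (f * g) = poly_eval h b f * poly_eval h b g"
proof (induction f rule: mpoly_single_induct)
  case (single t c)
  show ?case
    by (induction g rule: mpoly_single_induct)
       (simp_all add: mult_single poly_eval_single[OF assms] mon_eval_add rhom_mult[OF assms]
          algebra_simps poly_eval_add[OF assms])
qed (simp_all add: algebra_simps poly_eval_add[OF assms])

lemma poly_eval_pconst: "rhom h \<Longrightarrow> poly_eval h b (pconst c) = h c"
  by (simp add: poly_eval_single)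

lemma poly_eval_1: "rhom h \<Longrightarrow> poly_eval h b 1 = 1"
  using poly_eval_pconst[of h b 1] by (simp add: rhom_1)

lemma rhom_poly_eval: "rhom h \<Longrightarrow> rhom (poly_eval h b)"
  by (simp add: rhom_def[of "poly_eval h b"] poly_eval_add poly_eval_mult poly_eval_1)

lemma poly_eval_pvar: "rhom h \<Longrightarrow> poly_eval h b (pvar v) = b v"
  by (simp add: pvar_def poly_eval_single rhom_1 mon_eval_def)

lemma poly_eval_cong:
  assumes "\<And>v. v \<in> vars f \<Longrightarrow> b v = b' v"
  shows "poly_eval h b f = poly_eval h b' f"
  unfolding poly_eval_def
  by (intro sum.cong prod.cong arg_cong2[where f = "(*)"] arg_cong2[where f = "(^)"] refl)
     (use assms in \<open>auto simp: vars_def\<close>)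

lemma vars_iff: "v \<in> vars f \<longleftrightarrow> (\<exists>t\<in>keys f. lookup t v \<noteq> 0)"
  by (auto simp: vars_def in_keys_iff)

lemma vars_add: "vars (f + g) \<subseteq> vars f \<union> vars g"
  using Poly_Mapping.keys_add[of f g] by (fastforce simp: vars_iff)

lemma vars_uminus [simp]: "vars (- f) = vars f"
  by (auto simp: vars_iff in_keys_iff)

lemma vars_diff: "vars (f - g) \<subseteq> vars f \<union> vars (g :: ('v, 'a::comm_ring_1) mpoly)"
  using vars_add[of f "-g"] by simp

lemma vars_mult: "vars (f * g) \<subseteq> vars f \<union> vars g"
  using Poly_Mapping.keys_mult[of f g] by (fastforce simp: vars_iff lookup_add)

lemma vars_single: "vars (single t c) \<subseteq> keys t"
  by (auto simp: vars_def split: if_splits)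

lemma vars_pconst [simp]: "vars (pconst c) = {}"
  using vars_single[of 0 c] by simp

lemma vars_0 [simp]: "vars 0 = {}" and vars_1 [simp]: "vars 1 = {}"
  by (auto simp: vars_def)

lemma vars_pvar: "vars (pvar v :: ('v, 'a::comm_ring_1) mpoly) = {v}"
  by (auto simp: vars_def pvar_def)

lemma vars_sum: "(\<And>x. x \<in> A \<Longrightarrow> vars (g x) \<subseteq> V) \<Longrightarrow> vars (sum g A) \<subseteq> V"
  by (induction A rule: infinite_finite_induct) (use vars_add in fastforce)+

lemma vars_prod: "(\<And>x. x \<in> A \<Longrightarrow> vars (g x) \<subseteq> V) \<Longrightarrow> vars (prod g A) \<subseteq> V"
  by (induction A rule: infinite_finite_induct) (use vars_mult in fastforce)+

lemma vars_power: "vars (f ^ n) \<subseteq> vars (f :: ('v, 'a::comm_ring_1) mpoly)"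
  by (induction n) (use vars_mult in fastforce)+

lemma finite_vars [simp]: "finite (vars f)"
  by (simp add: vars_def)

lemma vars_empty_imp_pconst:
  assumes "vars f = {}"
  shows "f = pconst (lookup f 0)"
proof (rule poly_mapping_eqI)
  fix t
  have "t = 0" if "t \<in> keys f"
  proof (rule poly_mapping_eqI)
    show "lookup t k = lookup 0 k" for k
      using that assms vars_iff[of k f] by auto
  qed
  then show "lookup f t = lookup (pconst (lookup f 0)) t"
    by (cases "t = 0") (auto simp: lookup_single in_keys_iff)
qed

lemma polys_UNIV: "f \<in> polys UNIV V \<longleftrightarrow> vars f \<subseteq> V"
  by (simp add: polys_def)

text \<open>The induction never leaves the polynomials in \<open>V\<close>. The variable case may
  therefore use facts that hold on \<open>V\<close> only, such as injectivity of a renaming, and the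
  other cases know the variables of both parts.\<close>

lemma polys_induct [consumes 1, case_names const var add mult]:
  fixes f :: "('v, 'a::comm_ring_1) mpoly"
  assumes f: "vars f \<subseteq> V" and const: "\<And>c. Q (pconst c)" and var: "\<And>v. v \<in> V \<Longrightarrow> Q (pvar v)"
    and add: "\<And>f g. vars f \<subseteq> V \<Longrightarrow> vars g \<subseteq> V \<Longrightarrow> Q f \<Longrightarrow> Q g \<Longrightarrow> Q (f + g)"
    and mult: "\<And>f g. vars f \<subseteq> V \<Longrightarrow> vars g \<subseteq> V \<Longrightarrow> Q f \<Longrightarrow> Q g \<Longrightarrow> Q (f * g)"
  shows "Q f"
proof -
  define R where "R g \<longleftrightarrow> vars g \<subseteq> V \<and> Q g" for g
  have Rc: "R (pconst c)" for c by (simp add: R_def const)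
  have R1: "R 1" and R0: "R 0" using Rc[of 1] Rc[of 0] by simp_all
  have Ra: "R (g + g')" if "R g" "R g'" for g g'
    using that add vars_add[of g g'] by (auto simp: R_def)
  have Rm: "R (g * g')" if "R g" "R g'" for g g'
    using that mult vars_mult[of g g'] by (auto simp: R_def)
  have Rv: "R (pvar v ^ n)" if "v \<in> V" for v n
  proof (induction n)
    case (Suc n)
    have "R (pvar v)" using that var[OF that] by (simp add: R_def vars_pvar)
    from Rm[OF this Suc] show ?case by simp
  qed (simp add: R1)
  have Rp: "R (\<Prod>v\<in>A. pvar v ^ lookup t v)" if "A \<subseteq> V" for A t
    using that by (induction A rule: infinite_finite_induct) (auto intro: R1 Rm Rv)
  have Rs: "R (single t (lookup f t))" if "t \<in> keys f" for t
    by (subst single_eq_prod_pvar, intro Rm Rc Rp) (use that f in \<open>auto simp: vars_def\<close>)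
  have "R (\<Sum>t\<in>A. single t (lookup f t))" if "A \<subseteq> keys f" for A
    using that by (induction A rule: infinite_finite_induct) (auto intro: R0 Ra Rs)
  then have "R (\<Sum>t\<in>keys f. single t (lookup f t))" by blast
  then have "R f" by (subst mpoly_sum_single)
  then show ?thesis by (simp add: R_def)
qed

lemma mpoly_induct [case_names const var add mult]:
  fixes f :: "('v, 'a::comm_ring_1) mpoly"
  assumes "\<And>c. Q (pconst c)" "\<And>v. Q (pvar v)"
    "\<And>f g. Q f \<Longrightarrow> Q g \<Longrightarrow> Q (f + g)" "\<And>f g. Q f \<Longrightarrow> Q g \<Longrightarrow> Q (f * g)"
  shows "Q f"
  by (rule polys_induct[of f UNIV]) (use assms in auto)

text \<open>Universal property of the polynomial ring: both sides are homomorphisms in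
  \<open>f\<close> that agree on constants and indeterminates.\<close>

lemma poly_eval_comp:
  assumes "rhom h" "rhom \<phi>"
  shows "\<phi> (poly_eval h b f) = poly_eval (\<lambda>c. \<phi> (h c)) (\<lambda>v. \<phi> (b v)) f"
proof -
  note h = assms(1) and p = assms(2)
  have hp: "rhom (\<lambda>c. \<phi> (h c))" by (rule rhom_comp[OF assms(2,1)])
  show ?thesis
  proof (induction f rule: mpoly_induct)
    case (const c)
    show ?case by (simp only: poly_eval_pconst[OF h] poly_eval_pconst[OF hp])
  next
    case (var v)
    show ?case by (simp only: poly_eval_pvar[OF h] poly_eval_pvar[OF hp])
  next
    case (add f g)
    then show ?case
      by (simp only: poly_eval_add[OF h] poly_eval_add[OF hp] rhom_add[OF p])
  next
    case (mult f g)
    then show ?case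
      by (simp only: poly_eval_mult[OF h] poly_eval_mult[OF hp] rhom_mult[OF p])
  qed
qed

lemma poly_eval_subst:
  assumes "rhom h"
  shows "poly_eval h b (poly_eval pconst s f) = poly_eval h (\<lambda>v. poly_eval h b (s v)) f"
proof -
  have "(\<lambda>c. poly_eval h b (pconst c)) = h"
    by (rule ext) (rule poly_eval_pconst[OF assms])
  then show ?thesis
    using poly_eval_comp[OF rhom_pconst rhom_poly_eval[OF assms], of b s f] by argo
qed

lemma vars_poly_eval_subst:
  fixes f :: "('v, 'a::comm_ring_1) mpoly" and s :: "'v \<Rightarrow> ('w, 'a) mpoly"
  assumes "vars f \<subseteq> V" "\<And>v. v \<in> V \<Longrightarrow> vars (s v) \<subseteq> W"
  shows "vars (poly_eval pconst s f) \<subseteq> W"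
  using assms(1)
proof (induction rule: polys_induct)
  case (add f g)
  then show ?case
    using vars_add[of "poly_eval pconst s f" "poly_eval pconst s g"]
    by (simp only: poly_eval_add[OF rhom_pconst]) blast
next
  case (mult f g)
  then show ?case
    using vars_mult[of "poly_eval pconst s f" "poly_eval pconst s g"]
    by (simp only: poly_eval_mult[OF rhom_pconst]) blast
next
  case (const c)
  show ?case by (simp only: poly_eval_pconst[OF rhom_pconst]) simp
next
  case (var v)
  then show ?case by (simp only: poly_eval_pvar[OF rhom_pconst] assms)
qed


subsection \<open>Partial derivatives\<close>

lemma lookup_partial:
  "lookup (partial v f) s = of_nat (Suc (lookup s v)) * lookup f (s + single v 1)"
proof -
  have "lookup (partial v f) s =
    (\<Sum>t\<in>keys f. (of_nat (lookup t v) * lookup f t when t - single v 1 = s))"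
    by (simp add: partial_def lookup_sum lookup_single)
  also have "\<dots> = (\<Sum>t\<in>keys f. (of_nat (lookup t v) * lookup f t when t = s + single v 1))"
  proof (rule sum.cong[OF refl])
    fix t
    show "(of_nat (lookup t v) * lookup f t when t - single v 1 = s) =
          (of_nat (lookup t v) * lookup f t when t = s + single v 1)"
    proof (cases "lookup t v = 0")
      case False
      then have "t - single v 1 + single v 1 = t"
        by (intro poly_mapping_eqI) (auto simp: lookup_minus lookup_add lookup_single when_def)
      then have "t - single v 1 = s \<longleftrightarrow> t = s + single v 1"
        by (metis add_diff_cancel_right')
      then show ?thesis by simp
    qed simp
  qed
  also have "\<dots> = of_nat (lookup (s + single v 1) v) * lookup f (s + single v 1)"
    by (simp add: when_def in_keys_iff)
  finally show ?thesis by (simp add: lookup_add)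
qed

lemma partial_add: "partial v (f + g) = partial v f + partial v g"
  by (rule poly_mapping_eqI) (simp add: lookup_partial lookup_add algebra_simps)

lemma partial_single:
  "partial v (single t c) = single (t - single v 1) (of_nat (lookup t v) * c)"
  by (simp add: partial_def)

lemma partial_0 [simp]: "partial v 0 = 0"
  by (simp add: partial_def)

lemma partial_mult:
  fixes f g :: "('v, 'a::comm_ring_1) mpoly"
  shows "partial v (f * g) = partial v f * g + f * partial v g"
proof (induction f rule: mpoly_single_induct)
  case (single s a)
  show ?case
  proof (induction g rule: mpoly_single_induct)
    case (single t b)
    have 1: "single (s + t - single v 1) (of_nat (lookup s v) * a * b) =
        single (s - single v 1 + t) (of_nat (lookup s v) * a * b)"
    proof (cases "lookup s v = 0")
      case False
      then have "s + t - single v 1 = s - single v 1 + t"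
        by (intro poly_mapping_eqI) (auto simp: lookup_minus lookup_add lookup_single when_def)
      then show ?thesis by simp
    qed simp
    have 2: "single (s + t - single v 1) (of_nat (lookup t v) * a * b) =
        single (s + (t - single v 1)) (of_nat (lookup t v) * a * b)"
    proof (cases "lookup t v = 0")
      case False
      then have "s + t - single v 1 = s + (t - single v 1)"
        by (intro poly_mapping_eqI) (auto simp: lookup_minus lookup_add lookup_single when_def)
      then show ?thesis by simp
    qed simp
    have "partial v (single s a * single t b) =
        single (s + t - single v 1) (of_nat (lookup s v) * a * b) +
        single (s + t - single v 1) (of_nat (lookup t v) * a * b)"
      by (simp add: mult_single partial_single lookup_add algebra_simps flip: single_add)
    then show ?case
      unfolding 1 2 by (simp add: mult_single partial_single algebra_simps)
  qed (simp_all add: algebra_simps partial_add)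
qed (simp_all add: algebra_simps partial_add)

lemma partial_pconst [simp]: "partial v (pconst c) = 0"
  by (simp add: partial_single)

lemma partial_pvar: "partial v (pvar w) = (if v = w then 1 else 0 :: ('v, 'a::comm_ring_1) mpoly)"
  by (auto simp: pvar_def partial_single lookup_single)

lemma partial_notin_vars: "v \<notin> vars f \<Longrightarrow> partial v f = 0"
proof (rule poly_mapping_eqI)
  fix s
  assume "v \<notin> vars f"
  then have "s + single v 1 \<notin> keys f"
    unfolding vars_iff by (metis lookup_add lookup_single_eq add_is_0 one_neq_zero)
  then show "lookup (partial v f) s = lookup 0 s"
    by (simp add: lookup_partial in_keys_iff)
qed

lemma partial_sum: "partial v (sum g A) = (\<Sum>x\<in>A. partial v (g x))"
  by (induction A rule: infinite_finite_induct) (auto simp: partial_add)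

lemma vars_partial: "vars (partial v f) \<subseteq> vars f"
proof
  fix w assume "w \<in> vars (partial v f)"
  then obtain s where "lookup (partial v f) s \<noteq> 0" "lookup s w \<noteq> 0"
    by (auto simp: vars_iff in_keys_iff)
  then have "lookup f (s + single v 1) \<noteq> 0" "lookup (s + single v 1) w \<noteq> 0"
    by (auto simp: lookup_partial lookup_add)
  then show "w \<in> vars f" by (auto simp: vars_iff in_keys_iff)
qed

text \<open>Only the existence of the remainder matters, so induction on \<open>f\<close> replaces
  an explicit expansion and no factorial is ever inverted. The factor \<open>e\<^sup>2\<close> is
  what makes the Newton iteration in \<open>hensel_fps\<close> gain precision.\<close>

lemma poly_eval_taylor:
  fixes f :: "('v, 'a::comm_ring_1) mpoly" and x e :: "'c::comm_ring_1"
  assumes h: "rhom h"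
  shows "\<exists>R. poly_eval h (b(v := x + e)) f =
    poly_eval h (b(v := x)) f + e * poly_eval h (b(v := x)) (partial v f) + e\<^sup>2 * R"
proof -
  define E where "E = poly_eval h (b(v := x + e))"
  define F where "F = poly_eval h (b(v := x))"
  have E: "rhom E" "E (pconst c) = h c" "E (pvar w) = (if w = v then x + e else b w)" for c w
    by (simp_all add: E_def rhom_poly_eval h poly_eval_pconst poly_eval_pvar)
  have F: "rhom F" "F (pconst c) = h c" "F (pvar w) = (if w = v then x else b w)" for c w
    by (simp_all add: F_def rhom_poly_eval h poly_eval_pconst poly_eval_pvar)
  have "\<exists>R. E f = F f + e * F (partial v f) + e\<^sup>2 * R"
  proof (induction f rule: mpoly_induct)
    case (const c)
    then show ?case by (intro exI[of _ 0]) (simp add: E F rhom_0)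
  next
    case (var w)
    then show ?case by (intro exI[of _ 0]) (auto simp: E F partial_pvar rhom_0 rhom_1)
  next
    case (add f g)
    then obtain R S where "E f = F f + e * F (partial v f) + e\<^sup>2 * R"
      "E g = F g + e * F (partial v g) + e\<^sup>2 * S" by blast
    then show ?case
      by (intro exI[of _ "R + S"])
         (simp add: rhom_add[OF E(1)] rhom_add[OF F(1)] partial_add algebra_simps)
  next
    case (mult f g)
    then obtain R S where "E f = F f + e * F (partial v f) + e\<^sup>2 * R"
      "E g = F g + e * F (partial v g) + e\<^sup>2 * S" by blast
    then show ?case
      by (intro exI[of _ "F f * S + F g * R + F (partial v f) * F (partial v g)
            + e * F (partial v f) * S + e * F (partial v g) * R + e\<^sup>2 * R * S"])
         (simp add: rhom_add[OF F(1)] rhom_mult[OF E(1)] rhom_mult[OF F(1)] partial_mult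
           algebra_simps power2_eq_square)
  qed
  then show ?thesis by (simp add: E_def F_def)
qed


subsection \<open>Polynomials in one of the indeterminates\<close>

text \<open>A strict bound on the degree. In this form the zero polynomial is exactly the case
  \<open>n = 0\<close>, absence of \<open>v\<close> is the case \<open>n = 1\<close>, and no
  convention for the degree of zero is needed.\<close>

definition degb :: "'v \<Rightarrow> nat \<Rightarrow> ('v, 'a::zero) mpoly \<Rightarrow> bool" where
  "degb v n f \<longleftrightarrow> (\<forall>t\<in>keys f. lookup t v < n)"

lemma degb_mono: "degb v n f \<Longrightarrow> n \<le> m \<Longrightarrow> degb v m f"
  by (auto simp: degb_def)

lemma degb_add: "degb v n f \<Longrightarrow> degb v n g \<Longrightarrow> degb v n (f + g)"
  using Poly_Mapping.keys_add[of f g] by (auto simp: degb_def)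

lemma degb_0 [simp]: "degb v n 0"
  by (simp add: degb_def)

lemma degb_uminus [simp]: "degb v n (- f) \<longleftrightarrow> degb v n f"
  by (auto simp: degb_def in_keys_iff)

lemma degb_diff: "degb v n f \<Longrightarrow> degb v n g \<Longrightarrow> degb v n (f - g :: ('v, 'a::comm_ring_1) mpoly)"
  using degb_add[of v n f "-g"] by simp

lemma degb_1_iff: "degb v (Suc 0) f \<longleftrightarrow> v \<notin> vars f"
  by (auto simp: degb_def vars_iff)

lemma degb_0_iff: "degb v 0 f \<longleftrightarrow> f = 0"
  by (auto simp: degb_def)

lemma degb_mult: "degb v (Suc n) f \<Longrightarrow> degb v m g \<Longrightarrow> degb v (n + m) (f * g)"
  using Poly_Mapping.keys_mult[of f g] by (fastforce simp: degb_def lookup_add)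

lemma degb_mult_free: "v \<notin> vars f \<Longrightarrow> degb v n g \<Longrightarrow> degb v n (f * g)"
  using degb_mult[of v 0 f n g] by (simp add: degb_1_iff)

lemma pvar_power: "pvar v ^ n = single (single v n) (1::'a::comm_ring_1)"
  by (induction n) (auto simp: pvar_def mult_single single_add[symmetric])

lemma degb_pvar_power: "degb v (Suc n) (pvar v ^ n :: ('v, 'a::comm_ring_1) mpoly)"
  by (auto simp: degb_def pvar_power)

lemma degb_sum: "(\<And>x. x \<in> A \<Longrightarrow> degb v n (g x)) \<Longrightarrow> degb v n (sum g A)"
  by (induction A rule: infinite_finite_induct) (auto intro: degb_add)

lemma degb_deg_in: "degb v (Suc (deg_in v f)) f"
  by (auto simp: degb_def deg_in_def less_Suc_eq_le)

lemma deg_in_less_iff: "deg_in v f < n \<longleftrightarrow> 0 < n \<and> degb v n f"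
  by (simp add: deg_in_def degb_def) 

lemma vars_coeff_in: "vars (coeff_in v n f) \<subseteq> vars f - {v}"
proof -
  have "vars (single (t - single v n) (lookup f t)) \<subseteq> vars f - {v}"
    if "t \<in> keys f" "lookup t v = n" for t
  proof (rule order_trans[OF vars_single], rule subsetI)
    fix x assume "x \<in> keys (t - single v n)"
    then have "lookup t x \<noteq> 0" "x \<noteq> v"
      using that by (auto simp: in_keys_iff lookup_minus lookup_single when_def split: if_splits)
    then show "x \<in> vars f - {v}" using that(1) vars_iff by fastforce
  qed
  then show ?thesis unfolding coeff_in_def by (intro vars_sum) auto
qed

lemma coeff_in_split:
  fixes f :: "('v, 'a::comm_ring_1) mpoly"
  assumes "degb v (Suc n) f"
  obtains g where "f = coeff_in v n f * pvar v ^ n + g" "degb v n g" "vars g \<subseteq> vars f"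
    "\<And>w m. degb w m f \<Longrightarrow> degb w m g"
proof -
  let ?A = "{t \<in> keys f. lookup t v = n}" and ?B = "{t \<in> keys f. lookup t v \<noteq> n}"
  define g where "g = (\<Sum>t\<in>?B. single t (lookup f t))"
  have 1: "coeff_in v n f * pvar v ^ n = (\<Sum>t\<in>?A. single t (lookup f t))"
    unfolding coeff_in_def sum_distrib_right
  proof (rule sum.cong[OF refl])
    fix t assume "t \<in> ?A"
    then have "t - single v n + single v n = t"
      by (intro poly_mapping_eqI) (auto simp: lookup_minus lookup_add lookup_single when_def)
    then show "single (t - single v n) (lookup f t) * pvar v ^ n = single t (lookup f t)"
      by (simp add: pvar_power mult_single)
  qed
  have "f = (\<Sum>t\<in>?A \<union> ?B. single t (lookup f t))"
    using mpoly_sum_single[of f] by (simp add: Collect_disj_eq[symmetric] conj_disj_distribL[symmetric])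
  also have "\<dots> = coeff_in v n f * pvar v ^ n + g"
    unfolding 1 g_def by (rule sum.union_disjoint) auto
  finally have 2: "f = coeff_in v n f * pvar v ^ n + g" .
  have k: "keys g \<subseteq> ?B"
  proof
    fix t assume "t \<in> keys g"
    then have "(\<Sum>s\<in>?B. (lookup f s when s = t)) \<noteq> 0"
      by (simp add: g_def in_keys_iff lookup_sum lookup_single)
    then obtain s where "s \<in> ?B" "(lookup f s when s = t) \<noteq> 0"
      by (rule sum.not_neutral_contains_not_neutral)
    then show "t \<in> ?B" by (auto simp: when_def split: if_splits)
  qed
  then have "degb v n g"
    using assms by (fastforce simp: degb_def)
  moreover have "vars g \<subseteq> vars f" "\<And>w m. degb w m f \<Longrightarrow> degb w m g"
    using k by (auto simp: vars_def degb_def)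
  ultimately show thesis using 2 that by blast
qed

lemma lookup_coeff_in:
  assumes "lookup s v = 0"
  shows "lookup (coeff_in v n f) s = lookup f (s + single v n)"
proof -
  have "lookup (coeff_in v n f) s = (\<Sum>t\<in>{t \<in> keys f. lookup t v = n}. (lookup f t when t - single v n = s))"
    by (simp add: coeff_in_def lookup_sum lookup_single)
  also have "\<dots> = (\<Sum>t\<in>{t \<in> keys f. lookup t v = n}. (lookup f t when t = s + single v n))"
  proof (rule sum.cong[OF refl])
    fix t assume "t \<in> {t \<in> keys f. lookup t v = n}"
    then have "t - single v n + single v n = t"
      by (intro poly_mapping_eqI) (auto simp: lookup_minus lookup_add lookup_single when_def)
    then have "t - single v n = s \<longleftrightarrow> t = s + single v n"
      by (metis add_diff_cancel_right')
    then show "(lookup f t when t - single v n = s) = (lookup f t when t = s + single v n)" by simp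
  qed
  also have "\<dots> = lookup f (s + single v n)"
    using assms by (simp add: when_def in_keys_iff lookup_add)
  finally show ?thesis .
qed

lemma coeff_in_deg_in_neq_0:
  assumes "f \<noteq> 0"
  shows "coeff_in v (deg_in v f) f \<noteq> 0"
proof -
  have ne: "keys f \<noteq> {}" using assms by simp
  obtain t where t: "t \<in> keys f" "lookup t v = deg_in v f"
  proof -
    have m: "deg_in v f \<in> insert 0 ((\<lambda>t. lookup t v) ` keys f)"
      unfolding deg_in_def by (rule Max_in) auto
    show thesis
    proof (cases "deg_in v f = 0")
      case True
      then have "\<forall>t\<in>keys f. lookup t v = deg_in v f"
        using degb_deg_in[of v f] by (simp add: degb_def)
      then show thesis using that ne by blast
    next
      case False
      then show thesis using m that by auto
    qed
  qed
  let ?s = "t - single v (deg_in v f)"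
  have "lookup ?s v = 0" "?s + single v (deg_in v f) = t"
    using t by (auto intro!: poly_mapping_eqI simp: lookup_minus lookup_add lookup_single when_def)
  then have "lookup (coeff_in v (deg_in v f) f) ?s = lookup f t"
    by (simp add: lookup_coeff_in)
  then show ?thesis using t(1) by (auto simp: in_keys_iff)
qed

lemma vars_pvar_power: "vars (pvar v ^ n :: ('v, 'a::comm_ring_1) mpoly) \<subseteq> {v}"
  using vars_power[of "pvar v :: ('v, 'a) mpoly" n] by (simp add: vars_pvar)

lemma degb_coeff_in:
  assumes "degb w n f" "w \<noteq> v"
  shows "degb w n (coeff_in v m f)"
  unfolding coeff_in_def
proof (rule degb_sum)
  fix t assume t: "t \<in> {t \<in> keys f. lookup t v = m}"
  then have "lookup t w < n" using assms(1) by (auto simp: degb_def)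
  then show "degb w n (single (t - single v m) (lookup f t))"
    using assms(2) by (simp add: degb_def lookup_minus lookup_single)
qed

text \<open>Besides the usual division by a polynomial with leading coefficient \<open>I\<close>,
  two bounds are recorded. Degrees in indeterminates outside \<open>W\<close> do not grow, which
  preserves earlier reductions in \<open>tri_reduce\<close>; the degree of the quotient is needed in
  \<open>incomparable\<close>.\<close>

lemma pseudo_division:
  fixes f \<theta> :: "('v, 'a::comm_ring_1) mpoly"
  assumes I: "v \<notin> vars I" and \<theta>: "\<theta> = I * pvar v ^ D + \<theta>'" "degb v D \<theta>'"
    and W: "vars I \<subseteq> W" "vars \<theta>' \<subseteq> W" "v \<in> W"
  shows "degb v m f \<Longrightarrow> \<exists>k q g. I ^ k * f = q * \<theta> + g \<and> degb v D g \<and> degb v (m - D) q \<and>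
      vars g \<subseteq> vars f \<union> W \<and> vars q \<subseteq> vars f \<union> W \<and>
      (\<forall>w n. w \<notin> W \<longrightarrow> degb w n f \<longrightarrow> degb w n g)"
proof (induction m arbitrary: f)
  case 0
  then have f0: "f = 0" by (simp add: degb_0_iff)
  have "I ^ 0 * f = 0 * \<theta> + 0 \<and> degb v D (0::('v, 'a) mpoly) \<and> degb v (0 - D) (0::('v, 'a) mpoly) \<and>
      vars (0::('v, 'a) mpoly) \<subseteq> vars f \<union> W \<and> vars (0::('v, 'a) mpoly) \<subseteq> vars f \<union> W \<and>
      (\<forall>w n. w \<notin> W \<longrightarrow> degb w n f \<longrightarrow> degb w n (0::('v, 'a) mpoly))"
    by (simp add: f0)
  then show ?case by blast
next
  case (Suc m)
  show ?case
  proof (cases "Suc m \<le> D")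
    case True
    have d: "degb v D f" by (rule degb_mono[OF Suc.prems True])
    have "I ^ 0 * f = 0 * \<theta> + f \<and> degb v D f \<and> degb v (Suc m - D) (0::('v, 'a) mpoly) \<and>
      vars f \<subseteq> vars f \<union> W \<and> vars (0::('v, 'a) mpoly) \<subseteq> vars f \<union> W \<and>
      (\<forall>w n. w \<notin> W \<longrightarrow> degb w n f \<longrightarrow> degb w n f)"
      by (simp add: d)
    then show ?thesis by blast
  next
    case False
    obtain f' where f': "f = coeff_in v m f * pvar v ^ m + f'" "degb v m f'" "vars f' \<subseteq> vars f"
      "\<And>w n. degb w n f \<Longrightarrow> degb w n f'"
      using coeff_in_split[OF Suc.prems] by blast
    define c where "c = coeff_in v m f"
    define q0 where "q0 = c * pvar v ^ (m - D)"
    \<comment> \<open>This is \<open>I * f - q0 * \<theta>\<close> with the terms of degree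
      \<open>m\<close> in \<open>v\<close> already cancelled.\<close>
    define f1 where "f1 = I * f' - q0 * \<theta>'"
    have vc: "vars c \<subseteq> vars f - {v}" unfolding c_def by (rule vars_coeff_in)
    have p: "pvar v ^ m = (pvar v ^ (m - D) * pvar v ^ D :: ('v, 'a) mpoly)"
      using False by (simp flip: power_add)
    have "I * f = I * (c * pvar v ^ m + f')" using f'(1) c_def by simp
    then have eq: "I * f = q0 * \<theta> + f1"
      by (simp add: q0_def f1_def \<theta>(1) p algebra_simps)
    have qd: "degb v (Suc (m - D)) q0"
      unfolding q0_def using vc by (intro degb_mult_free degb_pvar_power) auto
    have "degb v m (q0 * \<theta>')"
      using degb_mult[OF qd \<theta>(2)] False by simp
    then have d1: "degb v m f1"
      unfolding f1_def by (rule degb_diff[OF degb_mult_free[OF I f'(2)]])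
    have vq: "vars q0 \<subseteq> vars f \<union> W"
      using vars_mult[of c "pvar v ^ (m - D)"] vc vars_pvar_power[of v "m - D", where 'a = 'a] W(3)
      unfolding q0_def by blast
    have v1: "vars f1 \<subseteq> vars f \<union> W"
      using vars_diff[of "I * f'" "q0 * \<theta>'"] vars_mult[of I f'] f'(3) vq vars_mult[of q0 \<theta>'] W
      unfolding f1_def by blast
    obtain k q g where IH: "I ^ k * f1 = q * \<theta> + g" "degb v D g" "degb v (m - D) q"
      "vars g \<subseteq> vars f1 \<union> W" "vars q \<subseteq> vars f1 \<union> W"
      "\<And>w n. w \<notin> W \<Longrightarrow> degb w n f1 \<Longrightarrow> degb w n g"
      using Suc.IH[OF d1] by blast
    have "I ^ Suc k * f = I ^ k * (I * f)" by (simp add: mult_ac)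
    also have "\<dots> = I ^ k * q0 * \<theta> + I ^ k * f1"
      unfolding eq by (simp add: algebra_simps)
    also have "\<dots> = (I ^ k * q0 + q) * \<theta> + g"
      unfolding IH(1) by (simp add: algebra_simps)
    finally have a: "I ^ Suc k * f = (I ^ k * q0 + q) * \<theta> + g" .
    have Ik: "vars (I ^ k) \<subseteq> vars I" by (rule vars_power)
    have b: "degb v (Suc m - D) (I ^ k * q0 + q)"
    proof (rule degb_add)
      show "degb v (Suc m - D) (I ^ k * q0)"
        using qd Ik I False by (intro degb_mult_free) (auto simp: Suc_diff_le)
      show "degb v (Suc m - D) q" using IH(3) by (rule degb_mono) simp
    qed
    have c: "vars (I ^ k * q0 + q) \<subseteq> vars f \<union> W"
      using vars_add[of "I ^ k * q0" q] vars_mult[of "I ^ k" q0] Ik vq IH(5) v1 W(1) by blast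
    have d: "vars g \<subseteq> vars f \<union> W" using IH(4) v1 by blast
    have "degb w n g" if w: "w \<notin> W" and f: "degb w n f" for w n
    proof -
      have "w \<noteq> v" using w W(3) by blast
      then have "degb w n c" unfolding c_def using f by (intro degb_coeff_in)
      moreover have "w \<notin> vars (\<theta>' * pvar v ^ (m - D))"
        using w W vars_mult[of \<theta>' "pvar v ^ (m - D)"] vars_pvar_power[of v "m - D", where 'a = 'a] by blast
      ultimately have "degb w n (\<theta>' * pvar v ^ (m - D) * c)" by (intro degb_mult_free)
      then have "degb w n (q0 * \<theta>')" by (simp add: q0_def mult_ac)
      moreover have "degb w n (I * f')"
        using w W(1) f'(4)[OF f] by (intro degb_mult_free) blast+
      ultimately have "degb w n f1"
        unfolding f1_def by (intro degb_diff)
      then show ?thesis using IH(6) w by blast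
    qed
    then show ?thesis using a b c d IH(2) by blast
  qed
qed


subsection \<open>Ideals and triangular systems\<close>

text \<open>Prime ideals of \<open>F[V]\<close> in terms of the operations of the type. The set
  \<open>F\<close> of coefficients matters for generic zeros, where ideals over the image of the
  base field in a larger type occur.\<close>

definition prime_in :: "'a set \<Rightarrow> 'v set \<Rightarrow> ('v, 'a::comm_ring_1) mpoly set \<Rightarrow> bool" where
  "prime_in F V P \<longleftrightarrow> P \<subseteq> polys F V \<and> 0 \<in> P \<and> (\<forall>f\<in>P. \<forall>g\<in>P. f + g \<in> P) \<and>
     (\<forall>f\<in>P. \<forall>g\<in>polys F V. g * f \<in> P) \<and> 1 \<notin> P \<and>
     (\<forall>f\<in>polys F V. \<forall>g\<in>polys F V. f * g \<in> P \<longrightarrow> f \<in> P \<or> g \<in> P)"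

definition subr :: "'a::comm_ring_1 set \<Rightarrow> bool" where
  "subr F \<longleftrightarrow> 1 \<in> F \<and> (\<forall>x\<in>F. \<forall>y\<in>F. x + y \<in> F \<and> x * y \<in> F) \<and> (\<forall>x\<in>F. - x \<in> F)"

lemma subrD:
  assumes "subr F"
  shows subr_0: "0 \<in> F" and subr_1: "1 \<in> F" and subr_add: "x \<in> F \<Longrightarrow> y \<in> F \<Longrightarrow> x + y \<in> F"
    and subr_mult: "x \<in> F \<Longrightarrow> y \<in> F \<Longrightarrow> x * y \<in> F" and subr_uminus: "x \<in> F \<Longrightarrow> - x \<in> F"
  using assms by (auto simp: subr_def) (metis add.right_inverse)

lemma subr_UNIV: "subr UNIV"
  by (simp add: subr_def)

lemma subr_polys:
  assumes "subr F"
  shows "subr (polys F V)"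
proof -
  have add: "f + g \<in> polys F V" if "f \<in> polys F V" "g \<in> polys F V" for f g
    using that vars_add[of f g] by (auto simp: polys_def lookup_add intro: subr_add[OF assms])
  have zero: "0 \<in> polys F V" by (simp add: polys_def subr_0[OF assms])
  have sum: "sum h A \<in> polys F V" if "\<And>x. x \<in> A \<Longrightarrow> h x \<in> polys F V" for h :: "'x \<Rightarrow> _" and A
    using that by (induction A rule: infinite_finite_induct) (auto intro: add zero)
  have mult: "f * g \<in> polys F V" if "f \<in> polys F V" "g \<in> polys F V" for f g
  proof -
    have "f * g = (\<Sum>s\<in>keys f. single s (lookup f s)) * (\<Sum>t\<in>keys g. single t (lookup g t))"
      using mpoly_sum_single[of f] mpoly_sum_single[of g] by simp
    also have "\<dots> = (\<Sum>s\<in>keys f. \<Sum>t\<in>keys g. single (s + t) (lookup f s * lookup g t))"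
      by (simp add: sum_product mult_single)
    also have "\<dots> \<in> polys F V"
    proof (intro sum)
      fix s t assume "s \<in> keys f" "t \<in> keys g"
      then have "keys s \<subseteq> V" "keys t \<subseteq> V" using that by (auto simp: polys_def vars_def)
      then have "keys (s + t) \<subseteq> V" using Poly_Mapping.keys_add[of s t] by blast
      then show "single (s + t) (lookup f s * lookup g t) \<in> polys F V"
        using that vars_single[of "s + t"] subr_0[OF assms] subr_mult[OF assms]
        by (auto simp: polys_def lookup_single when_def)
    qed
    finally show ?thesis .
  qed
  have "1 \<in> polys F V"
    using subr_0[OF assms] subr_1[OF assms] by (auto simp: polys_def lookup_one when_def)
  moreover have "- f \<in> polys F V" if "f \<in> polys F V" for f
    using that by (simp add: polys_def subr_uminus[OF assms])
  ultimately show ?thesis using add mult unfolding subr_def by blast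
qed

lemma cring_mpoly_ring:
  assumes "subr F"
  shows "cring (mpoly_ring F V)"
proof -
  note s = subr_polys[OF assms, of V]
  show ?thesis
    by (intro cringI abelian_groupI comm_monoidI)
       (auto simp: mpoly_ring_def algebra_simps intro: subr_add[OF s] subr_mult[OF s] subr_0[OF s]
          subr_1[OF s] bexI[OF _ subr_uminus[OF s]])
qed

lemma primeideal_iff:
  assumes "subr F"
  shows "primeideal P (mpoly_ring F V) \<longleftrightarrow> prime_in F V P"
proof
  let ?R = "mpoly_ring F V"
  interpret R: cring ?R by (rule cring_mpoly_ring[OF assms])
  note s = subr_polys[OF assms, of V]
  {
    assume P: "primeideal P ?R"
    interpret P: primeideal P ?R by (rule P)
    have "1 \<notin> P"
      using P.one_imp_carrier P.I_notcarr by (auto simp: mpoly_ring_def)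
    then show "prime_in F V P"
      using P.a_subset P.a_closed P.zero_closed P.I_l_closed P.I_prime
      unfolding prime_in_def by (auto simp: mpoly_ring_def)
  next
    assume P: "prime_in F V P"
    have inv: "inv\<^bsub>add_monoid ?R\<^esub> f = - f" if "f \<in> polys F V" for f
    proof -
      have "\<ominus>\<^bsub>?R\<^esub> f = - f"
        using that subr_uminus[OF s that]
        by (intro R.minus_equality) (auto simp: mpoly_ring_def)
      then show ?thesis by (simp add: a_inv_def)
    qed
    have neg: "- f \<in> P" if "f \<in> P" for f
    proof -
      have "(- 1) * f \<in> P"
        using P that subr_uminus[OF s subr_1[OF s]] unfolding prime_in_def by blast
      then show ?thesis by simp
    qed
    have "subgroup P (add_monoid ?R)"
      using P neg inv by (intro subgroup.intro) (auto simp: prime_in_def mpoly_ring_def subset_iff)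
    then have "ideal P ?R"
      using P by (intro idealI R.ring_axioms) (auto simp: prime_in_def mpoly_ring_def mult.commute)
    then show "primeideal P ?R"
      using P subr_1[OF s] by (intro primeidealI R.cring_axioms) (auto simp: prime_in_def mpoly_ring_def)
  }
qed

lemma prime_inD:
  assumes "prime_in F V P"
  shows prime_in_polys: "f \<in> P \<Longrightarrow> f \<in> polys F V"
    and prime_in_0: "0 \<in> P"
    and prime_in_add: "f \<in> P \<Longrightarrow> g \<in> P \<Longrightarrow> f + g \<in> P"
    and prime_in_mult: "f \<in> P \<Longrightarrow> g \<in> polys F V \<Longrightarrow> g * f \<in> P"
    and prime_in_1: "1 \<notin> P"
    and prime_in_prime: "f * g \<in> P \<Longrightarrow> f \<in> polys F V \<Longrightarrow> g \<in> polys F V \<Longrightarrow> f \<in> P \<or> g \<in> P"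
  using assms unfolding prime_in_def by blast+

lemma prime_in_vars: "prime_in UNIV V P \<Longrightarrow> f \<in> P \<Longrightarrow> vars f \<subseteq> V"
  using prime_in_polys[of UNIV V P f] polys_UNIV[of f V] by blast

lemma prime_in_mult': "prime_in UNIV V P \<Longrightarrow> f \<in> P \<Longrightarrow> vars g \<subseteq> V \<Longrightarrow> g * f \<in> P"
  using prime_in_mult[of UNIV V P f g] polys_UNIV[of g V] by blast

lemma prime_in_prime':
  "prime_in UNIV V P \<Longrightarrow> f * g \<in> P \<Longrightarrow> vars f \<subseteq> V \<Longrightarrow> vars g \<subseteq> V \<Longrightarrow> f \<in> P \<or> g \<in> P"
  using prime_in_prime[of UNIV V P f g] polys_UNIV[of f V] polys_UNIV[of g V] by blast

lemma prime_in_uminus: "prime_in UNIV V P \<Longrightarrow> f \<in> P \<Longrightarrow> - f \<in> P"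
  using prime_in_mult'[of V P f "-1"] by simp

lemma prime_in_diff: "prime_in UNIV V P \<Longrightarrow> f \<in> P \<Longrightarrow> g \<in> P \<Longrightarrow> f - g \<in> P"
  using prime_in_add[of UNIV V P f "- g"] prime_in_uminus[of V P g] by simp

lemma prime_in_sum: "prime_in F V P \<Longrightarrow> (\<And>x. x \<in> A \<Longrightarrow> g x \<in> P) \<Longrightarrow> sum g A \<in> P"
  by (induction A rule: infinite_finite_induct) (auto intro: prime_in_0 prime_in_add)

lemma prime_in_power_notin:
  assumes "prime_in UNIV V P" "f \<notin> P" "vars f \<subseteq> V"
  shows "f ^ n \<notin> P"
proof (induction n)
  case (Suc n)
  then show ?case
    using prime_in_prime'[OF assms(1), of f "f ^ n"] assms vars_power[of f n] by auto
qed (simp add: prime_in_1[OF assms(1)])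

lemma prime_in_prod_notin:
  assumes "prime_in UNIV V P" "\<And>x. x \<in> A \<Longrightarrow> g x \<notin> P \<and> vars (g x) \<subseteq> V"
  shows "prod g A \<notin> P"
  using assms(2)
proof (induction A rule: infinite_finite_induct)
  case (insert x A)
  have "vars (prod g A) \<subseteq> V" using insert.prems by (intro vars_prod) auto
  then show ?case
    using prime_in_prime'[OF assms(1), of "g x" "prod g A"] insert by auto
qed (simp_all add: prime_in_1[OF assms(1)])

lemma prime_in_pconst:
  fixes P :: "('v, 'a::field) mpoly set"
  assumes "prime_in UNIV V P" "pconst c \<in> P"
  shows "c = 0"
proof (rule ccontr)
  assume "c \<noteq> 0"
  then have "pconst (inverse c) * pconst c = (1 :: ('v, 'a) mpoly)" by (simp add: mult_single)
  then show False
    using prime_in_mult'[OF assms, of "pconst (inverse c)"] prime_in_1[OF assms(1)] by simp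
qed

text \<open>The list enumerates the main indeterminates of a triangular system in descending order.\<close>

primrec tri :: "'v set \<Rightarrow> 'v list \<Rightarrow> ('v \<Rightarrow> ('v, 'a::comm_ring_1) mpoly) \<Rightarrow> bool" where
  "tri V [] \<theta> \<longleftrightarrow> True"
| "tri V (v # vs) \<theta> \<longleftrightarrow> v \<in> V \<and> vars (\<theta> v) \<subseteq> V \<and> tri (V - {v}) vs \<theta>"

lemma tri_subset: "tri V vs \<theta> \<Longrightarrow> set vs \<subseteq> V"
  by (induction vs arbitrary: V) fastforce+

lemma tri_vars: "tri V vs \<theta> \<Longrightarrow> v \<in> set vs \<Longrightarrow> vars (\<theta> v) \<subseteq> V"
  by (induction vs arbitrary: V) fastforce+

lemma tri_distinct: "tri V vs \<theta> \<Longrightarrow> distinct vs"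
proof (induction vs arbitrary: V)
  case (Cons v vs)
  then show ?case using tri_subset[of "V - {v}" vs \<theta>] by auto
qed simp

text \<open>Pseudo-division by the equations from the highest main indeterminate down. The equations
  after \<open>v\<close> involve only \<open>V - {v}\<close>, so by the last conclusion of
  \<open>pseudo_division\<close> they do not destroy the degree bound already reached in
  \<open>v\<close>.\<close>

lemma tri_reduce:
  fixes f :: "('v, 'a::comm_ring_1) mpoly"
  assumes "tri V vs \<theta>"
    and "\<And>v. v \<in> set vs \<Longrightarrow> \<exists>\<theta>'. \<theta> v = I v * pvar v ^ D v + \<theta>' \<and> degb v (D v) \<theta>' \<and>
      v \<notin> vars (I v) \<and> vars (I v) \<subseteq> vars (\<theta> v) \<and> vars \<theta>' \<subseteq> vars (\<theta> v)"
  shows "\<exists>k c g. (\<Prod>v\<in>set vs. I v ^ k v) * f = g + (\<Sum>v\<in>set vs. c v * \<theta> v) \<and>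
    vars g \<subseteq> vars f \<union> V \<and> (\<forall>v\<in>set vs. vars (c v) \<subseteq> vars f \<union> V) \<and>
    (\<forall>v\<in>set vs. degb v (D v) g) \<and> (\<forall>w n. w \<notin> V \<longrightarrow> degb w n f \<longrightarrow> degb w n g)"
  using assms
proof (induction vs arbitrary: V f)
  case Nil
  then show ?case by (intro exI[of _ "\<lambda>_. 0"] exI[of _ f]) auto
next
  case (Cons v vs)
  let ?D = "D v"
  have v: "v \<in> V" "vars (\<theta> v) \<subseteq> V" and t: "tri (V - {v}) vs \<theta>" using Cons.prems by auto
  have vs: "set vs \<subseteq> V - {v}" by (rule tri_subset[OF t])
  obtain \<theta>' where \<theta>': "\<theta> v = I v * pvar v ^ D v + \<theta>'" "degb v (D v) \<theta>'" "v \<notin> vars (I v)"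
    "vars (I v) \<subseteq> vars (\<theta> v)" "vars \<theta>' \<subseteq> vars (\<theta> v)"
    using Cons.prems(2)[of v] by auto
  have "vars (I v) \<subseteq> V" "vars \<theta>' \<subseteq> V" using \<theta>'(4,5) v(2) by auto
  from pseudo_division[OF \<theta>'(3,1,2) this v(1) degb_deg_in, of f]
  obtain k0 q g1 where 1: "I v ^ k0 * f = q * \<theta> v + g1" "degb v ?D g1"
    "vars g1 \<subseteq> vars f \<union> V" "vars q \<subseteq> vars f \<union> V" "\<forall>w n. w \<notin> V \<longrightarrow> degb w n f \<longrightarrow> degb w n g1"
    by - (elim exE conjE, rule that)
  have "\<exists>k c g. (\<Prod>v\<in>set vs. I v ^ k v) * g1 = g + (\<Sum>v\<in>set vs. c v * \<theta> v) \<and>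
      vars g \<subseteq> vars g1 \<union> (V - {v}) \<and> (\<forall>v'\<in>set vs. vars (c v') \<subseteq> vars g1 \<union> (V - {v})) \<and>
      (\<forall>v\<in>set vs. degb v (D v) g) \<and> (\<forall>w n. w \<notin> V - {v} \<longrightarrow> degb w n g1 \<longrightarrow> degb w n g)"
    by (rule Cons.IH[OF t]) (rule Cons.prems(2), simp)
  then obtain k c g where 2: "(\<Prod>v\<in>set vs. I v ^ k v) * g1 = g + (\<Sum>v\<in>set vs. c v * \<theta> v)"
    "vars g \<subseteq> vars g1 \<union> (V - {v})" "\<forall>u\<in>set vs. vars (c u) \<subseteq> vars g1 \<union> (V - {v})"
    "\<forall>u\<in>set vs. degb u (D u) g"
    "\<forall>w n. w \<notin> V - {v} \<longrightarrow> degb w n g1 \<longrightarrow> degb w n g"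
    by - (elim exE conjE, rule that)
  define s where "s = (\<Prod>u\<in>set vs. I u ^ k u)"
  have nv: "v \<notin> set vs" using vs by blast
  have "(\<Prod>u\<in>set vs. I u ^ (k(v := k0)) u) = s"
    unfolding s_def by (rule prod.cong) (use nv in auto)
  then have p1: "(\<Prod>u\<in>set (v # vs). I u ^ (k(v := k0)) u) = I v ^ k0 * s"
    using nv by simp
  have "(\<Sum>u\<in>set vs. (c(v := s * q)) u * \<theta> u) = (\<Sum>u\<in>set vs. c u * \<theta> u)"
    by (rule sum.cong) (use nv in auto)
  then have p2: "(\<Sum>u\<in>set (v # vs). (c(v := s * q)) u * \<theta> u) = s * q * \<theta> v + (\<Sum>u\<in>set vs. c u * \<theta> u)"
    using nv by simp
  have "I v ^ k0 * s * f = s * (I v ^ k0 * f)" by (simp add: mult_ac)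
  also have "\<dots> = s * q * \<theta> v + s * g1" unfolding 1(1) by (simp add: algebra_simps)
  also have "\<dots> = g + (s * q * \<theta> v + (\<Sum>u\<in>set vs. c u * \<theta> u))"
    using 2(1) by (simp add: s_def algebra_simps)
  finally have a: "(\<Prod>u\<in>set (v # vs). I u ^ (k(v := k0)) u) * f =
      g + (\<Sum>u\<in>set (v # vs). (c(v := s * q)) u * \<theta> u)"
    unfolding p1 p2 .
  have "vars (I u ^ k u) \<subseteq> V" if "u \<in> set vs" for u
    using vars_power[of "I u" "k u"] Cons.prems(2)[of u] tri_vars[OF t that] that by fastforce
  then have "vars s \<subseteq> V" unfolding s_def by (rule vars_prod)
  then have b: "\<forall>u\<in>set (v # vs). vars ((c(v := s * q)) u) \<subseteq> vars f \<union> V"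
    using vars_mult[of s q] 1(3,4) 2(3) by (simp add: subset_iff) blast
  have c: "vars g \<subseteq> vars f \<union> V" using 2(2) 1(3) by blast
  have d: "\<forall>u\<in>set (v # vs). degb u (D u) g"
    using 2(4) 2(5)[rule_format, OF _ 1(2)] by simp
  have e: "\<forall>w n. w \<notin> V \<longrightarrow> degb w n f \<longrightarrow> degb w n g" using 1(5) 2(5) by simp
  show ?case
    by (rule exI[of _ "k(v := k0)"], rule exI[of _ "c(v := s * q)"], rule exI[of _ g])
       (intro conjI a b c d e)
qed

text \<open>The equations are solved from the end of the list. A new value for \<open>v\<close>
  affects neither the equations after it, which do not contain \<open>v\<close>, nor the
  coefficients \<open>S\<close>, which live on the set \<open>B\<close> where the point is
  kept.\<close>

lemma tri_solve_linear:
  fixes a :: "'v \<Rightarrow> 'a::field"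
  assumes "tri V vs \<theta>"
    and "\<And>v. v \<in> set vs \<Longrightarrow> v \<notin> B \<and> \<theta> v = S v * pvar v + G v \<and> vars (S v) \<subseteq> B \<and> v \<notin> vars (G v)
      \<and> poly_eval (\<lambda>c. c) a (S v) \<noteq> 0"
  shows "\<exists>a'. (\<forall>w\<in>B. a' w = a w) \<and> (\<forall>v\<in>set vs. poly_eval (\<lambda>c. c) a' (\<theta> v) = 0)"
  using assms
proof (induction vs arbitrary: V)
  case (Cons v vs)
  have t: "tri (V - {v}) vs \<theta>" using Cons.prems by simp
  obtain a' where a': "\<And>w. w \<in> B \<Longrightarrow> a' w = a w" "\<And>v. v \<in> set vs \<Longrightarrow> poly_eval (\<lambda>c. c) a' (\<theta> v) = 0"
  proof -
    have "\<exists>a'. (\<forall>w\<in>B. a' w = a w) \<and> (\<forall>v\<in>set vs. poly_eval (\<lambda>c. c) a' (\<theta> v) = 0)"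
      by (rule Cons.IH[OF t]) (rule Cons.prems(2), simp)
    then show thesis using that by blast
  qed
  note h = rhom_id[where 'a = 'a]
  have v: "v \<notin> B" "\<theta> v = S v * pvar v + G v" "vars (S v) \<subseteq> B" "v \<notin> vars (G v)"
    "poly_eval (\<lambda>c. c) a (S v) \<noteq> 0" using Cons.prems(2)[of v] by auto
  let ?s = "poly_eval (\<lambda>c. c) a (S v)" let ?g = "poly_eval (\<lambda>c. c) a' (G v)"
  define a'' where "a'' = a'(v := - ?g / ?s)"
  have B: "a'' w = a w" if "w \<in> B" for w using that v(1) a'(1) by (auto simp: a''_def)
  have 1: "poly_eval (\<lambda>c. c) a'' (S v) = ?s" by (rule poly_eval_cong) (use B v(3) in auto)
  have 2: "poly_eval (\<lambda>c. c) a'' (G v) = ?g" by (rule poly_eval_cong) (use v(4) in \<open>auto simp: a''_def\<close>)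
  have "poly_eval (\<lambda>c. c) a'' (\<theta> v) = ?s * a'' v + ?g"
    unfolding v(2) poly_eval_add[OF h] poly_eval_mult[OF h] poly_eval_pvar[OF h] 1 2 ..
  then have 3: "poly_eval (\<lambda>c. c) a'' (\<theta> v) = 0" using v(5) by (simp add: a''_def)
  have "poly_eval (\<lambda>c. c) a'' (\<theta> u) = 0" if "u \<in> set vs" for u
  proof -
    have "poly_eval (\<lambda>c. c) a'' (\<theta> u) = poly_eval (\<lambda>c. c) a' (\<theta> u)"
      by (rule poly_eval_cong) (use tri_vars[OF t that] in \<open>auto simp: a''_def\<close>)
    then show ?thesis using a'(2)[OF that] by simp
  qed
  then show ?case using B 3 by auto
qed auto


subsection \<open>Chains of prime ideals\<close>

text \<open>Splits off the terms free of \<open>v\<close> and divides the rest by \<open>v\<close>,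
  which lowers the degree bound by one; \<open>chain_independent\<close> descends along it.\<close>

lemma split_low:
  fixes f :: "('v, 'a::comm_ring_1) mpoly"
  shows "degb v (Suc n) f \<Longrightarrow> \<exists>f0 f1. f = f0 + pvar v * f1 \<and> vars f0 \<subseteq> vars f - {v} \<and>
    vars f1 \<subseteq> vars f \<and> degb v n f1"
proof (induction n arbitrary: f)
  case 0
  then have vf: "v \<notin> vars f" by (simp add: degb_1_iff)
  show ?case by (rule exI[of _ f], rule exI[of _ 0]) (simp add: vf)
next
  case (Suc n)
  define c where "c = coeff_in v (Suc n) f"
  obtain f' where f': "f = c * pvar v ^ Suc n + f'" "degb v (Suc n) f'" "vars f' \<subseteq> vars f"
    by (rule coeff_in_split[OF Suc.prems]) (rule that[unfolded c_def])
  obtain f0 f1 where f01: "f' = f0 + pvar v * f1" "vars f0 \<subseteq> vars f' - {v}"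
    "vars f1 \<subseteq> vars f'" "degb v n f1"
    using Suc.IH[OF f'(2)] by blast
  have vc: "vars c \<subseteq> vars f - {v}" unfolding c_def by (rule vars_coeff_in)
  have "f = f0 + pvar v * (c * pvar v ^ n + f1)"
    using f'(1) f01(1) by (simp add: algebra_simps)
  moreover have "degb v (Suc n) (c * pvar v ^ n + f1)"
    using vc degb_mono[OF f01(4)] by (intro degb_add degb_mult_free degb_pvar_power) auto
  moreover have "vars (c * pvar v ^ n + f1) \<subseteq> vars f"
  \<comment> \<open>For \<open>c = 0\<close> the power of \<open>v\<close> disappears, while
    \<open>c \<noteq> 0\<close> forces \<open>v\<close> to occur in \<open>f\<close>; either way no
    new indeterminate enters.\<close>
  proof (cases "c = 0")
    case False
    have "v \<in> vars f"
    proof (rule ccontr)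
      assume "v \<notin> vars f"
      then have "lookup t v \<noteq> Suc n" if "t \<in> keys f" for t using that by (auto simp: vars_iff)
      then have "{t \<in> keys f. lookup t v = Suc n} = {}" by blast
      then have "c = 0" unfolding c_def coeff_in_def by (simp only: sum.empty)
      then show False using False by simp
    qed
    then show ?thesis
      using vars_add[of "c * pvar v ^ n" f1] vars_mult[of c "pvar v ^ n"] vc f01(3) f'(3)
        vars_pvar_power[of v n, where 'a = 'a] by blast
  qed (use f01(3) f'(3) in auto)
  ultimately show ?case using f01(2) f'(3) by blast
qed

text \<open>Let \<open>h \<in> q\<close> have least degree in \<open>v\<close> among the elements with leading coefficient outside \<open>q\<close>, and
  let \<open>f \<in> q' - q\<close> have least degree in \<open>v\<close>. Were the contractions equal, pseudo-division of the one of
  higher degree by the other would contradict minimality.\<close>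

lemma incomparable:
  fixes q q' :: "('v, 'a::comm_ring_1) mpoly set"
  assumes q: "prime_in UNIV V q" and q': "prime_in UNIV V q'" and sub: "q \<subset> q'" and v: "v \<in> V"
    and \<theta>: "\<theta> \<in> q" "partial v \<theta> \<notin> q'"
  shows "q \<inter> polys UNIV (V - {v}) \<subset> q' \<inter> polys UNIV (V - {v})"
proof (rule ccontr)
  assume "\<not> ?thesis"
  then have eq: "f \<in> q \<longleftrightarrow> f \<in> q'" if "vars f \<subseteq> V - {v}" for f
    using sub that polys_UNIV[of f "V - {v}"] by blast
  let ?G = "\<lambda>n. \<exists>c g'. c * pvar v ^ n + g' \<in> q \<and> degb v n g' \<and> vars c \<subseteq> V - {v} \<and> vars g' \<subseteq> V \<and> c \<notin> q"
  have exG: "\<exists>n. ?G n"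
  proof -
    \<comment> \<open>Existence is read off from an element of \<open>q\<close> of least degree in
      \<open>v\<close> with derivative outside \<open>q\<close>: were its leading coefficient in
      \<open>q\<close>, dropping the leading term would leave an element of smaller degree with the
      same property.\<close>
    let ?T = "\<lambda>n. \<exists>g\<in>q. degb v (Suc n) g \<and> partial v g \<notin> q"
    have T: "\<exists>n. ?T n" using \<theta> sub degb_deg_in[of v \<theta>] by blast
    define n where "n = (LEAST n. ?T n)"
    obtain g where g: "g \<in> q" "degb v (Suc n) g" "partial v g \<notin> q"
      using LeastI_ex[OF T] n_def by blast
    define c where "c = coeff_in v n g"
    obtain g' where g': "g = c * pvar v ^ n + g'" "degb v n g'" "vars g' \<subseteq> vars g"
      by (rule coeff_in_split[OF g(2)]) (rule that[unfolded c_def])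
    have vg: "vars g \<subseteq> V" using prime_in_vars[OF q g(1)] .
    have vc: "vars c \<subseteq> V - {v}" using vars_coeff_in[of v n g] vg unfolding c_def by blast
    have "c \<notin> q"
    proof
      assume c: "c \<in> q"
      have vp: "vars (pvar v ^ n :: ('v, 'a) mpoly) \<subseteq> V"
        using vars_pvar_power[of v n, where 'a = 'a] v by blast
      then have 1: "pvar v ^ n * c \<in> q" using prime_in_mult'[OF q c] by blast
      then have 2: "g' \<in> q" using prime_in_diff[OF q g(1) 1] g'(1) by (simp add: mult.commute)
      have "partial v c = 0" using vc by (intro partial_notin_vars) auto
      then have "partial v g = partial v (pvar v ^ n) * c + partial v g'"
        by (subst g'(1)) (simp add: partial_add partial_mult mult.commute)
      moreover have "partial v (pvar v ^ n) * c \<in> q"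
        using vp vars_partial[of v "pvar v ^ n :: ('v, 'a) mpoly"] by (intro prime_in_mult'[OF q c]) blast
      ultimately have 3: "partial v g' \<notin> q" using g(3) prime_in_add[OF q] by metis
      show False
      proof (cases n)
        case 0
        then have "g' = 0" using g'(2) by (simp add: degb_0_iff)
        then show False using 3 prime_in_0[OF q] by simp
      next
        case (Suc m)
        then have "?T m" using 2 3 g'(2) by blast
        then show False using Suc not_less_Least[of m ?T] n_def by simp
      qed
    qed
    then show ?thesis using g(1) g' vg vc by (intro exI[of _ n] exI[of _ c] exI[of _ g']) auto
  qed
  define n where "n = (LEAST n. ?G n)"
  obtain c g' where g: "c * pvar v ^ n + g' \<in> q" "degb v n g'" "vars c \<subseteq> V - {v}" "vars g' \<subseteq> V" "c \<notin> q"
    using LeastI_ex[OF exG] n_def by blast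
  have minG: "\<not> ?G m" if "m < n" for m using that not_less_Least[of m ?G] n_def by blast
  let ?K = "\<lambda>k. \<exists>f\<in>q' - q. degb v (Suc k) f"
  have exK: "\<exists>k. ?K k"
  proof -
    obtain f where "f \<in> q' - q" using sub by blast
    then show ?thesis using degb_deg_in[of v f] by blast
  qed
  define k where "k = (LEAST k. ?K k)"
  obtain f where f: "f \<in> q'" "f \<notin> q" "degb v (Suc k) f"
    using LeastI_ex[OF exK] k_def by blast
  have minK': "f \<in> q" if "f \<in> q'" "degb v k f" for f
  proof (cases k)
    case 0
    then show ?thesis using that(2) prime_in_0[OF q] by (simp add: degb_0_iff)
  next
    case (Suc m)
    have "\<not> ?K m" by (rule not_less_Least) (simp add: k_def[symmetric] Suc)
    then show ?thesis using that Suc by blast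
  qed
  define e where "e = coeff_in v k f"
  obtain f' where f': "f = e * pvar v ^ k + f'" "degb v k f'" "vars f' \<subseteq> vars f"
    by (rule coeff_in_split[OF f(3)]) (rule that[unfolded e_def])
  have vf: "vars f \<subseteq> V" using prime_in_vars[OF q' f(1)] .
  have ve: "vars e \<subseteq> V - {v}" using vars_coeff_in[of v k f] vf unfolding e_def by blast
  have vp: "vars (pvar v ^ i :: ('v, 'a) mpoly) \<subseteq> V" for i
    using vars_pvar_power[of v i, where 'a = 'a] v by blast
  \<comment> \<open>The assumed equality of the contractions enters here. As \<open>e\<close> is
    free of \<open>v\<close>, \<open>e \<in> q'\<close> gives \<open>e \<in> q\<close>; then
    \<open>f'\<close> has smaller degree and lies in \<open>q'\<close>, hence in \<open>q\<close>,
    and so does \<open>f\<close>.\<close>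
  have eq': "e \<notin> q'"
  proof
    assume e: "e \<in> q'"
    then have e': "e \<in> q" using eq[OF ve] by blast
    have "f' = f - pvar v ^ k * e" using f'(1) by (simp add: mult.commute)
    then have "f' \<in> q'" using prime_in_diff[OF q' f(1) prime_in_mult'[OF q' e vp]] by simp
    then have "f' \<in> q" using minK' f'(2) by blast
    then have "f \<in> q"
      using prime_in_add[OF q prime_in_mult'[OF q e' vp[of k]], of f'] f'(1) by (simp add: mult.commute)
    then show False using f(2) by blast
  qed
  then have eq0: "e \<notin> q" using sub by blast
  have k0: "k \<noteq> 0"
  proof
    assume "k = 0"
    then have "f = e" using f'(1,2) by (simp add: degb_0_iff)
    then show False using f(1) eq' by blast
  qed
  have cq': "c \<notin> q'" using g(3,5) eq by blast
  have cV: "vars c \<subseteq> V" and eV: "vars e \<subseteq> V" using g(3) ve by auto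
  define h where "h = c * pvar v ^ n + g'"
  have hq: "h \<in> q" using g(1) h_def by simp
  show False
  proof (cases "n \<le> k")
    case True
    have p: "pvar v ^ k = (pvar v ^ (k - n) * pvar v ^ n :: ('v, 'a) mpoly)"
      using True by (simp flip: power_add)
    \<comment> \<open>The combination \<open>c * f - (e * pvar v ^ (k - n)) * h\<close> lies in
      \<open>q'\<close> and has degree below \<open>k\<close>, hence lies in \<open>q\<close>. Then
      \<open>c * f\<close> is in \<open>q\<close>, although neither factor is.\<close>
    define f1 where "f1 = c * f' - e * pvar v ^ (k - n) * g'"
    have f1: "f1 = c * f - (e * pvar v ^ (k - n)) * h"
      by (simp add: f1_def f'(1) h_def p algebra_simps)
    have ve2: "vars (e * pvar v ^ (k - n)) \<subseteq> V" using vars_mult[of e "pvar v ^ (k - n)"] eV vp by blast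
    have "f1 \<in> q'"
      unfolding f1 using hq sub
      by (intro prime_in_diff[OF q'] prime_in_mult'[OF q'] f(1) cV ve2) blast
    moreover have "degb v k f1"
    proof -
      have "degb v (Suc (k - n)) (e * pvar v ^ (k - n))"
        using ve by (intro degb_mult_free degb_pvar_power) auto
      from degb_mult[OF this g(2)] have 1: "degb v k (e * pvar v ^ (k - n) * g')"
        using True by simp
      have "v \<notin> vars c" using g(3) by blast
      from degb_diff[OF degb_mult_free[OF this f'(2)] 1] show ?thesis unfolding f1_def .
    qed
    ultimately have "f1 \<in> q" using minK' by blast
    then have "f1 + (e * pvar v ^ (k - n)) * h \<in> q"
      by (intro prime_in_add[OF q] prime_in_mult'[OF q hq] ve2)
    then have "c * f \<in> q" by (simp add: f1)
    then show False using prime_in_prime'[OF q _ cV vf] g(5) f(2) by blast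
  next
    case False
    then have kn: "k < n" by simp
    have p: "pvar v ^ n = (pvar v ^ (n - k) * pvar v ^ k :: ('v, 'a) mpoly)"
      using kn by (simp flip: power_add)
    \<comment> \<open>Now a multiple of \<open>h\<close> is divided by \<open>f\<close>. The
      remainder has degree below \<open>k\<close> and lies in \<open>q'\<close>, hence in
      \<open>q\<close>; primality puts the quotient \<open>s'\<close> into \<open>q\<close>. Its
      degree \<open>n - k\<close> and leading coefficient \<open>e ^ j * c\<close> outside
      \<open>q\<close> contradict the choice of \<open>n\<close>.\<close>
    define g1 where "g1 = e * g' - c * pvar v ^ (n - k) * f'"
    have e1: "e * h = c * pvar v ^ (n - k) * f + g1"
      by (simp add: g1_def f'(1) h_def p algebra_simps)
    have vc2: "vars (c * pvar v ^ (n - k)) \<subseteq> V" using vars_mult[of c "pvar v ^ (n - k)"] cV vp by blast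
    have "degb v (Suc (n - k)) (c * pvar v ^ (n - k))"
      using g(3) by (intro degb_mult_free degb_pvar_power) auto
    from degb_mult[OF this f'(2)] have d: "degb v n (c * pvar v ^ (n - k) * f')" using kn by simp
    have vne: "v \<notin> vars e" using ve by blast
    from degb_diff[OF degb_mult_free[OF vne g(2)] d] have dg1: "degb v n g1" unfolding g1_def .
    have vf': "vars f' \<subseteq> V" using f'(3) vf by blast
    have vg1: "vars g1 \<subseteq> V"
      using vars_diff[of "e * g'" "c * pvar v ^ (n - k) * f'"] vars_mult[of e g']
        vars_mult[of "c * pvar v ^ (n - k)" f'] eV g(4) vc2 vf' unfolding g1_def by blast
    obtain j s r where 1: "e ^ j * g1 = s * f + r" "degb v k r" "degb v (n - k) s" "vars s \<subseteq> vars g1 \<union> V"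
      using pseudo_division[OF vne f'(1,2) eV vf' v dg1] by blast
    have vs: "vars s \<subseteq> V" using 1(4) vg1 by blast
    define s' where "s' = e ^ j * c * pvar v ^ (n - k) + s"
    have ej: "vars (e ^ j) \<subseteq> V - {v}" using vars_power[of e j] ve by blast
    have "e ^ Suc j * h = e ^ j * (e * h)" by (simp add: mult_ac)
    also have "\<dots> = e ^ j * c * pvar v ^ (n - k) * f + e ^ j * g1" unfolding e1 by (simp add: algebra_simps)
    also have "\<dots> = s' * f + r" unfolding 1(1) s'_def by (simp add: algebra_simps)
    finally have 2: "e ^ Suc j * h = s' * f + r" .
    have ecV: "vars (e ^ j * c) \<subseteq> V - {v}" using vars_mult[of "e ^ j" c] ej g(3) by blast
    have vs': "vars s' \<subseteq> V"
      using vars_add[of "e ^ j * c * pvar v ^ (n - k)" s] vars_mult[of "e ^ j * c" "pvar v ^ (n - k)"]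
        ecV vp vs unfolding s'_def by blast
    have ehq: "e ^ Suc j * h \<in> q"
      using vars_power[of e "Suc j"] eV by (intro prime_in_mult'[OF q hq]) blast
    have "r = e ^ Suc j * h - s' * f" using 2 by simp
    moreover have "e ^ Suc j * h - s' * f \<in> q'"
      using ehq sub by (intro prime_in_diff[OF q'] prime_in_mult'[OF q' f(1) vs']) blast
    ultimately have "r \<in> q" using minK' 1(2) by blast
    then have "s' * f \<in> q" using prime_in_diff[OF q ehq, of r] 2 by simp
    then have "s' \<in> q" using prime_in_prime'[OF q _ vs' vf] f(2) by blast
    moreover have "e ^ j * c \<notin> q"
      using prime_in_prime'[OF q, of "e ^ j" c] prime_in_power_notin[OF q eq0 eV, of j] g(5) ej cV by blast
    ultimately have "?G (n - k)"
      unfolding s'_def using 1(3) vs ecV by blast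
    then show False using minG[of "n - k"] k0 kn by simp
  qed
qed

lemma prime_in_contract:
  assumes "prime_in UNIV V q" "W \<subseteq> V"
  shows "prime_in UNIV W (q \<inter> polys UNIV W)"
proof -
  note s = subr_polys[OF subr_UNIV, of W]
  have sub: "f \<in> polys UNIV V" if "f \<in> polys UNIV W" for f :: "('b, 'a) mpoly"
    using that assms(2) polys_UNIV[of f V] polys_UNIV[of f W] by blast
  show ?thesis
    unfolding prime_in_def
    by (intro conjI ballI impI IntI)
       (auto intro: subr_0[OF s] subr_add[OF s] subr_mult[OF s] prime_in_0[OF assms(1)]
          prime_in_add[OF assms(1)] prime_in_mult[OF assms(1)] sub
          simp: prime_in_1[OF assms(1)] dest!: prime_in_prime[OF assms(1) _ sub sub])
qed

section \<open>Algebraic dependence by counting monomials, and the length of chains of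
  primes\<close>

lemma linear_dependence:
  fixes u :: "'i \<Rightarrow> 'j \<Rightarrow> 'a::field"
  assumes "finite J" "finite I" "card J < card I"
  shows "\<exists>c. (\<exists>i\<in>I. c i \<noteq> 0) \<and> (\<forall>j\<in>J. (\<Sum>i\<in>I. c i * u i j) = 0)"
  using assms
proof (induction J arbitrary: I u rule: finite_induct)
  case empty
  then have "I \<noteq> {}" by auto
  then show ?case by (intro exI[of _ "\<lambda>_. 1"]) auto
next
  case (insert j J)
  show ?case
  proof (cases "\<exists>i0\<in>I. u i0 j \<noteq> 0")
    case False
    obtain c where "\<exists>i\<in>I. c i \<noteq> 0" "\<forall>j\<in>J. (\<Sum>i\<in>I. c i * u i j) = 0"
      using insert.IH[of I u] insert.prems insert.hyps by auto
    then show ?thesis using False by (intro exI[of _ c]) auto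
  next
    case True
    then obtain i0 where i0: "i0 \<in> I" "u i0 j \<noteq> 0" by blast
    let ?I = "I - {i0}"
    let ?u = "\<lambda>i j'. u i j' - u i j / u i0 j * u i0 j'"
    obtain c where c: "\<exists>i\<in>?I. c i \<noteq> 0" "\<forall>j\<in>J. (\<Sum>i\<in>?I. c i * ?u i j) = 0"
    proof -
      have "card J < card ?I" using insert.prems insert.hyps i0 by (simp add: card_Diff_singleton)
      then show thesis using insert.IH[of ?I ?u] insert.prems(1) that by blast
    qed
    \<comment> \<open>The value at \<open>i0\<close> is dictated by equation \<open>j\<close>; the
      coefficients \<open>?u\<close> arise from the other equations by substituting it.\<close>
    define c' where "c' = c(i0 := - (\<Sum>i\<in>?I. c i * u i j / u i0 j))"
    have 1: "(\<Sum>i\<in>I. c' i * u i j') = (\<Sum>i\<in>?I. c i * ?u i j')" for j'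
    proof -
      have "(\<Sum>i\<in>I. c' i * u i j') = c' i0 * u i0 j' + (\<Sum>i\<in>?I. c' i * u i j')"
        using i0 insert.prems by (simp add: sum.remove)
      also have "(\<Sum>i\<in>?I. c' i * u i j') = (\<Sum>i\<in>?I. c i * u i j')"
        by (intro sum.cong) (auto simp: c'_def)
      also have "c' i0 * u i0 j' = - (\<Sum>i\<in>?I. c i * (u i j / u i0 j * u i0 j'))"
        by (simp add: c'_def sum_distrib_right mult.assoc)
      finally show ?thesis by (simp add: algebra_simps sum_subtractf)
    qed
    have "(\<Sum>i\<in>?I. c i * ?u i j) = 0" using i0 by simp
    then have "\<forall>j'\<in>insert j J. (\<Sum>i\<in>I. c' i * u i j') = 0" using 1 c(2) by simp
    moreover have "\<exists>i\<in>I. c' i \<noteq> 0" using c(1) by (auto simp: c'_def)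
    ultimately show ?thesis by blast
  qed
qed

lemma card_exponents:
  assumes "finite A"
  shows "card {t :: 'v \<Rightarrow>\<^sub>0 nat. keys t \<subseteq> A \<and> (\<forall>v. lookup t v < Suc M)} = Suc M ^ card A" (is "card ?T = _")
    and "finite {t :: 'v \<Rightarrow>\<^sub>0 nat. keys t \<subseteq> A \<and> (\<forall>v. lookup t v < Suc M)}"
proof -
  have "bij_betw (\<lambda>t. restrict (lookup t) A) ?T (A \<rightarrow>\<^sub>E {..<Suc M})"
  proof (rule bij_betwI')
    fix s t assume st: "s \<in> ?T" "t \<in> ?T"
    have "s = t" if "restrict (lookup s) A = restrict (lookup t) A"
    proof (rule poly_mapping_eqI)
      fix v
      show "lookup s v = lookup t v"
      proof (cases "v \<in> A")
        case True
        then show ?thesis using fun_cong[OF that, of v] by simp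
      next
        case False
        then have "v \<notin> keys s" "v \<notin> keys t" using st by auto
        then show ?thesis by (simp add: in_keys_iff)
      qed
    qed
    then show "(restrict (lookup s) A = restrict (lookup t) A) = (s = t)" by blast
  next
    fix g assume g: "g \<in> A \<rightarrow>\<^sub>E {..<Suc M}"
    let ?t = "Abs_poly_mapping (\<lambda>v. if v \<in> A then g v else 0)"
    have l: "lookup ?t = (\<lambda>v. if v \<in> A then g v else 0)"
      by (rule lookup_Abs_poly_mapping) (use assms in \<open>auto intro: finite_subset[of _ A]\<close>)
    have "?t \<in> ?T" using g by (auto simp: l in_keys_iff PiE_def Pi_def split: if_splits)
    moreover have "g = restrict (lookup ?t) A" using g by (auto simp: l PiE_def extensional_def)
    ultimately show "\<exists>t\<in>?T. g = restrict (lookup t) A" by blast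
  qed auto
  from bij_betw_same_card[OF this] bij_betw_finite[OF this] assms
  show "card ?T = Suc M ^ card A" "finite ?T" by (simp_all add: card_PiE finite_PiE)
qed

lemma degb_prod:
  "(\<And>x. x \<in> A \<Longrightarrow> degb v (Suc (e x)) (f x)) \<Longrightarrow> degb v (Suc (sum e A)) (prod f A)"
proof (induction A rule: infinite_finite_induct)
  case (insert x A)
  then show ?case using degb_mult[of v "e x" "f x" "Suc (sum e A)" "prod f A"] by simp
qed (simp_all add: degb_1_iff)

lemma degb_power: "degb v (Suc e) f \<Longrightarrow> degb v (Suc (e * n)) (f ^ n)"
proof (induction n)
  case (Suc n)
  then show ?case using degb_mult[of v e f "Suc (e * n)" "f ^ n"] by simp
qed (simp add: degb_1_iff)

text \<open>For large \<open>N\<close> there are more monomials in the \<open>g j\<close> with exponents at most \<open>N\<close> than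
  monomials in the indeterminates \<open>V\<close> that can occur in them.\<close>

lemma algebraic_dependence:
  fixes g :: "nat \<Rightarrow> ('v, 'a::field) mpoly"
  assumes V: "finite V" and g: "\<And>j. j \<le> card V \<Longrightarrow> vars (g j) \<subseteq> V"
  shows "\<exists>F. F \<noteq> 0 \<and> vars F \<subseteq> {..card V} \<and> poly_eval pconst g F = 0"
proof -
  let ?d = "card V" let ?n = "Suc ?d"
  define C where "C = (\<Sum>j\<le>?d. \<Sum>v\<in>V. deg_in v (g j))"
  have C: "degb v (Suc C) (g j)" if "j \<le> ?d" "v \<in> V" for j v
  proof -
    have "deg_in v (g j) \<le> (\<Sum>v\<in>V. deg_in v (g j))"
      by (rule member_le_sum) (use that V in auto)
    also have "\<dots> \<le> C" unfolding C_def
      by (rule member_le_sum) (use that in auto)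
    finally show ?thesis using degb_mono[OF degb_deg_in[of v "g j"]] by simp
  qed
  \<comment> \<open>A product of the \<open>g j\<close> with exponents at most \<open>N\<close> has
    degree below \<open>A * Suc N\<close> in each indeterminate. This leaves at most
    \<open>A ^ ?d * Suc N ^ ?d\<close> monomials, and the choice \<open>N = A ^ ?d\<close> makes
    this less than the \<open>Suc N ^ Suc ?d\<close> products.\<close>
  define A where "A = Suc (C * ?n)"
  define N where "N = A ^ ?d"
  define I where "I = {t :: nat \<Rightarrow>\<^sub>0 nat. keys t \<subseteq> {..?d} \<and> (\<forall>v. lookup t v < Suc N)}"
  define J where "J = {t :: 'v \<Rightarrow>\<^sub>0 nat. keys t \<subseteq> V \<and> (\<forall>v. lookup t v < Suc (C * (?n * N)))}"
  have I: "card I = Suc N ^ ?n" "finite I"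
    unfolding I_def using card_exponents[of "{..?d}" N] by simp_all
  have J: "card J = Suc (C * (?n * N)) ^ ?d" "finite J"
    unfolding J_def using card_exponents[OF V] by simp_all
  have "Suc (C * (?n * N)) \<le> A * Suc N"
    by (simp add: A_def algebra_simps)
  then have "card J \<le> (A * Suc N) ^ ?d" unfolding J by (rule power_mono) simp
  also have "\<dots> = N * Suc N ^ ?d" by (simp only: power_mult_distrib N_def)
  also have "\<dots> < card I" unfolding I by simp
  finally have lt: "card J < card I" .
  have keysJ: "keys (mon_eval g t) \<subseteq> J" if "t \<in> I" for t
  proof
    fix s assume s: "s \<in> keys (mon_eval g t)"
    have kt: "keys t \<subseteq> {..?d}" using that by (simp add: I_def)
    have "vars (mon_eval g t) \<subseteq> V"
      unfolding mon_eval_def using g kt vars_power by (intro vars_prod) fast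
    then have sV: "keys s \<subseteq> V" using s by (auto simp: vars_def)
    have "lookup s v < Suc (C * (?n * N))" for v
    proof (cases "v \<in> V")
      case True
      have "degb v (Suc (\<Sum>j\<in>keys t. C * lookup t j)) (mon_eval g t)"
        unfolding mon_eval_def using C True kt by (intro degb_prod degb_power) auto
      then have "lookup s v \<le> (\<Sum>j\<in>keys t. C * lookup t j)" using s by (auto simp: degb_def)
      also have "\<dots> \<le> (\<Sum>j\<in>keys t. C * N)"
        using that by (intro sum_mono) (auto simp: I_def less_Suc_eq_le)
      also have "\<dots> = card (keys t) * (C * N)" by simp
      also have "\<dots> \<le> ?n * (C * N)"
        by (rule mult_le_mono1) (use card_mono[OF _ kt] in simp)
      finally show ?thesis by (simp add: algebra_simps)
    next
      case False
      then have "lookup s v = 0" using sV by (auto simp: in_keys_iff)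
      then show ?thesis by simp
    qed
    then show "s \<in> J" using sV by (simp add: J_def)
  qed
  obtain c where c: "\<exists>t\<in>I. c t \<noteq> 0" "\<And>s. s \<in> J \<Longrightarrow> (\<Sum>t\<in>I. c t * lookup (mon_eval g t) s) = 0"
    using linear_dependence[OF J(2) I(2) lt, of "\<lambda>t s. lookup (mon_eval g t) s"] by blast
  define F where "F = (\<Sum>t\<in>I. single t (c t))"
  have lF: "lookup F t = c t" if "t \<in> I" for t
    using that I(2) by (simp add: F_def lookup_sum lookup_single when_def)
  have "F \<noteq> 0" using c(1) lF by auto
  moreover have "vars F \<subseteq> {..?d}"
    unfolding F_def by (rule vars_sum) (use vars_single in \<open>fastforce simp: I_def\<close>)
  moreover have "poly_eval pconst g F = 0"
  proof (rule poly_mapping_eqI)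
    fix s
    have "poly_eval pconst g F = (\<Sum>t\<in>I. pconst (c t) * mon_eval g t)"
      unfolding F_def by (simp only: rhom_sum[OF rhom_poly_eval[OF rhom_pconst]] poly_eval_single[OF rhom_pconst])
    then have 1: "lookup (poly_eval pconst g F) s = (\<Sum>t\<in>I. c t * lookup (mon_eval g t) s)"
      by (auto simp: lookup_sum mult_map_scale_conv_mult[symmetric] map.rep_eq when_def intro!: sum.cong)
    show "lookup (poly_eval pconst g F) s = lookup 0 s"
    proof (cases "s \<in> J")
      case False
      then have "lookup (mon_eval g t) s = 0" if "t \<in> I" for t using keysJ[OF that] by (auto simp: in_keys_iff)
      then show ?thesis by (simp add: 1)
    qed (simp add: 1 c(2))
  qed
  ultimately show ?thesis by blast
qed

text \<open>If \<open>F (g) \<in> p k\<close>, the part of \<open>F\<close> free of the indeterminate \<open>k\<close> evaluates into \<open>p (k + 1)\<close>,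
  hence is zero, and a factor \<open>g k \<notin> p k\<close> can be divided out.\<close>

lemma chain_independent:
  fixes p :: "nat \<Rightarrow> ('v, 'a::field) mpoly set"
  assumes p: "\<And>i. i \<le> l \<Longrightarrow> prime_in UNIV V (p i)" and g: "\<And>i. i < l \<Longrightarrow> g i \<in> p (Suc i) - p i"
    and sub: "\<And>i. i < l \<Longrightarrow> p i \<subseteq> p (Suc i)"
  shows "k \<le> l \<Longrightarrow> vars F \<subseteq> {k..<l} \<Longrightarrow> poly_eval pconst g F \<in> p k \<Longrightarrow> F = 0"
proof (induction k arbitrary: F rule: inc_induct)
  case base
  then have "F = pconst (lookup F 0)" by (intro vars_empty_imp_pconst) simp
  then have "pconst (lookup F 0) \<in> p l"
    using base(2) poly_eval_pconst[OF rhom_pconst] by metis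
  then have "lookup F 0 = 0" by (rule prime_in_pconst[OF p[OF order_refl]])
  then show ?case using \<open>F = pconst _\<close> by simp
next
  case (step k)
  have gk: "g k \<in> p (Suc k)" "g k \<notin> p k" using g step.hyps by auto
  have pk: "prime_in UNIV V (p k)" and psk: "prime_in UNIV V (p (Suc k))" using p step.hyps by auto
  have vg: "vars (g i) \<subseteq> V" if "i < l" for i
    using g[OF that] prime_in_vars[OF p[of "Suc i"]] that by auto
  have vsub: "vars (poly_eval pconst g G) \<subseteq> V" if "vars G \<subseteq> {k..<l}" for G
    by (rule vars_poly_eval_subst[OF that]) (use vg in auto)
  \<comment> \<open>Inner induction on the degree in the indeterminate \<open>k\<close>: each round
    divides out one factor \<open>g k\<close>.\<close>
  have "F = 0" if "degb k n F" "vars F \<subseteq> {k..<l}" "poly_eval pconst g F \<in> p k" for n F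
    using that
  proof (induction n arbitrary: F)
    case (Suc n)
    obtain F0 F1 where F: "F = F0 + pvar k * F1" "vars F0 \<subseteq> vars F - {k}" "vars F1 \<subseteq> vars F" "degb k n F1"
      using split_low[OF Suc.prems(1)] by blast
    let ?s = "poly_eval pconst g"
    have e: "?s F = ?s F0 + g k * ?s F1"
      unfolding F(1) poly_eval_add[OF rhom_pconst] poly_eval_mult[OF rhom_pconst] poly_eval_pvar[OF rhom_pconst] ..
    have v1: "vars (?s F1) \<subseteq> V" using vsub F(3) Suc.prems(2) by blast
    have "?s F1 * g k \<in> p (Suc k)" by (rule prime_in_mult'[OF psk gk(1) v1])
    moreover have "?s F \<in> p (Suc k)" using Suc.prems(3) sub step.hyps by blast
    ultimately have "?s F - ?s F1 * g k \<in> p (Suc k)" by (intro prime_in_diff[OF psk])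
    then have "?s F0 \<in> p (Suc k)" by (simp add: e mult.commute)
    moreover have "vars F0 \<subseteq> {Suc k..<l}" using F(2) Suc.prems(2) by force
    ultimately have F0: "F0 = 0" using step.IH by blast
    then have "g k * ?s F1 \<in> p k" using e Suc.prems(3) by simp
    then have "?s F1 \<in> p k"
      using prime_in_prime'[OF pk, of "g k" "?s F1"] gk(2) v1 vg step.hyps by blast
    then have "F1 = 0" using Suc.IH F(3,4) Suc.prems(2) by blast
    then show ?case using F(1) F0 by simp
  qed (simp add: degb_0_iff)
  from this[OF degb_deg_in] show ?case using step.prems by blast
qed

text \<open>One element chosen from each step of the chain gives algebraically independent
  polynomials by \<open>chain_independent\<close>, whereas \<open>card V + 1\<close> polynomials in
  \<open>V\<close> are dependent.\<close>

lemma chain_length_le_card: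
  fixes p :: "nat \<Rightarrow> ('v, 'a::field) mpoly set"
  assumes V: "finite V" and p: "\<And>i. i \<le> l \<Longrightarrow> prime_in UNIV V (p i)" and sub: "\<And>i. i < l \<Longrightarrow> p i \<subset> p (Suc i)"
  shows "l \<le> card V"
proof (rule ccontr)
  assume l: "\<not> l \<le> card V"
  have "\<forall>i. \<exists>g. i < l \<longrightarrow> g \<in> p (Suc i) - p i" using sub by blast
  then obtain g where g: "\<And>i. i < l \<Longrightarrow> g i \<in> p (Suc i) - p i" by metis
  have vg: "vars (g i) \<subseteq> V" if "i \<le> card V" for i
    using g[of i] prime_in_vars[OF p[of "Suc i"]] that l by auto
  have "\<exists>F. F \<noteq> 0 \<and> vars F \<subseteq> {..card V} \<and> poly_eval pconst g F = 0"
    by (rule algebraic_dependence[OF V]) (rule vg)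
  then obtain F where F: "F \<noteq> 0" "vars F \<subseteq> {..card V}" "poly_eval pconst g F = 0"
    by - (elim exE conjE, rule that)
  have "vars F \<subseteq> {0..<l}"
  proof
    fix x assume "x \<in> vars F"
    then have "x \<le> card V" using F(2) by blast
    then show "x \<in> {0..<l}" using l by simp
  qed
  then have "F = 0"
  proof (intro chain_independent[of l V p g 0])
    show "poly_eval pconst g F \<in> p 0"
      using prime_in_0[OF p[of 0]] F(3) by simp
    show "p i \<subseteq> p (Suc i)" if "i < l" for i using sub[OF that] by blast
  qed (use p g in auto)
  then show False using F(1) by blast
qed

text \<open>Each main indeterminate is removed by contracting the whole chain. By
  \<open>incomparable\<close> the inclusions stay strict, since the derivative of
  \<open>\<theta> v\<close> is outside the larger ideal. What remains is a chain in fewer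
  indeterminates.\<close>

lemma chain_length_le:
  fixes p :: "nat \<Rightarrow> ('v, 'a::field) mpoly set"
  assumes "finite V" "tri V vs \<theta>" "\<And>i. i \<le> l \<Longrightarrow> prime_in UNIV V (p i)" "\<And>i. i < l \<Longrightarrow> p i \<subset> p (Suc i)"
    and "\<And>v i. v \<in> set vs \<Longrightarrow> i \<le> l \<Longrightarrow> \<theta> v \<in> p i \<and> partial v (\<theta> v) \<notin> p i"
  shows "l + length vs \<le> card V"
  using assms
proof (induction vs arbitrary: V p)
  case Nil
  then show ?case using chain_length_le_card[of V l p] by simp
next
  case (Cons v vs)
  let ?V = "V - {v}"
  have v: "v \<in> V" and t: "tri ?V vs \<theta>" using Cons.prems(2) by auto
  have "l + length vs \<le> card ?V"
  proof (rule Cons.IH[of _ "\<lambda>i. p i \<inter> polys UNIV ?V"])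
    show "prime_in UNIV ?V (p i \<inter> polys UNIV ?V)" if "i \<le> l" for i
      by (rule prime_in_contract[OF Cons.prems(3)[OF that]]) blast
    show "p i \<inter> polys UNIV ?V \<subset> p (Suc i) \<inter> polys UNIV ?V" if "i < l" for i
      using Cons.prems(5)[of v] that
      by (intro incomparable[OF Cons.prems(3,3) Cons.prems(4)[OF that] v, of "\<theta> v"]) auto
    show "\<theta> u \<in> p i \<inter> polys UNIV ?V \<and> partial u (\<theta> u) \<notin> p i \<inter> polys UNIV ?V"
      if "u \<in> set vs" "i \<le> l" for u i
      using that Cons.prems(5)[of u i] tri_vars[OF t, of u] polys_UNIV by auto
  qed (use Cons.prems(1) t in auto)
  moreover have "card V = Suc (card ?V)" using v Cons.prems(1) by (metis card_Suc_Diff1)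
  ultimately show ?case by simp
qed

lemma pconst_eq_0_iff [simp]: "pconst c = 0 \<longleftrightarrow> c = 0"
  by (metis lookup_single_eq lookup_zero single_zero)

lemma pvar_neq_0: "(pvar v :: ('v, 'a::comm_ring_1) mpoly) \<noteq> 0"
  by (metis vars_pvar vars_0 insert_not_empty)

subsection \<open>Jacobian rank of a triangular system\<close>

lemma lookup_gradient: "lookup (gradient a f) v = poly_eval (\<lambda>c. c) a (partial v f)"
proof -
  have "lookup (gradient a f) v = (\<Sum>w\<in>vars f. (poly_eval (\<lambda>c. c) a (partial w f) when w = v))"
    by (simp add: gradient_def lookup_sum lookup_single)
  also have "\<dots> = poly_eval (\<lambda>c. c) a (partial v f)"
    by (cases "v \<in> vars f") (simp_all add: when_def partial_notin_vars)
  finally show ?thesis .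
qed

lemma lookup_map_mult:
  fixes x :: "'v \<Rightarrow>\<^sub>0 'a::semiring_0"
  shows "lookup (Poly_Mapping.map ((*) c) x) v = c * lookup x v"
  by (simp add: map.rep_eq when_def)

lemma vector_space_poly_mapping:
  "vector_space (\<lambda>c :: 'a::field. Poly_Mapping.map ((*) c) :: ('v \<Rightarrow>\<^sub>0 'a) \<Rightarrow> _)"
  by unfold_locales
     (auto intro!: poly_mapping_eqI simp: lookup_map_mult lookup_add algebra_simps)

text \<open>The gradients of the \<open>\<theta> v\<close> span all gradients of \<open>P\<close>:
  in the derivative of \<open>s * f = (\<Sum>v\<in>set vs. c v * \<theta> v)\<close> at
  \<open>a\<close> the values of \<open>f\<close> and of the \<open>\<theta> v\<close> vanish, so
  \<open>s\<close> and the \<open>c v\<close> enter only through their values, and that of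
  \<open>s\<close> is invertible.\<close>

lemma jacobian_rank_tri:
  fixes a :: "'v \<Rightarrow> 'a::field"
  assumes t: "tri V vs \<theta>" and in_P: "\<And>v. v \<in> set vs \<Longrightarrow> \<theta> v \<in> P"
    and van: "\<And>f. f \<in> P \<Longrightarrow> poly_eval (\<lambda>c. c) a f = 0"
    and sep: "\<And>v. v \<in> set vs \<Longrightarrow> poly_eval (\<lambda>c. c) a (partial v (\<theta> v)) \<noteq> 0"
    and gen: "\<And>f. f \<in> P \<Longrightarrow> \<exists>s c. poly_eval (\<lambda>c. c) a s \<noteq> 0 \<and> s * f = (\<Sum>v\<in>set vs. c v * \<theta> v)"
  shows "jacobian_rank P a = length vs"
proof -
  let ?sc = "\<lambda>c :: 'a. Poly_Mapping.map ((*) c) :: ('v \<Rightarrow>\<^sub>0 'a) \<Rightarrow> _"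
  interpret L: vector_space ?sc by (rule vector_space_poly_mapping)
  let ?E = "poly_eval (\<lambda>c. c) a"
  have E: "rhom ?E" by (rule rhom_poly_eval[OF rhom_id])
  define G where "G v = gradient a (\<theta> v)" for v
  have indep: "L.independent (G ` set us) \<and> card (G ` set us) = length us"
    if "tri U us \<theta>" "set us \<subseteq> set vs" for U us
    using that
  proof (induction us arbitrary: U)
    case Nil
    then show ?case using L.independent_empty by simp
  next
    case (Cons v us)
    have tu: "tri (U - {v}) us \<theta>" using Cons.prems by simp
    have IH: "L.independent (G ` set us)" "card (G ` set us) = length us"
      using Cons.IH[OF tu] Cons.prems by auto
    \<comment> \<open>The main indeterminate \<open>v\<close> does not occur in the later equations,
      so the coordinate \<open>v\<close> vanishes on the span of their gradients.\<close>
    have zero: "lookup x v = 0" if "x \<in> L.span (G ` set us)" for x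
      using that
    proof (induction rule: L.span_induct)
      case base
      then show ?case
        by (auto simp: L.subspace_def lookup_add lookup_map_mult)
    next
      case (step x)
      then obtain u where u: "u \<in> set us" "x = G u" by blast
      have "v \<notin> vars (\<theta> u)" using tri_vars[OF tu u(1)] by blast
      then show ?case by (simp add: u(2) G_def lookup_gradient partial_notin_vars)
    qed
    have "lookup (G v) v \<noteq> 0" using sep Cons.prems by (simp add: G_def lookup_gradient)
    then have nin: "G v \<notin> L.span (G ` set us)" using zero by blast
    then have "G v \<notin> G ` set us" using L.span_base by blast
    then show ?case
      using L.independent_insertI[OF nin IH(1)] IH(2) by simp
  qed
  have "L.dim (gradient a ` P) = length vs"
  proof (rule L.dim_unique)
    show "G ` set vs \<subseteq> gradient a ` P" using in_P by (auto simp: G_def)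
    show "gradient a ` P \<subseteq> L.span (G ` set vs)"
    proof
      fix x assume "x \<in> gradient a ` P"
      then obtain f where f: "f \<in> P" "x = gradient a f" by blast
      obtain s c where s: "?E s \<noteq> 0" "s * f = (\<Sum>v\<in>set vs. c v * \<theta> v)" using gen[OF f(1)] by blast
      have "x = (\<Sum>v\<in>set vs. ?sc (?E (c v) / ?E s) (G v))"
      proof (rule poly_mapping_eqI)
        fix w
        have "?E (partial w (s * f)) = ?E s * ?E (partial w f)"
          using van[OF f(1)] by (simp add: partial_mult rhom_add[OF E] rhom_mult[OF E])
        moreover have "?E (partial w (s * f)) = (\<Sum>v\<in>set vs. ?E (c v) * ?E (partial w (\<theta> v)))"
          unfolding s(2) partial_sum rhom_sum[OF E]
          by (rule sum.cong[OF refl]) (simp add: partial_mult rhom_add[OF E] rhom_mult[OF E] van in_P)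
        ultimately have "?E (partial w f) = (\<Sum>v\<in>set vs. ?E (c v) * ?E (partial w (\<theta> v))) / ?E s"
          using s(1) by (simp add: field_simps)
        then show "lookup x w = lookup (\<Sum>v\<in>set vs. ?sc (?E (c v) / ?E s) (G v)) w"
          by (simp add: f(2) lookup_sum lookup_map_mult lookup_gradient G_def sum_divide_distrib)
      qed
      then show "x \<in> L.span (G ` set vs)"
        by (simp only:) (intro L.span_sum L.span_scale L.span_base imageI)
    qed
  qed (use indep[OF t] in auto)
  then show ?thesis by (simp add: jacobian_rank_def)
qed


subsection \<open>Power series points\<close>

lemma fps_X_power_dvd_iff:
  fixes f :: "'c::comm_ring_1 fps"
  shows "fps_X ^ n dvd f \<longleftrightarrow> (\<forall>i<n. fps_nth f i = 0)"
proof
  assume "fps_X ^ n dvd f"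
  then show "\<forall>i<n. fps_nth f i = 0" by (auto simp: fps_X_power_mult_nth)
next
  assume "\<forall>i<n. fps_nth f i = 0"
  then have "f = fps_X ^ n * fps_shift n f"
    by (intro fps_ext) (auto simp: fps_X_power_mult_nth)
  then show "fps_X ^ n dvd f" by (rule dvdI)
qed

text \<open>Newton iteration with the fixed multiplier \<open>u\<close> in place of the inverse of
  the current derivative; each step gains one power of the series variable, which suffices. The
  coefficients form only a ring, so the inverse is part of the data.\<close>

lemma hensel_fps:
  fixes h :: "'a::comm_ring_1 \<Rightarrow> 'c::comm_ring_1 fps"
  assumes h: "rhom h"
    and root: "fps_nth (poly_eval h (b(v := fps_const x0)) f) 0 = 0"
    and unit: "fps_nth (poly_eval h (b(v := fps_const x0)) (partial v f)) 0 * u = 1"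
  shows "\<exists>x. fps_nth x 0 = x0 \<and> poly_eval h (b(v := x)) f = 0"
proof -
  define F where "F x = poly_eval h (b(v := x)) f" for x
  define F' where "F' x = poly_eval h (b(v := x)) (partial v f)" for x
  have taylor: "\<exists>R. F (x + e) = F x + e * F' x + e\<^sup>2 * R" for x e
    unfolding F_def F'_def by (rule poly_eval_taylor[OF h])
  have taylor': "\<exists>R. F' (x + e) = F' x + e * R" for x e
  proof -
    obtain R where "F' (x + e) = F' x + e * poly_eval h (b(v := x)) (partial v (partial v f)) + e\<^sup>2 * R"
      unfolding F'_def using poly_eval_taylor[OF h, of b v x e "partial v f"] by blast
    then show ?thesis
      by (intro exI[of _ "poly_eval h (b(v := x)) (partial v (partial v f)) + e * R"])
         (simp add: algebra_simps power2_eq_square)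
  qed
  define xs where "xs = rec_nat (fps_const x0) (\<lambda>_ x. x - fps_const u * F x)"
  have xs0: "xs 0 = fps_const x0" and xsS: "xs (Suc n) = xs n - fps_const u * F (xs n)" for n
    by (simp_all add: xs_def)
  have inv: "fps_X ^ Suc n dvd F (xs n) \<and> fps_nth (xs n) 0 = x0" for n
  proof (induction n)
    case 0
    then show ?case using root by (simp add: xs0 F_def fps_X_power_dvd_iff[of 1, simplified])
  next
    case (Suc n)
    let ?x = "xs n"
    have F0: "fps_nth (F ?x) 0 = 0" 
      using Suc fps_X_power_dvd_iff[of "Suc n" "F ?x"] zero_less_Suc[of n] by blast
    obtain R' where "F' (fps_const x0 + (?x - fps_const x0)) = F' (fps_const x0) + (?x - fps_const x0) * R'"
      using taylor' by blast
    then have "fps_nth (F' ?x) 0 = fps_nth (F' (fps_const x0)) 0" using Suc by simp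
    then have "fps_nth (1 - fps_const u * F' ?x) 0 = 0"
      using unit by (simp add: F'_def mult.commute)
    moreover have "fps_X dvd g \<longleftrightarrow> fps_nth g 0 = 0" for g :: "'c fps"
      using fps_X_power_dvd_iff[of 1 g] by simp
    ultimately have d1: "fps_X dvd 1 - fps_const u * F' ?x" by blast
    obtain R where "F (?x + - (fps_const u * F ?x)) =
        F ?x + - (fps_const u * F ?x) * F' ?x + (- (fps_const u * F ?x))\<^sup>2 * R"
      using taylor by blast
    \<comment> \<open>The first summand gains a power because \<open>1 - fps_const u * F' ?x\<close>
      has zero constant term, the second because it is quadratic in \<open>F ?x\<close>.\<close>
    then have eq: "F (xs (Suc n)) = F ?x * (1 - fps_const u * F' ?x) + F ?x * F ?x * (fps_const u * fps_const u * R)"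
      by (simp add: xsS power2_eq_square algebra_simps del: fps_const_mult)
    have dF: "fps_X ^ Suc n dvd F ?x" using Suc by blast
    have 1: "fps_X ^ Suc (Suc n) dvd F ?x * (1 - fps_const u * F' ?x)"
      using mult_dvd_mono[OF dF d1] by (simp add: mult.commute)
    have "fps_X dvd F ?x" using F0 fps_X_power_dvd_iff[of 1 "F ?x"] by simp
    then have "fps_X ^ Suc (Suc n) dvd F ?x * F ?x"
      using mult_dvd_mono[OF dF] by (simp add: mult.commute)
    then have "fps_X ^ Suc (Suc n) dvd F (xs (Suc n))"
      unfolding eq by (rule dvd_add[OF 1 dvd_mult2])
    moreover have "fps_nth (xs (Suc n)) 0 = x0" using Suc F0 by (simp add: xsS)
    ultimately show ?case by blast
  qed
  have stable: "fps_nth (xs (n + m)) k = fps_nth (xs n) k" if "k \<le> n" for n m k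
  proof (induction m)
    case (Suc m)
    have "fps_X ^ Suc (n + m) dvd fps_const u * F (xs (n + m))"
      using inv[of "n + m"] by (simp add: dvd_mult)
    then have "fps_nth (fps_const u * F (xs (n + m))) k = 0"
      using that by (simp only: fps_X_power_dvd_iff; simp)
    then show ?case using Suc by (simp add: xsS)
  qed simp
  \<comment> \<open>The limit is taken coefficientwise: coefficient \<open>k\<close> no longer
    changes from \<open>xs k\<close> on.\<close>
  define x where "x = Abs_fps (\<lambda>k. fps_nth (xs k) k)"
  have "F x = 0"
  proof (rule fps_ext)
    fix n
    have "fps_nth (x - xs n) k = 0" if "k \<le> n" for k
      using stable[of k k "n - k"] that by (simp add: x_def)
    then have d: "fps_X ^ Suc n dvd x - xs n" by (simp only: fps_X_power_dvd_iff; simp)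
    obtain R where "F (xs n + (x - xs n)) = F (xs n) + (x - xs n) * F' (xs n) + (x - xs n)\<^sup>2 * R"
      using taylor by blast
    then have "F x = F (xs n) + (x - xs n) * (F' (xs n) + (x - xs n) * R)"
      by (simp add: power2_eq_square algebra_simps)
    then have "fps_X ^ Suc n dvd F x"
      using inv[of n] d by (simp add: dvd_add dvd_mult2)
    then show "fps_nth (F x) n = fps_nth 0 n" by (simp only: fps_X_power_dvd_iff; simp)
  qed
  moreover have "fps_nth x 0 = x0" using inv[of 0] by (simp add: x_def)
  ultimately show ?thesis unfolding F_def by blast
qed

lemma rhom_fps_nth_0: "rhom (\<lambda>x. fps_nth x 0)"
  by (simp add: rhom_def)

lemma rhom_fps_const: "rhom fps_const"
  by (simp add: rhom_def fps_const_add[symmetric] fps_const_mult[symmetric] del: fps_const_add fps_const_mult)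

lemma rhom_fps_map:
  fixes \<sigma> :: "'a::comm_ring_1 \<Rightarrow> 'c::comm_ring_1"
  assumes "rhom \<sigma>"
  shows "rhom (\<lambda>F. Abs_fps (\<lambda>n. \<sigma> (fps_nth F n)))"
  unfolding rhom_def
proof (intro conjI allI)
  show "Abs_fps (\<lambda>n. \<sigma> (fps_nth 1 n)) = 1"
    by (rule fps_ext) (auto simp: rhom_0 rhom_1 assms)
  fix x y
  show "Abs_fps (\<lambda>n. \<sigma> (fps_nth (x + y) n)) = Abs_fps (\<lambda>n. \<sigma> (fps_nth x n)) + Abs_fps (\<lambda>n. \<sigma> (fps_nth y n))"
    by (rule fps_ext) (simp add: rhom_add[OF assms])
  show "Abs_fps (\<lambda>n. \<sigma> (fps_nth (x * y) n)) = Abs_fps (\<lambda>n. \<sigma> (fps_nth x n)) * Abs_fps (\<lambda>n. \<sigma> (fps_nth y n))"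
    by (rule fps_ext) (simp add: fps_mult_nth rhom_sum[OF assms] rhom_mult[OF assms])
qed

text \<open>Power series in one indeterminate over a polynomial ring suffice: along the curves
  \<open>a + s y\<close> the polynomial indeterminates \<open>y\<close> serve as free parameters.\<close>

lemma tri_hensel:
  fixes a :: "'v \<Rightarrow> 'a::field" and b0 :: "'v \<Rightarrow> (nat, 'a) mpoly fps"
  assumes "tri V vs \<theta>" and b0: "\<And>w. fps_nth (b0 w) 0 = pconst (a w)"
    and "\<And>v. v \<in> set vs \<Longrightarrow> poly_eval (\<lambda>c. c) a (\<theta> v) = 0 \<and> poly_eval (\<lambda>c. c) a (partial v (\<theta> v)) \<noteq> 0"
  shows "\<exists>b. (\<forall>w. fps_nth (b w) 0 = pconst (a w)) \<and> (\<forall>w. w \<notin> set vs \<longrightarrow> b w = b0 w) \<and>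
    (\<forall>v\<in>set vs. poly_eval (\<lambda>c. fps_const (pconst c)) b (\<theta> v) = 0)"
  using assms(1,3)
proof (induction vs arbitrary: V)
  case Nil
  then show ?case using b0 by auto
next
  case (Cons v vs)
  let ?h = "\<lambda>c :: 'a. fps_const (pconst c :: (nat, 'a) mpoly)"
  have h: "rhom ?h" by (rule rhom_comp[OF rhom_fps_const rhom_pconst])
  have t: "tri (V - {v}) vs \<theta>" using Cons.prems by simp
  have "\<exists>b. (\<forall>w. fps_nth (b w) 0 = pconst (a w)) \<and> (\<forall>w. w \<notin> set vs \<longrightarrow> b w = b0 w) \<and>
    (\<forall>v\<in>set vs. poly_eval ?h b (\<theta> v) = 0)"
    by (rule Cons.IH[OF t]) (rule Cons.prems(2), simp)
  then obtain b where b: "\<And>w. fps_nth (b w) 0 = pconst (a w)" "\<And>w. w \<notin> set vs \<Longrightarrow> b w = b0 w"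
    "\<And>v. v \<in> set vs \<Longrightarrow> poly_eval ?h b (\<theta> v) = 0" by blast
  \<comment> \<open>Taking constant terms commutes with evaluation, which turns the hypotheses of
    \<open>hensel_fps\<close> into statements at \<open>a\<close>. The derivative at
    \<open>a\<close> is a nonzero field element, so it is invertible in the polynomial ring of
    parameters as well.\<close>
  have const: "fps_nth (poly_eval ?h b' f) 0 = pconst (poly_eval (\<lambda>c. c) a f)"
    if "\<And>w. fps_nth (b' w) 0 = pconst (a w)" for b' f
    unfolding poly_eval_comp[OF h rhom_fps_nth_0] poly_eval_comp[OF rhom_id rhom_pconst]
    by (simp add: that)
  let ?b = "b(v := fps_const (pconst (a v)))"
  have b': "fps_nth (?b w) 0 = pconst (a w)" for w using b(1) by simp
  have va: "poly_eval (\<lambda>c. c) a (\<theta> v) = 0" "poly_eval (\<lambda>c. c) a (partial v (\<theta> v)) \<noteq> 0"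
    using Cons.prems(2)[of v] by auto
  have "\<exists>x. fps_nth x 0 = pconst (a v) \<and> poly_eval ?h (b(v := x)) (\<theta> v) = 0"
  proof (rule hensel_fps[OF h])
    show "fps_nth (poly_eval ?h ?b (\<theta> v)) 0 = 0"
      unfolding const[of ?b, OF b'] by (simp add: va)
    show "fps_nth (poly_eval ?h ?b (partial v (\<theta> v))) 0 *
        pconst (inverse (poly_eval (\<lambda>c. c) a (partial v (\<theta> v)))) = 1"
      unfolding const[of ?b, OF b'] by (simp add: va mult_single)
  qed
  then obtain x where x: "fps_nth x 0 = pconst (a v)" "poly_eval ?h (b(v := x)) (\<theta> v) = 0" by blast
  define b1 where "b1 = b(v := x)"
  have b1: "fps_nth (b1 w) 0 = pconst (a w)" "w \<noteq> v \<Longrightarrow> b1 w = b w" for w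
    using b(1) x(1) by (auto simp: b1_def)
  have "poly_eval ?h b1 (\<theta> u) = 0" if "u \<in> set vs" for u
  proof -
    have "poly_eval ?h b1 (\<theta> u) = poly_eval ?h b (\<theta> u)"
      by (rule poly_eval_cong) (use tri_vars[OF t that] b1(2) in auto)
    then show ?thesis using b(3)[OF that] by simp
  qed
  moreover have "poly_eval ?h b1 (\<theta> v) = 0" using x(2) by (simp only: b1_def)
  ultimately show ?case using b1 b(2) by (intro exI[of _ b1]) auto
qed

section \<open>Dimension and smoothness at a point of a triangular system\<close>

lemma prime_in_kernel:
  fixes \<psi> :: "('v, 'a::comm_ring_1) mpoly \<Rightarrow> 'c::idom"
  assumes \<psi>: "rhom \<psi>"
  shows "prime_in UNIV V {f \<in> polys UNIV V. \<psi> f = 0}"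
proof -
  note s = subr_polys[OF subr_UNIV, of V]
  show ?thesis
    unfolding prime_in_def
    by (auto simp: rhom_0[OF \<psi>] rhom_1[OF \<psi>] rhom_add[OF \<psi>] rhom_mult[OF \<psi>]
        intro: subr_0[OF s] subr_add[OF s] subr_mult[OF s])
qed

text \<open>The indeterminates outside \<open>vs\<close> move along lines through \<open>a\<close>,
  each with its own parameter, and \<open>tri_hensel\<close> supplies the main ones. Specializing
  parameters to zero enlarges the kernel of evaluation. The constant term stays the point
  \<open>a\<close>, so every kernel lies in the maximal ideal of \<open>a\<close>.\<close>

lemma tri_chain:
  fixes a :: "'v \<Rightarrow> 'a::field"
  assumes V: "finite V" and t: "tri V vs \<theta>" and P: "P \<subseteq> polys UNIV V"
    and in_P: "\<And>v. v \<in> set vs \<Longrightarrow> \<theta> v \<in> P"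
    and van: "\<And>f. f \<in> P \<Longrightarrow> poly_eval (\<lambda>c. c) a f = 0"
    and sep: "\<And>v. v \<in> set vs \<Longrightarrow> poly_eval (\<lambda>c. c) a (partial v (\<theta> v)) \<noteq> 0"
    and gen: "\<And>f. f \<in> P \<Longrightarrow> \<exists>s c. poly_eval (\<lambda>c. c) a s \<noteq> 0 \<and> s * f = (\<Sum>v\<in>set vs. c v * \<theta> v)"
  shows "\<exists>Q. (\<forall>i. prime_in UNIV V (Q i) \<and> P \<subseteq> Q i \<and> Q i \<subseteq> {f. poly_eval (\<lambda>c. c) a f = 0}) \<and>
    (\<forall>i < card V - length vs. Q i \<subset> Q (Suc i))"
proof -
  let ?W = "V - set vs"
  have card: "card ?W = card V - length vs"
    using tri_subset[OF t] distinct_card[OF tri_distinct[OF t]] V by (simp add: card_Diff_subset)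
  obtain \<beta> where \<beta>: "bij_betw \<beta> ?W {0..<card ?W}" using ex_bij_betw_finite_nat[of ?W] V by blast
  define b0 :: "'v \<Rightarrow> (nat, 'a) mpoly fps"
    where "b0 w = fps_const (pconst (a w)) + (if w \<in> ?W then fps_X * fps_const (pvar (\<beta> w)) else 0)" for w
  let ?h = "\<lambda>c :: 'a. fps_const (pconst c :: (nat, 'a) mpoly)"
  have h: "rhom ?h" by (rule rhom_comp[OF rhom_fps_const rhom_pconst])
  have "\<exists>b. (\<forall>w. fps_nth (b w) 0 = pconst (a w)) \<and> (\<forall>w. w \<notin> set vs \<longrightarrow> b w = b0 w) \<and>
    (\<forall>v\<in>set vs. poly_eval ?h b (\<theta> v) = 0)"
    by (rule tri_hensel[OF t]) (use van in_P sep in \<open>auto simp: b0_def\<close>)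
  then obtain b where b: "\<And>w. fps_nth (b w) 0 = pconst (a w)" "\<And>w. w \<notin> set vs \<Longrightarrow> b w = b0 w"
    "\<And>v. v \<in> set vs \<Longrightarrow> poly_eval ?h b (\<theta> v) = 0" by blast
  define \<phi> where "\<phi> = poly_eval ?h b"
  have \<phi>: "rhom \<phi>" unfolding \<phi>_def by (rule rhom_poly_eval[OF h])
  have const: "fps_nth (\<phi> f) 0 = pconst (poly_eval (\<lambda>c. c) a f)" for f
    unfolding \<phi>_def poly_eval_comp[OF h rhom_fps_nth_0] poly_eval_comp[OF rhom_id rhom_pconst]
    by (simp add: b(1))
  \<comment> \<open>The series value of \<open>s\<close> has nonzero constant term, and power series
    over a polynomial ring form a domain, so \<open>s\<close> can be cancelled.\<close>
  have \<phi>P: "\<phi> f = 0" if f: "f \<in> P" for f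
  proof -
    obtain s c where s: "poly_eval (\<lambda>c. c) a s \<noteq> 0" "s * f = (\<Sum>v\<in>set vs. c v * \<theta> v)"
      using gen[OF f] by blast
    have "\<phi> s * \<phi> f = \<phi> (s * f)" by (simp add: rhom_mult[OF \<phi>])
    also have "\<dots> = (\<Sum>v\<in>set vs. \<phi> (c v) * \<phi> (\<theta> v))"
      unfolding s(2) by (simp add: rhom_sum[OF \<phi>] rhom_mult[OF \<phi>])
    also have "\<dots> = 0" using b(3) by (intro sum.neutral) (simp add: \<phi>_def)
    finally have "\<phi> s = 0 \<or> \<phi> f = 0" by simp
    moreover have "\<phi> s \<noteq> 0"
    proof
      assume "\<phi> s = 0"
      then have "lookup (pconst (poly_eval (\<lambda>c. c) a s) :: (nat, 'a) mpoly) 0 = 0" using const[of s] by simp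
      then show False using s(1) by simp
    qed
    ultimately show ?thesis by blast
  qed
  define \<sigma> :: "nat \<Rightarrow> (nat, 'a) mpoly \<Rightarrow> (nat, 'a) mpoly"
    where "\<sigma> i = poly_eval pconst (\<lambda>j. if j < i then 0 else pvar j)" for i
  have \<sigma>: "rhom (\<sigma> i)" for i unfolding \<sigma>_def by (rule rhom_poly_eval[OF rhom_pconst])
  have \<sigma>_pvar: "\<sigma> i (pvar j) = (if j < i then 0 else pvar j)" for i j
    unfolding \<sigma>_def by (rule poly_eval_pvar[OF rhom_pconst])
  have \<sigma>_pconst: "\<sigma> i (pconst c) = pconst c" for i c
    unfolding \<sigma>_def by (rule poly_eval_pconst[OF rhom_pconst])
  \<comment> \<open>Specializing in stages is the same as specializing at once; this makes the
    kernels increase.\<close>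
  have \<sigma>\<sigma>: "\<sigma> (Suc i) (\<sigma> i g) = \<sigma> (Suc i) g" for i g
  proof -
    have "\<sigma> (Suc i) (\<sigma> i g) = poly_eval pconst (\<lambda>j. \<sigma> (Suc i) (if j < i then 0 else pvar j)) g"
      unfolding \<sigma>_def by (rule poly_eval_subst[OF rhom_pconst])
    also have "(\<lambda>j. \<sigma> (Suc i) (if j < i then 0 else pvar j)) = (\<lambda>j. if j < Suc i then 0 else pvar j)"
      by (rule ext) (simp add: \<sigma>_pvar rhom_0[OF \<sigma>])
    finally show ?thesis by (simp add: \<sigma>_def)
  qed
  define \<rho> where "\<rho> i F = Abs_fps (\<lambda>n. \<sigma> i (fps_nth F n))" for i F
  have \<rho>: "rhom (\<rho> i)" for i unfolding \<rho>_def by (rule rhom_fps_map[OF \<sigma>])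
  \<comment> \<open>\<open>Q i\<close> is the ideal of the power series point after specializing the parameters \<open>j < i\<close> to \<open>0\<close>.\<close>
  define Q where "Q i = {f \<in> polys UNIV V. \<rho> i (\<phi> f) = 0}" for i
  have "prime_in UNIV V (Q i)" for i
    unfolding Q_def by (rule prime_in_kernel) (rule rhom_comp[OF \<rho> \<phi>])
  moreover have "P \<subseteq> Q i" for i
    using P \<phi>P by (auto simp: Q_def rhom_0[OF \<rho>])
  moreover have "Q i \<subseteq> {f. poly_eval (\<lambda>c. c) a f = 0}" for i
  proof safe
    fix f assume "f \<in> Q i"
    then have "fps_nth (\<rho> i (\<phi> f)) 0 = 0" by (simp add: Q_def)
    then show "poly_eval (\<lambda>c. c) a f = 0" by (simp add: \<rho>_def const \<sigma>_pconst)
  qed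
  moreover have "Q i \<subset> Q (Suc i)" if i: "i < card V - length vs" for i
  proof -
    have "\<rho> (Suc i) (\<rho> i F) = \<rho> (Suc i) F" for F
      by (rule fps_ext) (simp add: \<rho>_def \<sigma>\<sigma>)
    then have "\<rho> (Suc i) F = 0" if "\<rho> i F = 0" for F
      using that rhom_0[OF \<rho>, of "Suc i"] by metis
    then have "Q i \<subseteq> Q (Suc i)"
      unfolding Q_def by blast
    moreover have "\<exists>f. f \<in> Q (Suc i) \<and> f \<notin> Q i"
    proof -
      obtain w where w: "w \<in> ?W" "\<beta> w = i" 
      proof -
        have "i \<in> \<beta> ` ?W" using \<beta> i card by (simp add: bij_betw_def)
        then show thesis using that by blast
      qed
      \<comment> \<open>The displacement of the coordinate \<open>w\<close> is the series variable
        times the parameter \<open>i\<close>, which survives at stage \<open>i\<close> and is killed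
        at stage \<open>Suc i\<close>.\<close>
      let ?f = "pvar w - pconst (a w)"
      have "b w = fps_const (pconst (a w)) + fps_X * fps_const (pvar i)" using b(2)[of w] w by (simp add: b0_def)
      then have f: "\<phi> ?f = fps_X * fps_const (pvar i)"
        by (simp add: rhom_diff[OF \<phi>]) (simp add: \<phi>_def poly_eval_pvar[OF h] poly_eval_pconst[OF h])
      have "vars ?f \<subseteq> V" using vars_diff[of "pvar w" "pconst (a w)"] w by (auto simp: vars_pvar)
      then have fV: "?f \<in> polys UNIV V" by (simp add: polys_UNIV)
      have "\<rho> (Suc i) (\<phi> ?f) = 0"
        unfolding f \<rho>_def by (rule fps_ext) (simp add: \<sigma>_pvar rhom_0[OF \<sigma>])
      moreover have "fps_nth (\<rho> i (\<phi> ?f)) 1 \<noteq> 0"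
        unfolding f \<rho>_def by (simp add: \<sigma>_pvar pvar_neq_0)
      then have "\<rho> i (\<phi> ?f) \<noteq> 0" by (metis fps_zero_nth)
      ultimately show ?thesis using fV unfolding Q_def by blast
    qed
    ultimately show ?thesis by blast
  qed
  ultimately show ?thesis by blast
qed

lemma local_dim_tri:
  fixes a :: "'v \<Rightarrow> 'a::field"
  assumes V: "finite V" and t: "tri V vs \<theta>" and P: "P \<subseteq> polys UNIV V"
    and in_P: "\<And>v. v \<in> set vs \<Longrightarrow> \<theta> v \<in> P"
    and van: "\<And>f. f \<in> P \<Longrightarrow> poly_eval (\<lambda>c. c) a f = 0"
    and sep: "\<And>v. v \<in> set vs \<Longrightarrow> poly_eval (\<lambda>c. c) a (partial v (\<theta> v)) \<noteq> 0"
    and gen: "\<And>f. f \<in> P \<Longrightarrow> \<exists>s c. poly_eval (\<lambda>c. c) a s \<noteq> 0 \<and> s * f = (\<Sum>v\<in>set vs. c v * \<theta> v)"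
  shows "local_dim V P a = enat (card V - length vs)"
  unfolding local_dim_def primeideal_iff[OF subr_UNIV]
proof (rule antisym)
  let ?chain = "\<lambda>l p. (\<forall>i\<le>l. prime_in UNIV V (p i) \<and> P \<subseteq> p i \<and>
      p i \<subseteq> {f. poly_eval (\<lambda>c. c) a f = 0}) \<and> (\<forall>i<l. p i \<subset> p (Suc i))"
  show "Sup {enat l |l. \<exists>p. ?chain l p} \<le> enat (card V - length vs)"
  proof (rule Sup_least)
    fix x assume "x \<in> {enat l |l. \<exists>p. ?chain l p}"
    then obtain l p where x: "x = enat l" and p: "?chain l p" by blast
    have "l + length vs \<le> card V"
    proof (rule chain_length_le[OF V t, of l p])
      \<comment> \<open>The derivative is nonzero at \<open>a\<close>, hence outside every prime of
        the chain, all of whose elements vanish at \<open>a\<close>.\<close>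
      show "\<theta> v \<in> p i \<and> partial v (\<theta> v) \<notin> p i" if "v \<in> set vs" "i \<le> l" for v i
        using p that in_P[OF that(1)] sep[OF that(1)] by blast
    qed (use p in auto)
    then show "x \<le> enat (card V - length vs)" by (simp add: x)
  qed
  obtain Q where "\<And>i. prime_in UNIV V (Q i) \<and> P \<subseteq> Q i \<and> Q i \<subseteq> {f. poly_eval (\<lambda>c. c) a f = 0}"
    "\<And>i. i < card V - length vs \<Longrightarrow> Q i \<subset> Q (Suc i)"
    using tri_chain[OF V t P in_P van sep gen] by blast
  then have "?chain (card V - length vs) Q" by blast
  then show "enat (card V - length vs) \<le> Sup {enat l |l. \<exists>p. ?chain l p}"
    by (intro Sup_upper) blast
qed

lemma smooth_at_tri:
  fixes a :: "'v \<Rightarrow> 'a::field"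
  assumes V: "finite V" and t: "tri V vs \<theta>" and P: "P \<subseteq> polys UNIV V"
    and in_P: "\<And>v. v \<in> set vs \<Longrightarrow> \<theta> v \<in> P"
    and van: "\<And>f. f \<in> P \<Longrightarrow> poly_eval (\<lambda>c. c) a f = 0"
    and sep: "\<And>v. v \<in> set vs \<Longrightarrow> poly_eval (\<lambda>c. c) a (partial v (\<theta> v)) \<noteq> 0"
    and gen: "\<And>f. f \<in> P \<Longrightarrow> \<exists>s c. poly_eval (\<lambda>c. c) a s \<noteq> 0 \<and> s * f = (\<Sum>v\<in>set vs. c v * \<theta> v)"
  shows "smooth_at V P a"
proof -
  have "length vs \<le> card V"
    using card_mono[OF V tri_subset[OF t]] distinct_card[OF tri_distinct[OF t]] by simp
  moreover have "local_dim V P a = enat (card V - length vs)"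
    by (rule local_dim_tri[OF V t P]) (use in_P van sep gen in auto)
  moreover have "jacobian_rank P a = length vs"
    by (rule jacobian_rank_tri[OF t]) (use in_P van sep gen in auto)
  ultimately show ?thesis unfolding smooth_at_def using van by simp
qed

subsection \<open>The ranking of the indeterminates\<close>

lemma index_order_add: "index_order (\<xi> + \<eta>) = index_order \<xi> + index_order \<eta>"
  by (simp add: index_order_def lookup_add sum.distrib)

lemma index_order_0 [simp]: "index_order 0 = 0"
  by (simp add: index_order_def)

lemma index_order_eq_0_iff: "index_order \<xi> = 0 \<longleftrightarrow> \<xi> = 0"
  by (auto simp: index_order_def poly_mapping_eq_iff fun_eq_iff)

lemma index_order_single: "index_order (single k (1::nat)) = 1"
  by (simp add: index_order_def lookup_single when_def)

lemma multi_index_induct [case_names zero add]: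
  fixes \<xi> :: "'m::finite \<Rightarrow>\<^sub>0 nat"
  assumes "Q 0" "\<And>\<xi> k. Q \<xi> \<Longrightarrow> Q (\<xi> + single k 1)"
  shows "Q \<xi>"
proof (induction "index_order \<xi>" arbitrary: \<xi>)
  case 0
  then show ?case using assms(1) index_order_eq_0_iff[of \<xi>] by simp
next
  case (Suc n)
  then have "\<xi> \<noteq> 0" by auto
  then obtain k where k: "lookup \<xi> k \<noteq> 0" by (auto simp: poly_mapping_eq_iff fun_eq_iff)
  have eq: "\<xi> - single k 1 + single k 1 = \<xi>"
    by (intro poly_mapping_eqI) (use k in \<open>auto simp: lookup_minus lookup_add lookup_single when_def\<close>)
  then have "index_order (\<xi> - single k 1) + 1 = index_order \<xi>"
    using index_order_add[of "\<xi> - single k 1" "single k 1"] index_order_single[of k] by simp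
  then have "Q (\<xi> - single k 1)" using Suc by auto
  then show ?case using assms(2) eq by metis
qed

text \<open>The operator of multi-index \<open>\<eta>\<close> acting on an indeterminate;
  \<open>ind_deriv\<close> is the case of a unit vector.\<close>

definition shift :: "('m \<Rightarrow>\<^sub>0 nat) \<Rightarrow> 'm ind \<Rightarrow> 'm ind" where
  "shift \<eta> v = (fst v, snd v + \<eta>)"

lemma shift_0 [simp]: "shift 0 v = v"
  by (simp add: shift_def)

lemma ind_deriv_shift: "ind_deriv k (shift \<eta> v) = shift (\<eta> + single k 1) v"
  by (simp add: ind_deriv_def shift_def add.assoc)

lemma ind_deriv_eq_shift: "ind_deriv k v = shift (single k 1) v"
  by (simp add: ind_deriv_def shift_def)

lemma proper_derivatives_eq: "proper_derivatives v = {shift \<eta> v | \<eta>. \<eta> \<noteq> 0}"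
  by (simp add: proper_derivatives_def shift_def)

lemma length_ind_key: "length (ind_key (v :: 'm::{finite,linorder} ind)) = Suc (Suc (card (UNIV :: 'm set)))"
  by (simp add: ind_key_def)

lemma ind_key_inj: "ind_key v = ind_key w \<Longrightarrow> v = w"
proof -
  assume "ind_key v = ind_key w"
  then have "fst v = fst w" "\<And>k. lookup (snd v) k = lookup (snd w) k"
    by (auto simp: ind_key_def)
  then show "v = w" by (simp add: prod_eq_iff poly_mapping_eqI)
qed

lemma ind_less_irrefl: "\<not> ind_less v v"
  unfolding ind_less_def by (intro lexord_irreflexive) simp

lemma ind_less_trans: "ind_less u v \<Longrightarrow> ind_less v w \<Longrightarrow> ind_less u w"
  unfolding ind_less_def by (erule lexord_trans) (auto simp: trans_def)

lemma ind_less_total: "v \<noteq> w \<Longrightarrow> ind_less v w \<or> ind_less w v"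
proof -
  assume "v \<noteq> w"
  then have ne: "ind_key v \<noteq> ind_key w" using ind_key_inj by blast
  have "\<forall>a b. (a, b) \<in> {(x, y :: nat). x < y} \<or> a = b \<or> (b, a) \<in> {(x, y). x < y}" by auto
  from lexord_linear[OF this, of "ind_key v" "ind_key w"] ne show ?thesis
    unfolding ind_less_def by blast
qed

lemma ind_less_asym: "ind_less v w \<Longrightarrow> \<not> ind_less w v"
  using ind_less_trans ind_less_irrefl by blast

text \<open>On arbitrary lists \<open>lexord\<close> is not well-founded, but all keys have the same
  length, and there it agrees with the well-founded \<open>lex\<close>.\<close>

lemma wf_ind_less: "wf {(v, w). ind_less v w}"
proof -
  have "wf (inv_image (lex {(x, y :: nat). x < y}) ind_key)"
    by (intro wf_inv_image wf_lex) (rule wf)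
  moreover have "{(v, w). ind_less v w} \<subseteq> inv_image (lex {(x, y :: nat). x < y}) ind_key"
    by (auto simp: ind_less_def lexord_lex length_ind_key)
  ultimately show ?thesis by (rule wf_subset)
qed

lemma ind_less_order: "ind_less v w \<Longrightarrow> index_order (snd v) \<le> index_order (snd w)"
  by (auto simp: ind_less_def ind_key_def)

lemma ind_less_if_order: "index_order (snd v) < index_order (snd w) \<Longrightarrow> ind_less v w"
  by (simp add: ind_less_def ind_key_def)

lemma ind_less_shift: "\<eta> \<noteq> 0 \<Longrightarrow> ind_less v (shift \<eta> v)"
  using index_order_eq_0_iff[of \<eta>]
  by (intro ind_less_if_order) (simp add: shift_def index_order_add)

lemma lexord_map2_add:
  fixes xs ys cs :: "nat list"
  assumes "length xs = length cs" "length ys = length cs" "(xs, ys) \<in> lexord {(x, y). x < y}"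
  shows "(map2 (+) xs cs, map2 (+) ys cs) \<in> lexord {(x, y). x < y}"
  using assms
proof (induction cs arbitrary: xs ys)
  case (Cons c cs)
  then obtain x xs' y ys' where "xs = x # xs'" "ys = y # ys'" by (metis length_Suc_conv)
  then show ?case using Cons by auto
qed simp

lemma ind_key_shift:
  "ind_key (shift \<eta> v) = map2 (+) (ind_key v) (index_order \<eta> # 0 # map (lookup \<eta>) (sorted_list_of_set UNIV))"
proof -
  have "map2 (+) (map f zs) (map g zs) = map (\<lambda>z. f z + g z) zs" for f g :: "'a \<Rightarrow> nat" and zs
    by (induction zs) auto
  then show ?thesis by (simp add: ind_key_def shift_def index_order_add lookup_add)
qed

text \<open>Shifting adds one and the same list to every key (\<open>ind_key_shift\<close>), and
  adding a fixed list entrywise preserves the lexicographic order.\<close>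

lemma ind_less_shift_mono:
  fixes v w :: "'m::{finite,linorder} ind"
  assumes "ind_less v w"
  shows "ind_less (shift \<eta> v) (shift \<eta> w)"
  using assms unfolding ind_less_def ind_key_shift
  by (intro lexord_map2_add) (simp_all add: length_ind_key)

lemma ex_ind_max:
  assumes "finite A" "A \<noteq> {}"
  shows "\<exists>v\<in>A. \<forall>w\<in>A. w \<noteq> v \<longrightarrow> ind_less w v"
  using assms
proof (induction A rule: finite_ne_induct)
  case (insert x A)
  then obtain v where v: "v \<in> A" "\<And>w. w \<in> A \<Longrightarrow> w \<noteq> v \<Longrightarrow> ind_less w v" by blast
  show ?case
  proof (cases "ind_less v x")
    case True
    then have "ind_less w x" if "w \<in> A" for w using v(2)[OF that] ind_less_trans[of w v x] by blast
    then show ?thesis by blast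
  next
    case False
    then have "x = v \<or> ind_less x v" using ind_less_total by blast
    then show ?thesis using v by blast
  qed
qed simp

lemma leader:
  assumes "vars f \<noteq> {}"
  shows leader_in_vars: "leader f \<in> vars f"
    and ind_less_leader: "w \<in> vars f \<Longrightarrow> w \<noteq> leader f \<Longrightarrow> ind_less w (leader f)"
proof -
  obtain v where v: "v \<in> vars f" "\<And>w. w \<in> vars f \<Longrightarrow> w \<noteq> v \<Longrightarrow> ind_less w v"
    using ex_ind_max[OF finite_vars assms] by blast
  have "leader f = v"
    unfolding leader_def
  proof (rule the_equality)
    fix v' assume "v' \<in> vars f \<and> (\<forall>w\<in>vars f. w \<noteq> v' \<longrightarrow> ind_less w v')"
    then show "v' = v" using v(1) v(2)[of v'] ind_less_asym[of v v'] by (cases "v' = v") auto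
  qed (use v in blast)
  then show "leader f \<in> vars f" "w \<in> vars f \<Longrightarrow> w \<noteq> leader f \<Longrightarrow> ind_less w (leader f)"
    using v by auto
qed


subsection \<open>Iterated derivations\<close>

lemma iter_deriv_0 [simp]: "iter_deriv D 0 x = x"
proof -
  have "foldr (\<lambda>k. D k ^^ lookup 0 k) ks x = x" for ks by (induction ks) auto
  then show ?thesis by (simp add: iter_deriv_def)
qed

lemma foldr_closed:
  assumes "\<And>k x. x \<in> A \<Longrightarrow> D k x \<in> A" "x \<in> A"
  shows "foldr (\<lambda>k. D k ^^ e k) ks x \<in> A"
proof (induction ks)
  case (Cons k ks)
  have "(D k ^^ n) y \<in> A" if "y \<in> A" for n y using that by (induction n) (auto intro: assms)
  then show ?case using Cons by simp
qed (simp add: assms)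

lemma iter_deriv_closed:
  assumes "\<And>k x. x \<in> A \<Longrightarrow> D k x \<in> A" "x \<in> A"
  shows "iter_deriv D \<xi> x \<in> A"
  unfolding iter_deriv_def by (rule foldr_closed) (use assms in auto)

text \<open>\<open>iter_deriv\<close> composes in a fixed order, so the additional derivation has to
  be moved to the front. A closed set \<open>A\<close> is kept because in an extension given by a
  record the derivations commute only on the carrier.\<close>

lemma iter_deriv_add_single:
  assumes cl: "\<And>k x. x \<in> A \<Longrightarrow> D k x \<in> A" and comm: "\<And>k l x. x \<in> A \<Longrightarrow> D k (D l x) = D l (D k x)"
    and x: "x \<in> A"
  shows "iter_deriv D (\<xi> + single k 1) x = D k (iter_deriv D \<xi> x)"
proof -
  let ?f = "\<lambda>j. D j ^^ lookup \<xi> j" and ?g = "\<lambda>j. D j ^^ lookup (\<xi> + single k 1) j"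
  have comm_pow: "(D j ^^ n) (D k y) = D k ((D j ^^ n) y)" if "y \<in> A" for j n y
  proof (induction n)
    case (Suc n)
    have "(D j ^^ n) y \<in> A" using that by (induction n) (auto intro: cl)
    then show ?case using Suc comm by simp
  qed simp
  have "distinct ks \<Longrightarrow> foldr ?g ks x = (if k \<in> set ks then D k (foldr ?f ks x) else foldr ?f ks x)" for ks
  proof (induction ks)
    case (Cons j ks)
    have A: "foldr ?f ks x \<in> A" by (rule foldr_closed) (use cl x in auto)
    show ?case
    proof (cases "j = k")
      case True
      then show ?thesis using Cons by (simp add: lookup_add)
    next
      case False
      then have "lookup (\<xi> + single k 1) j = lookup \<xi> j" by (simp add: lookup_add lookup_single)
      then show ?thesis using Cons False comm_pow[OF A] by auto
    qed
  qed simp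
  from this[of "sorted_list_of_set UNIV"] show ?thesis by (simp add: iter_deriv_def)
qed

lemma iter_deriv_hom:
  assumes cl: "\<And>k x. x \<in> A \<Longrightarrow> D k x \<in> A" and hom: "\<And>k x. x \<in> A \<Longrightarrow> \<phi> (D k x) = D' k (\<phi> x)"
    and x: "x \<in> A"
  shows "\<phi> (iter_deriv D \<xi> x) = iter_deriv D' \<xi> (\<phi> x)"
proof -
  have "\<phi> (foldr (\<lambda>k. D k ^^ lookup \<xi> k) ks x) = foldr (\<lambda>k. D' k ^^ lookup \<xi> k) ks (\<phi> x)" for ks
  proof (induction ks)
    case (Cons k ks)
    have "\<phi> ((D k ^^ n) y) = (D' k ^^ n) (\<phi> y) \<and> (D k ^^ n) y \<in> A" if "y \<in> A" for n y
      using that by (induction n) (auto simp: hom intro: cl)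
    moreover have "foldr (\<lambda>k. D k ^^ lookup \<xi> k) ks x \<in> A" by (rule foldr_closed) (use cl x in auto)
    ultimately show ?case using Cons by simp
  qed simp
  then show ?thesis by (simp add: iter_deriv_def)
qed

lemma jet_ind_deriv:
  assumes "\<And>k x. x \<in> A \<Longrightarrow> D k x \<in> A" "\<And>k l x. x \<in> A \<Longrightarrow> D k (D l x) = D l (D k x)" "b (fst v) \<in> A"
  shows "jet D b (ind_deriv k v) = D k (jet D b v)"
  using iter_deriv_add_single[of A D "b (fst v)" "snd v" k] assms
  by (simp add: jet_def ind_deriv_def case_prod_unfold)

lemma differential_fieldD:
  assumes "differential_field d"
  shows deriv_add: "d k (x + y) = d k x + d k y"
    and deriv_mult: "d k (x * y) = d k x * y + x * d k y"
    and deriv_comm: "d k (d l x) = d l (d k x)"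
  using assms by (auto simp: differential_field_def)

lemma deriv_0: "differential_field d \<Longrightarrow> d k 0 = 0"
  using deriv_add[of d k 0 0] by simp

lemma deriv_1: "differential_field d \<Longrightarrow> d k 1 = 0"
  using deriv_mult[of d k 1 1] by simp

lemma deriv_inverse:
  assumes "differential_field d" "x \<noteq> 0"
  shows "d k (inverse x) = - d k x * inverse x * inverse x"
proof -
  have "0 = d k (x * inverse x)" using assms by (simp add: deriv_1)
  also have "\<dots> = d k x * inverse x + x * d k (inverse x)" by (rule deriv_mult[OF assms(1)])
  finally have *: "x * d k (inverse x) = - d k x * inverse x"
    by (metis add.inverse_unique mult_minus_left)
  have "d k (inverse x) = inverse x * (x * d k (inverse x))" using assms(2) by simp
  also have "\<dots> = - d k x * inverse x * inverse x" unfolding * by (simp add: algebra_simps)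
  finally show ?thesis .
qed

lemma ind_deriv_inds: "ind_deriv k ` inds n \<subseteq> inds n"
  by (auto simp: inds_def ind_deriv_def)


subsection \<open>Derivations of the differential polynomial ring\<close>

text \<open>The first summand of \<open>dpoly_deriv\<close>, split off so that the Leibniz rule can
  be checked separately for coefficients and for indeterminates.\<close>

definition coeff_deriv :: "('a \<Rightarrow> 'a) \<Rightarrow> ('v, 'a::comm_ring_1) mpoly \<Rightarrow> ('v, 'a) mpoly" where
  "coeff_deriv D f = (\<Sum>t\<in>keys f. single t (D (lookup f t)))"

lemma lookup_coeff_deriv: "D 0 = 0 \<Longrightarrow> lookup (coeff_deriv D f) s = D (lookup f s)"
  by (auto simp: coeff_deriv_def lookup_sum lookup_single when_def in_keys_iff)

lemma vars_coeff_deriv: "vars (coeff_deriv D f) \<subseteq> vars f"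
  unfolding coeff_deriv_def
proof (rule vars_sum)
  fix t assume "t \<in> keys f"
  then show "vars (single t (D (lookup f t))) \<subseteq> vars f"
    using vars_single[of t "D (lookup f t)"] by (auto simp: vars_def)
qed

lemma dpoly_deriv_superset:
  assumes "finite B" "vars f \<subseteq> B"
  shows "dpoly_deriv d k f = coeff_deriv (d k) f + (\<Sum>v\<in>B. partial v f * pvar (ind_deriv k v))"
  unfolding dpoly_deriv_def coeff_deriv_def
  by (intro arg_cong2[where f = "(+)"] refl sum.mono_neutral_left) (use assms in \<open>auto simp: partial_notin_vars\<close>)

context
  fixes d :: "'m::{finite,linorder} \<Rightarrow> 'a::field_char_0 \<Rightarrow> 'a"
  assumes d: "differential_field d"
begin

lemma coeff_deriv_add: "coeff_deriv (d k) (f + g) = coeff_deriv (d k) f + coeff_deriv (d k) g"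
  by (rule poly_mapping_eqI)
     (simp only: lookup_add lookup_coeff_deriv[of "d k", OF deriv_0[OF d]] deriv_add[OF d])

lemma coeff_deriv_mult:
  fixes f g :: "('m, 'a) dpoly"
  shows "coeff_deriv (d k) (f * g) = coeff_deriv (d k) f * g + f * coeff_deriv (d k) g"
proof (induction f rule: mpoly_single_induct)
  case (single t c)
  have \<delta>_single: "coeff_deriv (d k) (single t c :: ('m, 'a) dpoly) = single t (d k c)" for t c
    by (rule poly_mapping_eqI)
       (auto simp: lookup_coeff_deriv[of "d k", OF deriv_0[OF d]] lookup_single when_def deriv_0[OF d])
  show ?case
  proof (induction g rule: mpoly_single_induct)
    case zero
    then show ?case by (simp add: coeff_deriv_def)
  next
    case (single s c')
    then show ?case by (simp add: \<delta>_single mult_single deriv_mult[OF d] single_add)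
  next
    case (add f g)
    then show ?case by (simp add: coeff_deriv_add algebra_simps)
  qed
next
  case zero
  then show ?case by (simp add: coeff_deriv_def)
next
  case (add f f')
  then show ?case by (simp add: coeff_deriv_add algebra_simps)
qed

lemma dpoly_deriv_add: "dpoly_deriv d k (f + g) = dpoly_deriv d k f + dpoly_deriv d k g"
proof -
  let ?B = "vars f \<union> vars g"
  have *: "finite ?B" "vars f \<subseteq> ?B" "vars g \<subseteq> ?B" "vars (f + g) \<subseteq> ?B" using vars_add[of f g] by auto
  show ?thesis
    unfolding dpoly_deriv_superset[OF *(1,2)] dpoly_deriv_superset[OF *(1,3)] dpoly_deriv_superset[OF *(1,4)]
    by (simp add: coeff_deriv_add partial_add distrib_right sum.distrib)
qed

lemma dpoly_deriv_mult: "dpoly_deriv d k (f * g) = dpoly_deriv d k f * g + f * dpoly_deriv d k g"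
proof -
  let ?B = "vars f \<union> vars g"
  have *: "finite ?B" "vars f \<subseteq> ?B" "vars g \<subseteq> ?B" "vars (f * g) \<subseteq> ?B" using vars_mult[of f g] by auto
  show ?thesis
    unfolding dpoly_deriv_superset[OF *(1,2)] dpoly_deriv_superset[OF *(1,3)] dpoly_deriv_superset[OF *(1,4)]
      coeff_deriv_mult partial_mult
    by (simp add: algebra_simps sum.distrib sum_distrib_left)
qed

lemma dpoly_deriv_pconst: "dpoly_deriv d k (pconst c) = pconst (d k c)"
  by (rule poly_mapping_eqI)
     (auto simp: dpoly_deriv_def lookup_single when_def deriv_0[OF d])

lemma dpoly_deriv_pvar: "dpoly_deriv d k (pvar v) = pvar (ind_deriv k v)"
proof -
  have "coeff_deriv (d k) (pvar v :: ('m, 'a) dpoly) = 0"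
    by (rule poly_mapping_eqI)
       (simp add: lookup_coeff_deriv[of "d k", OF deriv_0[OF d]] pvar_def lookup_single when_def
         deriv_0[OF d] deriv_1[OF d])
  moreover have "finite {v}" "vars (pvar v :: ('m, 'a) dpoly) \<subseteq> {v}" by (auto simp: vars_pvar)
  ultimately show ?thesis by (simp add: dpoly_deriv_superset[of "{v}"] partial_pvar)
qed

lemma dpoly_deriv_0: "dpoly_deriv d k 0 = 0"
  by (simp add: dpoly_deriv_def)

lemma dpoly_deriv_comm: "dpoly_deriv d k (dpoly_deriv d l f) = dpoly_deriv d l (dpoly_deriv d k f)"
proof (induction f rule: mpoly_induct)
  case (const c)
  show ?case by (simp only: dpoly_deriv_pconst deriv_comm[OF d, of k l])
next
  case (var v)
  show ?case by (simp add: dpoly_deriv_pvar ind_deriv_def ac_simps)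
next
  case (mult f g)
  then show ?case by (simp add: dpoly_deriv_mult dpoly_deriv_add algebra_simps)
qed (simp add: dpoly_deriv_add)

lemma vars_dpoly_deriv: "vars (dpoly_deriv d k f) \<subseteq> vars f \<union> ind_deriv k ` vars f"
proof -
  define g where "g = (\<Sum>v\<in>vars f. partial v f * pvar (ind_deriv k v))"
  have "vars g \<subseteq> vars f \<union> ind_deriv k ` vars f"
    unfolding g_def
  proof (rule vars_sum)
    fix v assume "v \<in> vars f"
    then show "vars (partial v f * pvar (ind_deriv k v)) \<subseteq> vars f \<union> ind_deriv k ` vars f"
      using vars_mult[of "partial v f" "pvar (ind_deriv k v)"] vars_partial[of v f]
        vars_pvar[of "ind_deriv k v", where 'a = 'a] by blast
  qed
  moreover have "dpoly_deriv d k f = coeff_deriv (d k) f + g"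
    unfolding g_def by (rule dpoly_deriv_superset) auto
  ultimately show ?thesis
    using vars_add[of "coeff_deriv (d k) f" g] vars_coeff_deriv[of "d k" f] by auto
qed

lemma vars_iter_dpoly_deriv:
  assumes "vars f \<subseteq> inds n"
  shows "vars (iter_deriv (dpoly_deriv d) \<xi> f) \<subseteq> inds n"
proof -
  have "iter_deriv (dpoly_deriv d) \<xi> f \<in> {f. vars f \<subseteq> inds n}"
  proof (rule iter_deriv_closed)
    fix k and g :: "('m, 'a) dpoly" assume "g \<in> {f. vars f \<subseteq> inds n}"
    then show "dpoly_deriv d k g \<in> {f. vars f \<subseteq> inds n}"
      using vars_dpoly_deriv[of k g] image_mono[of "vars g" "inds n" "ind_deriv k"] ind_deriv_inds[of k n]
      by (simp only: mem_Collect_eq) blast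
  qed (simp add: assms)
  then show ?thesis by simp
qed

text \<open>The derivative of the leader ranks above all indeterminates of \<open>f\<close> and
  above the derivatives of the others. It therefore enters only through the summand of the leader,
  with the separant as coefficient.\<close>

lemma dpoly_deriv_leader:
  assumes f: "vars f \<noteq> {}"
  shows "\<exists>g. dpoly_deriv d k f = separant f * pvar (ind_deriv k (leader f)) + g \<and>
    (\<forall>w\<in>vars g. ind_less w (ind_deriv k (leader f)))"
proof -
  let ?v = "leader f" and ?\<delta> = "\<lambda>v. ind_deriv k v"
  note v = leader_in_vars[OF f] and less = ind_less_leader[OF f]
  have vd: "ind_less ?v (?\<delta> ?v)"
    unfolding ind_deriv_eq_shift by (rule ind_less_shift) (simp add: poly_mapping_eq_iff fun_eq_iff lookup_single when_def)
  have le: "ind_less w (?\<delta> ?v)" if "w \<in> vars f" for w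
    using less[OF that] vd ind_less_trans[of w ?v "?\<delta> ?v"] by (cases "w = ?v") auto
  have mono: "ind_less (?\<delta> w) (?\<delta> ?v)" if "w \<in> vars f" "w \<noteq> ?v" for w
    unfolding ind_deriv_eq_shift by (rule ind_less_shift_mono[OF less[OF that]])
  define g1 where "g1 = coeff_deriv (d k) f"
  define g2 where "g2 = (\<Sum>w\<in>vars f - {?v}. partial w f * pvar (?\<delta> w))"
  have eq: "dpoly_deriv d k f = separant f * pvar (?\<delta> ?v) + (g1 + g2)"
    unfolding dpoly_deriv_superset[OF finite_vars order_refl] g1_def g2_def separant_def
    by (simp add: sum.remove[OF finite_vars v])
  have 1: "vars g1 \<subseteq> vars f" unfolding g1_def by (rule vars_coeff_deriv)
  have 2: "vars g2 \<subseteq> vars f \<union> ?\<delta> ` (vars f - {?v})"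
    unfolding g2_def
  proof (rule vars_sum)
    fix w assume "w \<in> vars f - {?v}"
    then show "vars (partial w f * pvar (?\<delta> w)) \<subseteq> vars f \<union> ?\<delta> ` (vars f - {?v})"
      using vars_mult[of "partial w f" "pvar (?\<delta> w)"] vars_partial[of w f]
        vars_pvar[of "?\<delta> w", where 'a = 'a] by blast
  qed
  have "ind_less w (?\<delta> ?v)" if "w \<in> vars (g1 + g2)" for w
    using that vars_add[of g1 g2] 1 2 le mono by blast
  then show ?thesis using eq by blast
qed

text \<open>After one derivation the polynomial is linear in its leader with coefficient
  \<open>separant f\<close>. A further derivation of this coefficient only multiplies the old
  leader, which now ranks lower, so the coefficient of the new leader is again the separant.\<close>

lemma iter_dpoly_deriv_leader:
  assumes f: "vars f \<noteq> {}"
  shows "\<xi> \<noteq> 0 \<Longrightarrow> \<exists>g. iter_deriv (dpoly_deriv d) \<xi> f = separant f * pvar (shift \<xi> (leader f)) + g \<and>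
    (\<forall>w\<in>vars g. ind_less w (shift \<xi> (leader f)))"
proof (induction \<xi> rule: multi_index_induct)
  case (add \<xi> k)
  let ?D = "dpoly_deriv d" and ?v = "shift \<xi> (leader f)"
  have it: "iter_deriv ?D (\<xi> + single k 1) f = ?D k (iter_deriv ?D \<xi> f)"
    by (rule iter_deriv_add_single[of UNIV]) (auto simp: dpoly_deriv_comm)
  have sh: "shift (\<xi> + single k 1) (leader f) = ind_deriv k ?v" by (rule ind_deriv_shift[symmetric])
  show ?case
  proof (cases "\<xi> = 0")
    case True
    then show ?thesis using dpoly_deriv_leader[OF f, of k] unfolding it sh by simp
  next
    case False
    then obtain g where g: "iter_deriv ?D \<xi> f = separant f * pvar ?v + g" "\<And>w. w \<in> vars g \<Longrightarrow> ind_less w ?v"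
      using add.IH by blast
    have vv: "ind_less ?v (ind_deriv k ?v)"
      unfolding ind_deriv_eq_shift by (rule ind_less_shift) (simp add: poly_mapping_eq_iff fun_eq_iff lookup_single when_def)
    have mono: "ind_less (ind_deriv k w) (ind_deriv k ?v)" if "ind_less w ?v" for w
      unfolding ind_deriv_eq_shift by (rule ind_less_shift_mono[OF that])
    have S: "ind_less w ?v" if "w \<in> vars (separant f)" for w
    proof -
      have "w \<in> vars f" using that vars_partial[of "leader f" f] by (auto simp: separant_def)
      then have "w = leader f \<or> ind_less w (leader f)" using ind_less_leader[OF f] by blast
      then show ?thesis
        using ind_less_shift[OF False, of "leader f"] ind_less_trans[of w "leader f" ?v] by blast
    qed
    define g' where "g' = ?D k (separant f) * pvar ?v + ?D k g"
    have "?D k (iter_deriv ?D \<xi> f) = separant f * pvar (ind_deriv k ?v) + g'"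
      unfolding g(1) g'_def by (simp add: dpoly_deriv_add dpoly_deriv_mult dpoly_deriv_pvar algebra_simps)
    moreover have "ind_less w (ind_deriv k ?v)" if "w \<in> vars g'" for w
    proof -
      have "w \<in> vars (?D k (separant f)) \<union> {?v} \<union> vars (?D k g)"
        using that vars_add[of "?D k (separant f) * pvar ?v" "?D k g"]
          vars_mult[of "?D k (separant f)" "pvar ?v"] vars_pvar[of ?v, where 'a = 'a]
        unfolding g'_def by blast
      then have "w \<in> vars (separant f) \<union> vars g \<union> {?v} \<or> w \<in> ind_deriv k ` (vars (separant f) \<union> vars g)"
        using vars_dpoly_deriv[of k "separant f"] vars_dpoly_deriv[of k g] by blast
      then show ?thesis
      proof
        assume "w \<in> vars (separant f) \<union> vars g \<union> {?v}"
        then have "w = ?v \<or> ind_less w ?v" using S g(2) by blast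
        then show ?thesis using vv ind_less_trans[of w ?v "ind_deriv k ?v"] by blast
      next
        assume "w \<in> ind_deriv k ` (vars (separant f) \<union> vars g)"
        then show ?thesis using mono S g(2) by blast
      qed
    qed
    ultimately show ?thesis unfolding it sh by blast
  qed
qed simp

lemma poly_eval_dpoly_deriv:
  fixes D :: "'m \<Rightarrow> 'c::field_char_0 \<Rightarrow> 'c"
  assumes D: "differential_field D" and h: "rhom h" "\<And>c. h (d k c) = D k (h c)"
    and b: "\<And>v. b (ind_deriv k v) = D k (b v)"
  shows "poly_eval h b (dpoly_deriv d k f) = D k (poly_eval h b f)"
proof (induction f rule: mpoly_induct)
  case (const c)
  show ?case by (simp only: dpoly_deriv_pconst poly_eval_pconst[OF h(1)] h(2))
next
  case (var v)
  show ?case by (simp only: dpoly_deriv_pvar poly_eval_pvar[OF h(1)] b)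
next
  case (add f g)
  then show ?case by (simp only: dpoly_deriv_add poly_eval_add[OF h(1)] deriv_add[OF D])
next
  case (mult f g)
  then show ?case
    by (simp only: dpoly_deriv_mult poly_eval_add[OF h(1)] poly_eval_mult[OF h(1)] deriv_mult[OF D])
qed

lemma poly_eval_jet_iter_deriv_eq_0:
  fixes D :: "'m \<Rightarrow> 'c::field_char_0 \<Rightarrow> 'c"
  assumes D: "differential_field D" and h: "rhom h" "\<And>k c. h (d k c) = D k (h c)"
    and f: "poly_eval h (jet D b) f = 0"
  shows "poly_eval h (jet D b) (iter_deriv (dpoly_deriv d) \<xi> f) = 0"
proof -
  have "iter_deriv (dpoly_deriv d) \<xi> f \<in> {f. poly_eval h (jet D b) f = 0}"
  proof (rule iter_deriv_closed)
    fix k and g :: "('m, 'a) dpoly" assume "g \<in> {f. poly_eval h (jet D b) f = 0}"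
    moreover have "jet D b (ind_deriv k v) = D k (jet D b v)" for v
      by (rule jet_ind_deriv[of UNIV]) (auto simp: deriv_comm[OF D])
    ultimately show "dpoly_deriv d k g \<in> {f. poly_eval h (jet D b) f = 0}"
      using poly_eval_dpoly_deriv[OF D h(1), of k "jet D b" g] h(2) by (simp add: deriv_0[OF D])
  qed (simp add: f)
  then show ?thesis by simp
qed

end

subsection \<open>Autoreduced sets\<close>

lemma mono_subseq_nat:
  fixes s :: "nat \<Rightarrow> nat"
  shows "\<exists>\<phi> :: nat \<Rightarrow> nat. strict_mono \<phi> \<and> mono (\<lambda>i. s (\<phi> i))"
proof -
  obtain \<phi> :: "nat \<Rightarrow> nat" where \<phi>: "strict_mono \<phi>" "monoseq (\<lambda>i. s (\<phi> i))" using seq_monosub by blast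
  show ?thesis
  proof (cases "\<forall>m. \<forall>n\<ge>m. s (\<phi> m) \<le> s (\<phi> n)")
    case True
    then show ?thesis using \<phi>(1) by (intro exI[of _ \<phi>]) (simp add: mono_def)
  next
    case False
    then have dec: "s (\<phi> n) \<le> s (\<phi> m)" if "m \<le> n" for m n using \<phi>(2) that unfolding monoseq_def by blast
    \<comment> \<open>A nonincreasing sequence of natural numbers is constant from its minimum
      on.\<close>
    obtain N where N: "\<And>n. s (\<phi> N) \<le> s (\<phi> n)"
      using ex_has_least_nat[of "\<lambda>_. True" 0 "\<lambda>n. s (\<phi> n)"] by auto
    have const: "s (\<phi> (i + N)) = s (\<phi> N)" for i
      using N[of "i + N"] dec[of N "i + N"] by simp
    have "strict_mono (\<lambda>i. \<phi> (i + N))" using \<phi>(1) by (simp add: strict_mono_def)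
    then show ?thesis using const by (intro exI[of _ "\<lambda>i. \<phi> (i + N)"]) (auto simp: mono_def)
  qed
qed

lemma mono_subseq_finite:
  fixes S :: "(nat \<Rightarrow> nat) set"
  assumes "finite S"
  shows "\<exists>\<phi> :: nat \<Rightarrow> nat. strict_mono \<phi> \<and> (\<forall>s\<in>S. mono (\<lambda>i. s (\<phi> i)))"
  using assms
proof (induction S rule: finite_induct)
  case empty
  then show ?case by (intro exI[of _ id]) (simp add: strict_mono_def)
next
  case (insert s S)
  then obtain \<phi> :: "nat \<Rightarrow> nat" where \<phi>: "strict_mono \<phi>" "\<And>s. s \<in> S \<Longrightarrow> mono (\<lambda>i. s (\<phi> i))" by blast
  obtain \<psi> :: "nat \<Rightarrow> nat" where \<psi>: "strict_mono \<psi>" "mono (\<lambda>i. s (\<phi> (\<psi> i)))"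
    using mono_subseq_nat[of "\<lambda>i. s (\<phi> i)"] by blast
  have "strict_mono (\<lambda>i. \<phi> (\<psi> i))" using \<phi>(1) \<psi>(1) by (simp add: strict_mono_def)
  moreover have "mono (\<lambda>i. s' (\<phi> (\<psi> i)))" if "s' \<in> S" for s'
    using \<phi>(2)[OF that] strict_mono_mono[OF \<psi>(1)] by (simp add: mono_def)
  ultimately show ?case using \<psi>(2) by (intro exI[of _ "\<lambda>i. \<phi> (\<psi> i)"]) auto
qed

lemma dickson:
  fixes v :: "nat \<Rightarrow> 'm::finite ind"
  assumes "\<And>i. fst (v i) < n"
  shows "\<exists>i j \<eta>. i < j \<and> v j = shift \<eta> (v i)"
proof -
  \<comment> \<open>Both \<open>fst (v i)\<close> and \<open>n - fst (v i)\<close> are made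
    monotone, which forces the variable index to be constant along the subsequence.\<close>
  define S where "S = {\<lambda>i. fst (v i), \<lambda>i. n - fst (v i)} \<union> range (\<lambda>k i. lookup (snd (v i)) k)"
  have "finite S" by (simp add: S_def)
  then obtain \<phi> :: "nat \<Rightarrow> nat" where \<phi>: "strict_mono \<phi>" "\<And>s. s \<in> S \<Longrightarrow> mono (\<lambda>i. s (\<phi> i))"
    using mono_subseq_finite by blast
  define i where "i = \<phi> 0"
  define j where "j = \<phi> 1"
  have le: "s i \<le> s j" if "s \<in> S" for s using \<phi>(2)[OF that] by (simp add: mono_def i_def j_def)
  have "fst (v i) \<le> fst (v j)" "n - fst (v i) \<le> n - fst (v j)"
    using le[of "\<lambda>i. fst (v i)"] le[of "\<lambda>i. n - fst (v i)"] by (auto simp: S_def)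
  then have 1: "fst (v j) = fst (v i)" using assms[of i] assms[of j] by simp
  have 2: "lookup (snd (v i)) k \<le> lookup (snd (v j)) k" for k
    using le[of "\<lambda>i. lookup (snd (v i)) k"] by (auto simp: S_def)
  have "snd (v j) = snd (v i) + (snd (v j) - snd (v i))"
    by (rule poly_mapping_eqI) (simp add: lookup_add lookup_minus 2)
  then have "v j = shift (snd (v j) - snd (v i)) (v i)"
    using 1 by (simp add: shift_def prod_eq_iff)
  moreover have "i < j" using \<phi>(1) by (simp add: strict_mono_def i_def j_def)
  ultimately show ?thesis by blast
qed

lemma leader_deg_pos: "vars f \<noteq> {} \<Longrightarrow> 0 < leader_deg f"
  using leader_in_vars[of f] deg_in_less_iff[of "leader f" f 1] degb_1_iff[of "leader f" f]
  by (simp add: leader_deg_def)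

lemma reduced_wrtD:
  assumes "reduced_wrt g f"
  shows "\<eta> \<noteq> 0 \<Longrightarrow> shift \<eta> (leader f) \<notin> vars g" "deg_in (leader f) g < leader_deg f"
  using assms by (auto simp: reduced_wrt_def proper_derivatives_eq)

lemma reduced_wrt_same_leader:
  "reduced_wrt g f \<Longrightarrow> leader g = leader f \<Longrightarrow> leader_deg g < leader_deg f"
  using reduced_wrtD(2)[of g f] by (simp add: leader_deg_def)

lemma reduced_wrt_if_ind_less:
  assumes f: "vars f \<noteq> {}" and less: "\<And>w. w \<in> vars g \<Longrightarrow> ind_less w (leader f)"
  shows "reduced_wrt g f"
proof -
  have "leader f \<notin> vars g" using less ind_less_irrefl by blast
  then have "deg_in (leader f) g < leader_deg f"
    using leader_deg_pos[OF f] degb_mono[of "leader f" 1 g "leader_deg f"]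
    by (simp add: deg_in_less_iff degb_1_iff)
  moreover have "shift \<eta> (leader f) \<notin> vars g" if "\<eta> \<noteq> 0" for \<eta>
    using less[of "shift \<eta> (leader f)"] ind_less_shift[OF that, of "leader f"] ind_less_asym by blast
  ultimately show ?thesis by (auto simp: reduced_wrt_def proper_derivatives_eq)
qed

lemma reduced_wrt_if_leader_less:
  assumes f: "vars f \<noteq> {}" and g: "vars g \<noteq> {}" and less: "ind_less (leader g) (leader f)"
  shows "reduced_wrt g f"
proof (rule reduced_wrt_if_ind_less[OF f])
  fix w assume "w \<in> vars g"
  then show "ind_less w (leader f)"
    using ind_less_leader[OF g] less ind_less_trans[of w "leader g" "leader f"] by (cases "w = leader g") auto
qed

lemma reduced_wrt_rank: "dpoly_rank f = dpoly_rank f' \<Longrightarrow> reduced_wrt g f \<longleftrightarrow> reduced_wrt g f'"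
  by (simp add: dpoly_rank_def reduced_wrt_def)

lemma wf_rank_less: "wf {(f, g). rank_less f g}"
proof -
  have "wf (inv_image ({(v, w). ind_less v w} <*lex*> less_than) (\<lambda>f. (leader f, leader_deg f)))"
    by (intro wf_inv_image wf_lex_prod wf_ind_less wf_less_than)
  then show ?thesis by (rule wf_subset) (auto simp: rank_less_def)
qed

lemma rank_less_trans: "rank_less f g \<Longrightarrow> rank_less g h \<Longrightarrow> rank_less f h"
  unfolding rank_less_def using ind_less_trans by (metis less_trans)

lemma rank_less_irrefl: "\<not> rank_less f f"
  by (simp add: rank_less_def ind_less_irrefl)

lemma rank_less_linear: "rank_less f g \<or> dpoly_rank f = dpoly_rank g \<or> rank_less g f"
  unfolding rank_less_def dpoly_rank_def using ind_less_total[of "leader f" "leader g"]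
  by (cases "leader f = leader g") auto

lemma autoreducedD:
  assumes "autoreduced n \<Lambda>"
  shows autoreduced_vars: "f \<in> \<Lambda> \<Longrightarrow> vars f \<subseteq> inds n"
    and autoreduced_nonconst: "f \<in> \<Lambda> \<Longrightarrow> vars f \<noteq> {}"
    and autoreduced_reduced: "f \<in> \<Lambda> \<Longrightarrow> g \<in> \<Lambda> \<Longrightarrow> f \<noteq> g \<Longrightarrow> reduced_wrt f g"
  using assms polys_UNIV[of f "inds n"] unfolding autoreduced_def by blast+

lemma autoreduced_leader_inj:
  assumes "autoreduced n \<Lambda>" "f \<in> \<Lambda>" "g \<in> \<Lambda>" "leader f = leader g"
  shows "f = g"
proof (rule ccontr)
  assume "f \<noteq> g"
  then have "reduced_wrt f g" "reduced_wrt g f" using autoreduced_reduced[OF assms(1)] assms(2,3) by auto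
  then show False using reduced_wrt_same_leader[of f g] reduced_wrt_same_leader[of g f] assms(4) by simp
qed

lemma autoreduced_leader_antichain:
  assumes "autoreduced n \<Lambda>" "f \<in> \<Lambda>" "g \<in> \<Lambda>" "leader g = shift \<eta> (leader f)"
  shows "\<eta> = 0"
proof (rule ccontr)
  assume \<eta>: "\<eta> \<noteq> 0"
  then have "f \<noteq> g" using ind_less_shift[OF \<eta>, of "leader f"] ind_less_irrefl assms(4) by metis
  then have "reduced_wrt g f" using autoreduced_reduced[OF assms(1)] assms(2,3) by blast
  then show False
    using reduced_wrtD(1)[OF _ \<eta>, of g f] leader_in_vars[OF autoreduced_nonconst[OF assms(1,3)]] assms(4) by simp
qed

text \<open>In an infinite autoreduced set \<open>dickson\<close> would find an element whose leader
  is a derivative of the leader of another one.\<close>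

lemma finite_autoreduced:
  fixes \<Lambda> :: "('m::{finite,linorder}, 'a::zero) dpoly set"
  assumes "autoreduced n \<Lambda>"
  shows "finite \<Lambda>"
proof (rule ccontr)
  assume "infinite \<Lambda>"
  then obtain f :: "nat \<Rightarrow> _" where f: "inj f" "range f \<subseteq> \<Lambda>" using infinite_countable_subset by blast
  have "fst (leader (f i)) < n" for i
  proof -
    have "f i \<in> \<Lambda>" using f(2) by blast
    then have "leader (f i) \<in> inds n"
      using leader_in_vars[OF autoreduced_nonconst[OF assms]] autoreduced_vars[OF assms] by blast
    then show ?thesis by (auto simp: inds_def)
  qed
  from dickson[of "\<lambda>i. leader (f i)", OF this]
  obtain i j \<eta> where ij: "i < j" "leader (f j) = shift \<eta> (leader (f i))" by blast
  have "\<eta> = 0" using autoreduced_leader_antichain[OF assms _ _ ij(2)] f(2) by blast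
  then have "f i = f j" using autoreduced_leader_inj[OF assms, of "f i" "f j"] ij(2) f(2) by auto
  then show False using f(1) ij(1) by (simp add: inj_eq)
qed

text \<open>\<open>autoreduced_less\<close> speaks of some increasing enumerations; uniqueness
  identifies these with an enumeration already at hand.\<close>

lemma sorted_wrt_strict_unique:
  assumes trans: "\<And>x y z. R x y \<Longrightarrow> R y z \<Longrightarrow> R x z" and irrefl: "\<And>x. \<not> R x x"
  shows "sorted_wrt R xs \<Longrightarrow> sorted_wrt R ys \<Longrightarrow> set xs = set ys \<Longrightarrow> xs = ys"
proof (induction xs arbitrary: ys)
  case (Cons x xs)
  then obtain y ys' where ys: "ys = y # ys'" by (cases ys) auto
  have "x = y"
  proof (rule ccontr)
    assume "x \<noteq> y"
    then have "x \<in> set ys'" "y \<in> set xs" using Cons.prems(3) ys by auto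
    then show False using Cons.prems(1,2) ys trans[of x y x] irrefl by auto
  qed
  moreover have "x \<notin> set xs" "y \<notin> set ys'" using Cons.prems(1,2) ys irrefl by auto
  ultimately have "set xs = set ys'" using Cons.prems(3) ys by (simp add: insert_ident)
  then show ?case using Cons ys \<open>x = y\<close> by auto
qed simp

lemma ex_sorted_wrt_strict:
  assumes "finite A" "wf {(x, y). R x y}" "\<And>x y. x \<in> A \<Longrightarrow> y \<in> A \<Longrightarrow> x \<noteq> y \<Longrightarrow> R x y \<or> R y x"
  shows "\<exists>xs. set xs = A \<and> sorted_wrt R xs"
  using assms(1,3)
proof (induction "card A" arbitrary: A)
  case (Suc c)
  then have "A \<noteq> {}" by auto
  then obtain x where x: "x \<in> A" by blast
  obtain m where m0: "m \<in> A" "\<And>y. (y, m) \<in> {(x, y). R x y} \<Longrightarrow> y \<notin> A"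
    using wfE_min[OF assms(2) x] by metis
  have m: "m \<in> A" "\<not> R y m" if "y \<in> A" for y using m0 that by auto
  have "c = card (A - {m})" "finite (A - {m})" using Suc.hyps(2) Suc.prems(1) m0(1) by auto
  from Suc.hyps(1)[OF this] Suc.prems(2) obtain xs where xs: "set xs = A - {m}" "sorted_wrt R xs" by blast
  have "sorted_wrt R (m # xs)" using xs m(2) m0(1) Suc.prems(2) by auto
  moreover have "set (m # xs) = A" using xs(1) m0(1) by auto
  ultimately show ?case by blast
qed auto

lemma ex_sorted_autoreduced:
  fixes \<Lambda> :: "('m::{finite,linorder}, 'a::zero) dpoly set"
  assumes "autoreduced n \<Lambda>"
  shows "\<exists>fs. set fs = \<Lambda> \<and> sorted_wrt rank_less fs"
proof (rule ex_sorted_wrt_strict[OF finite_autoreduced[OF assms] wf_rank_less])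
  fix f g assume "f \<in> \<Lambda>" "g \<in> \<Lambda>" "f \<noteq> g"
  then show "rank_less f g \<or> rank_less g f"
    using autoreduced_leader_inj[OF assms, of f g] rank_less_linear[of f g] by (auto simp: dpoly_rank_def)
qed


subsection \<open>Characteristic sets\<close>

text \<open>Greedily adjoin an element of lowest rank among those reduced with respect to the earlier
  ones; Dickson's lemma makes this stop.\<close>

lemma ex_characteristic_set:
  fixes P :: "('m::{finite,linorder}, 'a::zero) dpoly set"
  assumes P: "P \<subseteq> polys UNIV (inds n)"
  shows "\<exists>\<Lambda>. characteristic_set n P \<Lambda>"
proof -
  define cand where "cand xs = {g \<in> P. vars g \<noteq> {} \<and> (\<forall>f\<in>set xs. reduced_wrt g f)}" for xs
  define pick where "pick xs = (SOME g. g \<in> cand xs \<and> (\<forall>g'\<in>cand xs. \<not> rank_less g' g))" for xs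
  define xs where "xs = rec_nat [] (\<lambda>_ ys. ys @ [pick ys])"
  have xs0: "xs 0 = []" and xsS: "xs (Suc i) = xs i @ [pick (xs i)]" for i by (simp_all add: xs_def)
  define f where "f i = pick (xs i)" for i
  have set_xs: "set (xs i) = f ` {..<i}" and len: "length (xs i) = i" for i
    by (induction i) (auto simp: xs0 xsS f_def lessThan_Suc)
  have nth: "xs i ! j = f j" if "j < i" for i j
    using that by (induction i) (auto simp: xsS nth_append len f_def less_Suc_eq)
  have pick: "f i \<in> cand (xs i) \<and> (\<forall>g'\<in>cand (xs i). \<not> rank_less g' (f i))" if ne: "cand (xs i) \<noteq> {}" for i
  proof -
    obtain g0 where g0: "g0 \<in> cand (xs i)" using ne by blast
    obtain g where g: "g \<in> cand (xs i)" "\<And>y. (y, g) \<in> {(f, g). rank_less f g} \<Longrightarrow> y \<notin> cand (xs i)"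
      using wfE_min[OF wf_rank_less g0] by metis
    have "\<not> rank_less g' g" if "g' \<in> cand (xs i)" for g' using g(2)[of g'] that by auto
    then have "\<exists>g. g \<in> cand (xs i) \<and> (\<forall>g'\<in>cand (xs i). \<not> rank_less g' g)" using g(1) by blast
    then show ?thesis unfolding f_def pick_def by (rule someI_ex)
  qed
  have red: "reduced_wrt (f j) (f i) \<and> \<not> rank_less (f j) (f i)"
    if "i < j" "cand (xs i) \<noteq> {}" "cand (xs j) \<noteq> {}" for i j
  proof -
    have "f i \<in> set (xs j)" using set_xs that(1) by blast
    moreover have "set (xs i) \<subseteq> set (xs j)" using set_xs that(1) by auto
    then have "cand (xs j) \<subseteq> cand (xs i)" unfolding cand_def by blast
    ultimately show ?thesis using pick[OF that(2)] pick[OF that(3)] unfolding cand_def by blast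
  qed
  have "\<exists>N. cand (xs N) = {}"
  proof (rule ccontr)
    assume "\<nexists>N. cand (xs N) = {}"
    then have ne: "cand (xs i) \<noteq> {}" for i by blast
    have fP: "f i \<in> P" "vars (f i) \<noteq> {}" for i using pick[OF ne[of i]] by (auto simp: cand_def)
    have "fst (leader (f i)) < n" for i
      using leader_in_vars[OF fP(2)[of i]] fP(1)[of i] P polys_UNIV[of "f i" "inds n"] by (auto simp: inds_def)
    from dickson[of "\<lambda>i. leader (f i)", OF this]
    obtain i j \<eta> where ij: "i < j" "leader (f j) = shift \<eta> (leader (f i))" by blast
    have r: "reduced_wrt (f j) (f i)" "\<not> rank_less (f j) (f i)" using red[OF ij(1) ne ne] by auto
    have "\<eta> = 0"
      using reduced_wrtD(1)[OF r(1), of \<eta>] leader_in_vars[OF fP(2)[of j]] ij(2) by auto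
    then have "leader (f j) = leader (f i)" using ij(2) by simp
    then show False using r reduced_wrt_same_leader[OF r(1)] by (simp add: rank_less_def)
  qed
  define N where "N = (LEAST N. cand (xs N) = {})"
  have N: "cand (xs N) = {}" using LeastI_ex[OF \<open>\<exists>N. cand (xs N) = {}\<close>] by (simp add: N_def)
  have ne: "cand (xs i) \<noteq> {}" if "i < N" for i using not_less_Least that unfolding N_def by blast
  have fP: "f i \<in> P" "vars (f i) \<noteq> {}" if "i < N" for i using pick[OF ne[OF that]] by (auto simp: cand_def)
  \<comment> \<open>A later choice was already available earlier, so its rank is not lower; being
    reduced it cannot have the same leader either.\<close>
  have less: "ind_less (leader (f i)) (leader (f j))" if "i < j" "j < N" for i j
  proof -
    have r: "reduced_wrt (f j) (f i)" "\<not> rank_less (f j) (f i)" using red[OF that(1)] ne that by auto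
    have "leader (f j) \<noteq> leader (f i)"
      using r reduced_wrt_same_leader[OF r(1)] by (auto simp: rank_less_def)
    then show ?thesis using r(2) ind_less_total[of "leader (f i)" "leader (f j)"] by (auto simp: rank_less_def)
  qed
  let ?\<Lambda> = "set (xs N)"
  have "reduced_wrt (f i) (f j)" if "i < N" "j < N" "i \<noteq> j" for i j
  proof (cases "j < i")
    case True
    then show ?thesis using red[of j i] ne that by blast
  next
    case False
    then show ?thesis using that reduced_wrt_if_leader_less[OF fP(2) fP(2) less] by simp
  qed
  then have auto: "autoreduced n ?\<Lambda>"
    using fP P unfolding autoreduced_def set_xs by auto
  have sorted: "sorted_wrt rank_less (xs N)"
    unfolding sorted_wrt_iff_nth_less using less by (auto simp: len nth rank_less_def)
  have "\<not> autoreduced_less \<Gamma> ?\<Lambda>" if \<Gamma>: "autoreduced n \<Gamma>" "\<Gamma> \<subseteq> P" for \<Gamma>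
  proof
    assume "autoreduced_less \<Gamma> ?\<Lambda>"
    then obtain gs fs where gs: "set gs = \<Gamma>" "sorted_wrt rank_less gs"
      and fs: "set fs = ?\<Lambda>" "sorted_wrt rank_less fs"
      and c: "(\<exists>i. i < length gs \<and> i < length fs \<and>
              (\<forall>j<i. dpoly_rank (gs ! j) = dpoly_rank (fs ! j)) \<and> rank_less (gs ! i) (fs ! i)) \<or>
         (length gs > length fs \<and> (\<forall>j<length fs. dpoly_rank (gs ! j) = dpoly_rank (fs ! j)))"
      unfolding autoreduced_less_def by blast
    have fs': "fs = xs N"
      by (rule sorted_wrt_strict_unique[of rank_less]) (use rank_less_trans rank_less_irrefl fs sorted in blast)+
    \<comment> \<open>Being reduced with respect to an element depends only on the rank of that
      element. A competitor with the same ranks up to place \<open>i\<close> therefore offers its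
      next element as a candidate at that place: it cannot rank lower than the choice made, and at
      place \<open>N\<close> no candidate is left.\<close>
    have candI: "gs ! i \<in> cand (xs i)"
      if i: "i < length gs" "i \<le> N" and eq: "\<And>j. j < i \<Longrightarrow> dpoly_rank (gs ! j) = dpoly_rank (f j)" for i
    proof -
      have gi: "gs ! i \<in> \<Gamma>" using i gs(1) by auto
      have "reduced_wrt (gs ! i) (f j)" if "j < i" for j
      proof -
        have "rank_less (gs ! j) (gs ! i)" using gs(2) that i sorted_wrt_nth_less by blast
        then have "gs ! i \<noteq> gs ! j" using rank_less_irrefl by metis
        moreover have "gs ! j \<in> \<Gamma>" using that i gs(1) by auto
        ultimately have "reduced_wrt (gs ! i) (gs ! j)" using autoreduced_reduced[OF \<Gamma>(1)] gi by blast
        then show ?thesis using reduced_wrt_rank[OF eq[OF that]] by blast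
      qed
      then show ?thesis
        using gi \<Gamma>(2) autoreduced_nonconst[OF \<Gamma>(1) gi] unfolding cand_def set_xs by auto
    qed
    from c show False
    proof
      assume "\<exists>i. i < length gs \<and> i < length fs \<and>
              (\<forall>j<i. dpoly_rank (gs ! j) = dpoly_rank (fs ! j)) \<and> rank_less (gs ! i) (fs ! i)"
      then obtain i where i: "i < length gs" "i < N" "\<And>j. j < i \<Longrightarrow> dpoly_rank (gs ! j) = dpoly_rank (f j)"
        "rank_less (gs ! i) (f i)" using fs' by (auto simp: len nth)
      then show False using candI[of i] pick[OF ne[OF i(2)]] by auto
    next
      assume "length gs > length fs \<and> (\<forall>j<length fs. dpoly_rank (gs ! j) = dpoly_rank (fs ! j))"
      then have "gs ! N \<in> cand (xs N)" using fs' by (intro candI) (auto simp: len nth)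
      then show False using N by blast
    qed
  qed
  moreover have "?\<Lambda> \<subseteq> P" using fP(1) set_xs by auto
  ultimately have "characteristic_set n P ?\<Lambda>"
    using auto unfolding characteristic_set_def by blast
  then show ?thesis by blast
qed

lemma characteristic_setD:
  assumes "characteristic_set n P \<Lambda>"
  shows characteristic_set_autoreduced: "autoreduced n \<Lambda>"
    and characteristic_set_subset: "\<Lambda> \<subseteq> P"
    and characteristic_set_minimal: "autoreduced n \<Gamma> \<Longrightarrow> \<Gamma> \<subseteq> P \<Longrightarrow> \<not> autoreduced_less \<Gamma> \<Lambda>"
  using assms unfolding characteristic_set_def by blast+

text \<open>A nonconstant reduced \<open>g\<close> could replace all elements of
  \<open>\<Lambda>\<close> that do not rank below it, which gives a lower autoreduced subset of
  \<open>P\<close>. A constant in a proper ideal is zero.\<close>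

lemma reduced_imp_eq_0:
  fixes P :: "('m::{finite,linorder}, 'a::field) dpoly set"
  assumes P: "prime_in UNIV (inds n) P" and \<Lambda>: "characteristic_set n P \<Lambda>"
    and g: "g \<in> P" and red: "\<And>f. f \<in> \<Lambda> \<Longrightarrow> reduced_wrt g f"
  shows "g = 0"
proof (cases "vars g = {}")
  case True
  then have "g = pconst (lookup g 0)" by (rule vars_empty_imp_pconst)
  then show ?thesis using prime_in_pconst[OF P, of "lookup g 0"] g by simp
next
  case False
  note ar = characteristic_set_autoreduced[OF \<Lambda>] and sub = characteristic_set_subset[OF \<Lambda>]
  obtain fs where fs: "set fs = \<Lambda>" "sorted_wrt rank_less fs" using ex_sorted_autoreduced[OF ar] by blast
  define us where "us = takeWhile (\<lambda>f. rank_less f g) fs"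
  define ws where "ws = dropWhile (\<lambda>f. rank_less f g) fs"
  have uw: "fs = us @ ws" by (simp add: us_def ws_def)
  have us: "rank_less f g" if "f \<in> set us" for f using that unfolding us_def by (rule set_takeWhileD[THEN conjunct2])
  have us\<Lambda>: "set us \<subseteq> \<Lambda>" using fs(1) uw by auto
  have ne: "dpoly_rank f \<noteq> dpoly_rank g" if "f \<in> \<Lambda>" for f
    using reduced_wrt_same_leader[OF red[OF that]] by (auto simp: dpoly_rank_def)
  let ?gs = "us @ [g]"
  have sorted: "sorted_wrt rank_less ?gs"
    using fs(2) us unfolding uw by (auto simp: sorted_wrt_append)
  have lt: "ind_less (leader f) (leader g)" if "f \<in> set us" for f
    using us[OF that] reduced_wrt_same_leader[OF red, of f] us\<Lambda> that by (auto simp: rank_less_def)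
  have "autoreduced n (set ?gs)"
    unfolding autoreduced_def
  proof (intro conjI ballI impI)
    show "set ?gs \<subseteq> polys UNIV (inds n)"
      using us\<Lambda> sub g prime_in_polys[OF P] by auto
    show "vars f \<noteq> {}" if "f \<in> set ?gs" for f
      using that False autoreduced_nonconst[OF ar, of f] us\<Lambda> by auto
    fix f f' assume ff: "f \<in> set ?gs" "f' \<in> set ?gs" "f \<noteq> f'"
    show "reduced_wrt f f'"
    proof (cases "f' = g")
      case True
      then have "f \<in> set us" using ff by auto
      then show ?thesis
        using reduced_wrt_if_leader_less[OF False _ lt, of f] autoreduced_nonconst[OF ar, of f] us\<Lambda> True by blast
    next
      case f': False
      then have f'u: "f' \<in> \<Lambda>" using ff us\<Lambda> by auto
      show ?thesis
      proof (cases "f = g")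
        case True
        then show ?thesis using red[OF f'u] by simp
      next
        case False
        then show ?thesis using ff us\<Lambda> f'u autoreduced_reduced[OF ar, of f f'] by auto
      qed
    qed
  qed
  moreover have "set ?gs \<subseteq> P" using us\<Lambda> sub g by auto
  moreover have "autoreduced_less (set ?gs) \<Lambda>"
  proof (cases ws)
    case Nil
    then have "fs = us" using uw by simp
    then have "length ?gs > length fs \<and> (\<forall>j<length fs. dpoly_rank (?gs ! j) = dpoly_rank (fs ! j))"
      by (simp add: nth_append)
    then show ?thesis unfolding autoreduced_less_def using fs sorted by blast
  next
    case (Cons w ws')
    then have "\<not> rank_less w g" using hd_dropWhile[of "\<lambda>f. rank_less f g" fs] ws_def by auto
    moreover have "w \<in> \<Lambda>" using fs(1) uw Cons by auto
    ultimately have "rank_less g w" using ne[of w] rank_less_linear[of w g] by blast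
    then have "length us < length ?gs \<and> length us < length fs \<and>
        (\<forall>j<length us. dpoly_rank (?gs ! j) = dpoly_rank (fs ! j)) \<and> rank_less (?gs ! length us) (fs ! length us)"
      using uw Cons by (simp add: nth_append)
    then show ?thesis unfolding autoreduced_less_def using fs sorted by blast
  qed
  ultimately show ?thesis using characteristic_set_minimal[OF \<Lambda>] by blast
qed

section \<open>Initials and separants of a characteristic set\<close>

lemma degb_partial:
  assumes "degb w n f"
  shows "degb w n (partial v f)" and "0 < n \<Longrightarrow> degb v n f \<Longrightarrow> degb v (n - 1) (partial v f)"
proof -
  have *: "t + single v 1 \<in> keys f" if "t \<in> keys (partial v f)" for t
    using that by (auto simp: in_keys_iff lookup_partial)
  show "degb w n (partial v f)"
    unfolding degb_def
  proof
    fix t assume "t \<in> keys (partial v f)"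
    then have "lookup (t + single v 1) w < n" using * assms by (auto simp: degb_def)
    then show "lookup t w < n" by (simp add: lookup_add)
  qed
  show "degb v (n - 1) (partial v f)" if "0 < n" "degb v n f"
    unfolding degb_def
  proof
    fix t assume "t \<in> keys (partial v f)"
    then have "lookup (t + single v 1) v < n" using * that(2) by (auto simp: degb_def)
    then show "lookup t v < n - 1" by (simp add: lookup_add)
  qed
qed

text \<open>Characteristic 0 keeps the exponent that differentiation brings down from vanishing;
  hence separants are nonzero.\<close>

lemma partial_neq_0:
  fixes f :: "('v, 'a::field_char_0) mpoly"
  assumes "v \<in> vars f"
  shows "partial v f \<noteq> 0"
proof
  assume p: "partial v f = 0"
  obtain t where t: "t \<in> keys f" "lookup t v \<noteq> 0" using assms by (auto simp: vars_iff)
  have "t - single v 1 + single v 1 = t"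
    by (intro poly_mapping_eqI) (use t(2) in \<open>auto simp: lookup_minus lookup_add lookup_single when_def\<close>)
  then have "of_nat (Suc (lookup (t - single v 1) v)) * lookup f t = 0"
    using lookup_partial[of v f "t - single v 1"] p by simp
  then show False using t(1) by (simp only: mult_eq_0_iff of_nat_eq_0_iff) (auto simp: in_keys_iff)
qed

text \<open>Collects what initial and separant of \<open>f\<close> have in common: no new
  indeterminates, smaller degree in the leader and no larger degree elsewhere.\<close>

lemma char_set_coeff_reduced:
  fixes f :: "('m::{finite,linorder}, 'a::comm_ring_1) dpoly"
  assumes ar: "autoreduced n \<Lambda>" and f: "f \<in> \<Lambda>" "g \<in> \<Lambda>"
    and c: "vars c \<subseteq> vars f" "degb (leader f) (leader_deg f) c"
    "\<And>w m. w \<noteq> leader f \<Longrightarrow> degb w m f \<Longrightarrow> degb w m c"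
  shows "reduced_wrt c g"
proof (cases "g = f")
  case True
  have ne: "vars f \<noteq> {}" by (rule autoreduced_nonconst[OF ar f(1)])
  have "shift \<eta> (leader f) \<notin> vars c" if "\<eta> \<noteq> 0" for \<eta>
  proof
    assume "shift \<eta> (leader f) \<in> vars c"
    then have "shift \<eta> (leader f) \<in> vars f" using c(1) by blast
    then have "shift \<eta> (leader f) = leader f \<or> ind_less (shift \<eta> (leader f)) (leader f)"
      using ind_less_leader[OF ne] by blast
    then show False using ind_less_shift[OF that, of "leader f"] ind_less_asym ind_less_irrefl by metis
  qed
  moreover have "deg_in (leader f) c < leader_deg f"
    using c(2) leader_deg_pos[OF ne] by (simp add: deg_in_less_iff)
  ultimately show ?thesis unfolding True by (auto simp: reduced_wrt_def proper_derivatives_eq)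
next
  case False
  then have r: "reduced_wrt f g" using autoreduced_reduced[OF ar f] by blast
  have "leader g \<noteq> leader f" using autoreduced_leader_inj[OF ar f(2,1)] False by blast
  then have "deg_in (leader g) c < leader_deg g"
    using c(3)[of "leader g" "leader_deg g"] reduced_wrtD(2)[OF r] by (simp add: deg_in_less_iff)
  then show ?thesis using r c(1) unfolding reduced_wrt_def by blast
qed

text \<open>Both are nonzero and reduced with respect to every element of the characteristic set, so
  \<open>reduced_imp_eq_0\<close> excludes them from \<open>P\<close>.\<close>

lemma initial_separant_notin:
  fixes P :: "('m::{finite,linorder}, 'a::field_char_0) dpoly set"
  assumes P: "prime_in UNIV (inds n) P" and \<Lambda>: "characteristic_set n P \<Lambda>" and f: "f \<in> \<Lambda>"
  shows "initial f \<notin> P" "separant f \<notin> P"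
proof -
  note ar = characteristic_set_autoreduced[OF \<Lambda>]
  have ne: "vars f \<noteq> {}" by (rule autoreduced_nonconst[OF ar f])
  have f0: "f \<noteq> 0" using ne by auto
  note pos = leader_deg_pos[OF ne]
  have "reduced_wrt (initial f) g" if "g \<in> \<Lambda>" for g
  proof (rule char_set_coeff_reduced[OF ar f that])
    show "vars (initial f) \<subseteq> vars f" using vars_coeff_in[of "leader f" "leader_deg f" f] by (auto simp: initial_def)
    have "leader f \<notin> vars (initial f)" using vars_coeff_in[of "leader f" "leader_deg f" f] by (auto simp: initial_def)
    then show "degb (leader f) (leader_deg f) (initial f)"
      using degb_mono[of "leader f" 1 "initial f" "leader_deg f"] pos by (simp add: degb_1_iff)
    show "degb w m (initial f)" if "w \<noteq> leader f" "degb w m f" for w m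
      unfolding initial_def by (rule degb_coeff_in[OF that(2,1)])
  qed
  then show "initial f \<notin> P"
    using reduced_imp_eq_0[OF P \<Lambda>, of "initial f"] coeff_in_deg_in_neq_0[OF f0, of "leader f"]
    by (auto simp: initial_def leader_deg_def)
  have "reduced_wrt (separant f) g" if "g \<in> \<Lambda>" for g
  proof (rule char_set_coeff_reduced[OF ar f that])
    show "vars (separant f) \<subseteq> vars f" unfolding separant_def by (rule vars_partial)
    show "degb (leader f) (leader_deg f) (separant f)"
      using degb_partial(2)[OF degb_deg_in[of "leader f" f], of "leader f"] degb_deg_in[of "leader f" f]
      by (simp add: separant_def leader_deg_def)
    show "degb w m (separant f)" if "w \<noteq> leader f" "degb w m f" for w m
      unfolding separant_def by (rule degb_partial(1)[OF that(2)])
  qed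
  then show "separant f \<notin> P"
    using reduced_imp_eq_0[OF P \<Lambda>, of "separant f"] partial_neq_0[OF leader_in_vars[OF ne]]
    by (auto simp: separant_def)
qed

lemma vars_initial: "vars (initial f) \<subseteq> vars f"
  using vars_coeff_in[of "leader f" "leader_deg f" f] by (auto simp: initial_def)

lemma vars_separant: "vars (separant f) \<subseteq> vars f"
  unfolding separant_def by (rule vars_partial)

lemma vars_H_prod:
  assumes "\<And>f. f \<in> \<Lambda> \<Longrightarrow> vars f \<subseteq> V"
  shows "vars (H_prod \<Lambda>) \<subseteq> V"
  unfolding H_prod_def
proof (rule vars_prod)
  fix f assume "f \<in> \<Lambda>"
  then show "vars (initial f * separant f) \<subseteq> V"
    using vars_mult[of "initial f" "separant f"] vars_initial[of f] vars_separant[of f] assms by blast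
qed

lemma H_prod_notin:
  fixes P :: "('m::{finite,linorder}, 'a::field_char_0) dpoly set"
  assumes P: "prime_in UNIV (inds n) P" and \<Lambda>: "characteristic_set n P \<Lambda>"
  shows "H_prod \<Lambda> \<notin> P"
  unfolding H_prod_def
proof (rule prime_in_prod_notin[OF P])
  fix f assume f: "f \<in> \<Lambda>"
  have v: "vars (initial f) \<subseteq> inds n" "vars (separant f) \<subseteq> inds n"
    using vars_initial[of f] vars_separant[of f] autoreduced_vars[OF characteristic_set_autoreduced[OF \<Lambda>] f] by auto
  then have "initial f * separant f \<notin> P"
    using prime_in_prime'[OF P, of "initial f" "separant f"] initial_separant_notin[OF P \<Lambda> f] by blast
  then show "initial f * separant f \<notin> P \<and> vars (initial f * separant f) \<subseteq> inds n"
    using vars_mult[of "initial f" "separant f"] v by blast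
qed

subsection \<open>Reduction modulo a characteristic set\<close>

lemma lookup_mult_pvar:
  fixes s :: "('v, 'a::comm_ring_1) mpoly"
  shows "lookup (s * pvar v) (t + single v 1) = lookup s t"
    and "lookup t v = 0 \<Longrightarrow> lookup (s * pvar v) t = 0"
proof -
  show "lookup (s * pvar v) (t + single v 1) = lookup s t"
    by (induction s rule: mpoly_single_induct)
       (simp_all add: pvar_def mult_single lookup_single when_def lookup_add distrib_right)
  assume t: "lookup t v = 0"
  show "lookup (s * pvar v) t = 0"
  proof (rule ccontr)
    assume "lookup (s * pvar v) t \<noteq> 0"
    then have "t \<in> keys (s * pvar v)" by (simp add: in_keys_iff)
    then obtain u where "t = u + single v 1"
      using Poly_Mapping.keys_mult[of s "pvar v"] by (auto simp: pvar_def)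
    then show False using t by (simp add: lookup_add)
  qed
qed

text \<open>Every term of \<open>S * pvar v\<close> contains \<open>v\<close> and no term of
  \<open>g\<close> does, so the two parts cannot cancel.\<close>

lemma linear_in_var:
  fixes S g :: "('v, 'a::comm_ring_1) mpoly"
  assumes "v \<notin> vars S" "v \<notin> vars g"
  shows "vars S \<subseteq> vars (S * pvar v + g)" "vars g \<subseteq> vars (S * pvar v + g)"
    "partial v (S * pvar v + g) = S"
proof -
  let ?F = "S * pvar v + g"
  have g0: "lookup g t = 0" if "lookup t v \<noteq> 0" for t
  proof -
    have "t \<notin> keys g" using assms(2) that by (auto simp: vars_iff)
    then show ?thesis by (simp add: in_keys_iff)
  qed
  show "vars S \<subseteq> vars ?F"
  proof
    fix w assume "w \<in> vars S"
    then obtain t where t: "lookup S t \<noteq> 0" "lookup t w \<noteq> 0" by (auto simp: vars_iff in_keys_iff)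
    have "lookup ?F (t + single v 1) = lookup S t"
      using lookup_mult_pvar(1)[of S v t] g0[of "t + single v 1"] by (simp add: lookup_add)
    then have "t + single v 1 \<in> keys ?F" "lookup (t + single v 1) w \<noteq> 0" using t by (auto simp: in_keys_iff lookup_add)
    then show "w \<in> vars ?F" using vars_iff[of w ?F] by blast
  qed
  show "vars g \<subseteq> vars ?F"
  proof
    fix w assume "w \<in> vars g"
    then obtain t where t: "lookup g t \<noteq> 0" "lookup t w \<noteq> 0" by (auto simp: vars_iff in_keys_iff)
    then have "lookup t v = 0" using g0[of t] by blast
    then have "lookup ?F t \<noteq> 0" using lookup_mult_pvar(2)[of t v S] t(1) by (simp add: lookup_add)
    then show "w \<in> vars ?F" using t(2) vars_iff[of w ?F] in_keys_iff[of t ?F] by blast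
  qed
  show "partial v ?F = S"
    by (simp add: partial_add partial_mult partial_notin_vars assms partial_pvar)
qed

lemma finite_inds_upto [simp]: "finite (inds_upto n r :: 'm::finite ind set)"
proof -
  have "inds_upto n r \<subseteq> {..<n} \<times> {t :: 'm \<Rightarrow>\<^sub>0 nat. keys t \<subseteq> UNIV \<and> (\<forall>v. lookup t v < Suc r)}"
  proof
    fix v :: "'m ind" assume "v \<in> inds_upto n r"
    then obtain i \<xi> where v: "v = (i, \<xi>)" "i < n" "index_order \<xi> \<le> r" by (auto simp: inds_upto_def)
    have "lookup \<xi> k \<le> index_order \<xi>" for k
      unfolding index_order_def by (rule member_le_sum) auto
    then have "lookup \<xi> k < Suc r" for k using v(3) by (metis le_imp_less_Suc le_trans)
    then show "v \<in> {..<n} \<times> {t. keys t \<subseteq> UNIV \<and> (\<forall>v. lookup t v < Suc r)}" using v by simp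
  qed
  then show ?thesis by (rule finite_subset) (simp add: card_exponents(2)[of UNIV, simplified])
qed

lemma inds_upto_subset_inds: "inds_upto n r \<subseteq> inds n"
  by (auto simp: inds_upto_def inds_def)

lemma inds_upto_iff: "v \<in> inds_upto n r \<longleftrightarrow> v \<in> inds n \<and> index_order (snd v) \<le> r"
  by (auto simp: inds_upto_def inds_def)

lemma ex_inds_upto:
  assumes "finite A" "A \<subseteq> inds n"
  shows "\<exists>r. A \<subseteq> inds_upto n r"
proof -
  have "index_order (snd v) \<le> (\<Sum>v\<in>A. index_order (snd v))" if "v \<in> A" for v
    by (rule member_le_sum) (use assms(1) that in auto)
  then show ?thesis using assms(2) inds_upto_iff by blast
qed

lemma ex_descending_list:
  assumes "finite (M :: 'm::{finite,linorder} ind set)"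
  shows "\<exists>vs. set vs = M \<and> sorted_wrt (\<lambda>v w. ind_less w v) vs"
proof -
  obtain us where "set us = M" "sorted_wrt ind_less us"
    using ex_sorted_wrt_strict[OF assms wf_ind_less] ind_less_total by blast
  then show ?thesis by (intro exI[of _ "rev us"]) (simp add: sorted_wrt_rev)
qed

lemma tri_descending:
  assumes "sorted_wrt (\<lambda>v w. ind_less w v) vs"
    and "\<And>v. v \<in> set vs \<Longrightarrow> v \<in> V \<and> vars (\<theta> v) \<subseteq> {w \<in> V. w = v \<or> ind_less w v}"
  shows "tri V vs \<theta>"
  using assms
proof (induction vs arbitrary: V)
  case (Cons v vs)
  have "tri (V - {v}) vs \<theta>"
  proof (rule Cons.IH)
    fix u assume u: "u \<in> set vs"
    then have less: "ind_less u v" using Cons.prems(1) by simp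
    then have "w \<noteq> v" if "w = u \<or> ind_less w u" for w
      using that ind_less_trans[of w u v] ind_less_irrefl by blast
    then show "u \<in> V - {v} \<and> vars (\<theta> u) \<subseteq> {w \<in> V - {v}. w = u \<or> ind_less w u}"
      using Cons.prems(2)[of u] u by auto
  qed (use Cons.prems(1) in simp)
  then show ?case using Cons.prems(2)[of v] by auto
qed simp

locale prime_char_set =
  fixes d :: "'m::{finite,linorder} \<Rightarrow> 'a::field_char_0 \<Rightarrow> 'a" and n :: nat
    and P \<Lambda> :: "('m, 'a) dpoly set"
  assumes d: "differential_field d" and P: "prime_in UNIV (inds n) P"
    and deriv_P: "\<And>k f. f \<in> P \<Longrightarrow> dpoly_deriv d k f \<in> P"
    and \<Lambda>: "characteristic_set n P \<Lambda>"
begin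

lemmas autoreduced = characteristic_set_autoreduced[OF \<Lambda>]

lemma iter_deriv_in_P: "f \<in> P \<Longrightarrow> iter_deriv (dpoly_deriv d) \<xi> f \<in> P"
  by (rule iter_deriv_closed) (use deriv_P in auto)

text \<open>For each derivative \<open>v\<close> of a leader fix one derivative \<open>theta v\<close> of an element of the
  characteristic set with leader \<open>v\<close>, its leading coefficient \<open>lead v\<close> and its degree in \<open>v\<close>.\<close>

definition principal :: "'m ind \<Rightarrow> bool" where
  "principal v \<longleftrightarrow> (\<exists>f\<in>\<Lambda>. \<exists>\<xi>. v = shift \<xi> (leader f))"

text \<open>One specification from which polynomial, leading coefficient and degree are chosen in
  turn. At leaders of \<open>\<Lambda>\<close> the degree is that of the element of
  \<open>\<Lambda>\<close>; at other derivatives of leaders the polynomial is linear in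
  \<open>v\<close> with a separant as coefficient.\<close>

definition theta_spec :: "'m ind \<Rightarrow> ('m, 'a) dpoly \<Rightarrow> ('m, 'a) dpoly \<Rightarrow> nat \<Rightarrow> bool" where
  "theta_spec v \<theta> I D \<longleftrightarrow>
    (\<exists>f\<in>\<Lambda>. (\<exists>\<xi>. \<theta> = iter_deriv (dpoly_deriv d) \<xi> f) \<and> (I = initial f \<or> I = separant f) \<and>
       partial v \<theta> = separant f \<and>
       (if v = leader f then D = leader_deg f else v \<notin> leader ` \<Lambda> \<and> D = 1 \<and> I = separant f \<and>
          vars f \<subseteq> {w. ind_less w v})) \<and>
    vars \<theta> \<subseteq> {w \<in> inds n. w = v \<or> ind_less w v} \<and>
    (\<exists>\<theta>'. \<theta> = I * pvar v ^ D + \<theta>' \<and> degb v D \<theta>' \<and> v \<notin> vars I \<and> vars I \<subseteq> vars \<theta> \<and> vars \<theta>' \<subseteq> vars \<theta>)"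

definition theta :: "'m ind \<Rightarrow> ('m, 'a) dpoly" where
  "theta v = (SOME \<theta>. \<exists>I D. theta_spec v \<theta> I D)"

definition lead :: "'m ind \<Rightarrow> ('m, 'a) dpoly" where
  "lead v = (SOME I. \<exists>D. theta_spec v (theta v) I D)"

definition theta_deg :: "'m ind \<Rightarrow> nat" where
  "theta_deg v = (SOME D. theta_spec v (theta v) (lead v) D)"

lemma theta_spec:
  assumes "principal v"
  shows "theta_spec v (theta v) (lead v) (theta_deg v)"
proof -
  have "\<exists>\<theta> I D. theta_spec v \<theta> I D"
  proof (cases "v \<in> leader ` \<Lambda>")
    case True
    then obtain f where f: "f \<in> \<Lambda>" "v = leader f" by blast
    have ne: "vars f \<noteq> {}" by (rule autoreduced_nonconst[OF autoreduced f(1)])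
    obtain g where g: "f = initial f * pvar v ^ leader_deg f + g" "degb v (leader_deg f) g" "vars g \<subseteq> vars f"
    proof -
      have "degb v (Suc (leader_deg f)) f"
        unfolding leader_deg_def f(2) by (rule degb_deg_in)
      then show thesis
        by (rule coeff_in_split) (rule that, simp_all add: initial_def f(2))
    qed
    have "vars f \<subseteq> {w \<in> inds n. w = v \<or> ind_less w v}"
      using autoreduced_vars[OF autoreduced f(1)] ind_less_leader[OF ne] f(2) by blast
    moreover have "v \<notin> vars (initial f)"
      using vars_coeff_in[of v "leader_deg f" f] f(2) by (auto simp: initial_def)
    moreover have "f = iter_deriv (dpoly_deriv d) 0 f" "partial v f = separant f"
      by (simp_all add: separant_def f(2))
    ultimately have "theta_spec v f (initial f) (leader_deg f)"
      unfolding theta_spec_def using f g vars_initial[of f]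
      by (intro conjI bexI[of _ f] exI[of _ g]) (auto intro: exI[of _ 0])
    then show ?thesis by blast
  next
    case False
    obtain f \<xi> where f: "f \<in> \<Lambda>" "v = shift \<xi> (leader f)" using assms by (auto simp: principal_def)
    have ne: "vars f \<noteq> {}" by (rule autoreduced_nonconst[OF autoreduced f(1)])
    have \<xi>: "\<xi> \<noteq> 0" using False f by auto
    let ?F = "iter_deriv (dpoly_deriv d) \<xi> f"
    obtain g where g: "?F = separant f * pvar v + g" "\<And>w. w \<in> vars g \<Longrightarrow> ind_less w v"
      using iter_dpoly_deriv_leader[OF d ne \<xi>] f(2) by blast
    have vf: "ind_less w v" if "w \<in> vars f" for w
      using ind_less_leader[OF ne that] ind_less_shift[OF \<xi>, of "leader f"] f(2)
        ind_less_trans[of w "leader f" v] by (cases "w = leader f") auto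
    have "v \<notin> vars (separant f)" using vf vars_separant[of f] ind_less_irrefl by blast
    moreover have "v \<notin> vars g" using g(2) ind_less_irrefl by blast
    ultimately have l: "vars (separant f) \<subseteq> vars ?F" "vars g \<subseteq> vars ?F" "partial v ?F = separant f"
      and dg: "degb v 1 g" and vS: "v \<notin> vars (separant f)"
      using linear_in_var[of v "separant f" g] unfolding g(1) by (simp_all add: degb_1_iff)
    have "vars ?F \<subseteq> {w. w = v \<or> ind_less w v}"
    proof
      fix w assume "w \<in> vars ?F"
      then have "w \<in> vars (separant f) \<union> {v} \<union> vars g"
        using vars_add[of "separant f * pvar v" g] vars_mult[of "separant f" "pvar v"] vars_pvar[of v, where 'a = 'a]
        unfolding g(1) by blast
      then show "w \<in> {w. w = v \<or> ind_less w v}" using vf g(2) vars_separant[of f] by blast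
    qed
    moreover have "vars ?F \<subseteq> inds n"
      by (rule vars_iter_dpoly_deriv[OF d autoreduced_vars[OF autoreduced f(1)]])
    ultimately have 1: "vars ?F \<subseteq> {w \<in> inds n. w = v \<or> ind_less w v}" by blast
    have 2: "\<exists>\<xi>'. ?F = iter_deriv (dpoly_deriv d) \<xi>' f" by blast
    have 3: "?F = separant f * pvar v ^ 1 + g" using g(1) by simp
    have 4: "if v = leader f then 1 = leader_deg f else v \<notin> leader ` \<Lambda> \<and> (1 :: nat) = 1 \<and>
        separant f = separant f \<and> vars f \<subseteq> {w. ind_less w v}"
      using vf False f(1) by auto
    have "theta_spec v ?F (separant f) 1"
      unfolding theta_spec_def
      by (intro conjI bexI[OF _ f(1)] exI[of _ g] 1 2 3 4 l dg vS disjI2[OF refl])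
    then show ?thesis by blast
  qed
  then have "\<exists>I D. theta_spec v (theta v) I D" unfolding theta_def by (rule someI_ex)
  then have "\<exists>D. theta_spec v (theta v) (lead v) D" unfolding lead_def by (rule someI_ex)
  then show ?thesis unfolding theta_deg_def by (rule someI_ex)
qed

lemma theta_in_P: "principal v \<Longrightarrow> theta v \<in> P"
  using theta_spec[of v] iter_deriv_in_P characteristic_set_subset[OF \<Lambda>]
  unfolding theta_spec_def by auto

lemma vars_theta: "principal v \<Longrightarrow> vars (theta v) \<subseteq> {w \<in> inds n. w = v \<or> ind_less w v}"
  using theta_spec[of v] unfolding theta_spec_def by blast

lemma vars_theta_inds_upto:
  assumes "principal v" "v \<in> inds_upto n r"
  shows "vars (theta v) \<subseteq> {w \<in> inds_upto n r. w = v \<or> ind_less w v}"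
proof
  fix w assume "w \<in> vars (theta v)"
  then have w: "w \<in> inds n" "w = v \<or> ind_less w v" using vars_theta[OF assms(1)] by auto
  then have "index_order (snd w) \<le> index_order (snd v)" using ind_less_order by blast
  then show "w \<in> {w \<in> inds_upto n r. w = v \<or> ind_less w v}"
    using w assms(2) by (auto simp: inds_upto_iff)
qed

lemma theta_split:
  assumes "principal v"
  shows "\<exists>\<theta>'. theta v = lead v * pvar v ^ theta_deg v + \<theta>' \<and> degb v (theta_deg v) \<theta>' \<and>
    v \<notin> vars (lead v) \<and> vars (lead v) \<subseteq> vars (theta v) \<and> vars \<theta>' \<subseteq> vars (theta v)"
  using theta_spec[OF assms] unfolding theta_spec_def by (elim conjE)

lemma lead_cases: "principal v \<Longrightarrow> \<exists>f\<in>\<Lambda>. lead v = initial f \<or> lead v = separant f"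
  using theta_spec[of v] unfolding theta_spec_def by blast

lemma partial_theta: "principal v \<Longrightarrow> \<exists>f\<in>\<Lambda>. partial v (theta v) = separant f"
  using theta_spec[of v] unfolding theta_spec_def by blast

lemma theta_deg_leader:
  assumes "f \<in> \<Lambda>"
  shows "theta_deg (leader f) = leader_deg f"
proof -
  have "principal (leader f)" unfolding principal_def using assms by (intro bexI[of _ f] exI[of _ 0]) auto
  from theta_spec[OF this] obtain f' where f': "f' \<in> \<Lambda>"
    "if leader f = leader f' then theta_deg (leader f) = leader_deg f' else leader f \<notin> leader ` \<Lambda>"
    unfolding theta_spec_def by (auto split: if_splits)
  then have "leader f = leader f'" using assms by (auto split: if_splits)
  then show ?thesis using autoreduced_leader_inj[OF autoreduced assms f'(1)] f'(2) by simp
qed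

lemma theta_linear:
  assumes "principal v" "v \<notin> leader ` \<Lambda>"
  shows "theta_deg v = 1 \<and> (\<exists>f\<in>\<Lambda>. lead v = separant f)"
proof -
  obtain f where "f \<in> \<Lambda>" "if v = leader f then theta_deg v = leader_deg f else theta_deg v = 1 \<and> lead v = separant f"
    using theta_spec[OF assms(1)] unfolding theta_spec_def by (auto split: if_splits)
  then show ?thesis using assms(2) by (auto split: if_splits)
qed

lemma theta_in_prolongation:
  assumes "principal v" "v \<in> inds_upto n r"
  shows "theta v \<in> prolongation d n r \<Lambda>"
proof -
  have "\<exists>f\<in>\<Lambda>. \<exists>\<xi>. theta v = iter_deriv (dpoly_deriv d) \<xi> f"
    using theta_spec[OF assms(1)] unfolding theta_spec_def by blast
  moreover have "theta v \<in> polys UNIV (inds_upto n r)"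
    using vars_theta_inds_upto[OF assms] by (auto simp: polys_UNIV)
  ultimately show ?thesis unfolding prolongation_def by blast
qed

lemma prolongation_subset: "prolongation d n r \<Lambda> \<subseteq> P \<inter> polys UNIV (inds_upto n r)"
  using iter_deriv_in_P characteristic_set_subset[OF \<Lambda>] unfolding prolongation_def by auto

lemma ex_tri: "\<exists>vs. set vs = {v \<in> inds_upto n r. principal v} \<and> tri (inds_upto n r) vs theta"
proof -
  have "finite {v \<in> inds_upto n r. principal v}" by simp
  then obtain vs where vs: "set vs = {v \<in> inds_upto n r. principal v}" "sorted_wrt (\<lambda>v w. ind_less w v) vs"
    using ex_descending_list by blast
  have "tri (inds_upto n r) vs theta"
    by (rule tri_descending[OF vs(2)]) (use vs(1) vars_theta_inds_upto in auto)
  then show ?thesis using vs(1) by blast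
qed

text \<open>At a proper derivative of a leader the degree \<open>theta_deg\<close> is 1, so the
  bound says that this indeterminate is absent; at a leader it is the bound in the definition of
  \<open>reduced_wrt\<close>.\<close>

lemma reduced_if_degb:
  assumes g: "vars g \<subseteq> inds n" and deg: "\<And>v. principal v \<Longrightarrow> v \<in> vars g \<Longrightarrow> degb v (theta_deg v) g"
    and f: "f \<in> \<Lambda>"
  shows "reduced_wrt g f"
proof -
  have ne: "vars f \<noteq> {}" by (rule autoreduced_nonconst[OF autoreduced f])
  have "shift \<eta> (leader f) \<notin> vars g" if \<eta>: "\<eta> \<noteq> 0" for \<eta>
  proof
    let ?w = "shift \<eta> (leader f)"
    assume w: "?w \<in> vars g"
    have pr: "principal ?w" using f by (auto simp: principal_def)
    have "?w \<notin> leader ` \<Lambda>"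
      using autoreduced_leader_antichain[OF autoreduced f] \<eta> by (metis imageE)
    then have "theta_deg ?w = 1" using theta_linear[OF pr] by blast
    then show False using deg[OF pr w] w by (simp add: degb_1_iff)
  qed
  moreover have "deg_in (leader f) g < leader_deg f"
  proof (cases "leader f \<in> vars g")
    case True
    have "principal (leader f)" unfolding principal_def using f by (intro bexI[of _ f] exI[of _ 0]) auto
    then show ?thesis using deg[OF _ True] theta_deg_leader[OF f] leader_deg_pos[OF ne] by (simp add: deg_in_less_iff)
  next
    case False
    then show ?thesis
      using leader_deg_pos[OF ne] degb_mono[of "leader f" 1 g "leader_deg f"] by (simp add: deg_in_less_iff degb_1_iff)
  qed
  ultimately show ?thesis by (auto simp: reduced_wrt_def proper_derivatives_eq)
qed

text \<open>The remainder of the triangular reduction lies in \<open>P\<close> because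
  \<open>f\<close> and all \<open>theta v\<close> do. The ideal \<open>P\<close> itself thus takes
  over the part of a coherence condition, and one equation per main indeterminate also controls the
  other derivatives with that leader.\<close>

lemma reduction:
  assumes vs: "set vs = {v \<in> inds_upto n r. principal v}" "tri (inds_upto n r) vs theta"
    and f: "f \<in> P" "vars f \<subseteq> inds_upto n r"
  shows "\<exists>k c. (\<Prod>v\<in>set vs. lead v ^ k v) * f = (\<Sum>v\<in>set vs. c v * theta v)"
proof -
  let ?V = "inds_upto n r"
  have V: "?V \<subseteq> inds n" by (rule inds_upto_subset_inds)
  have spl: "\<exists>\<theta>'. theta v = lead v * pvar v ^ theta_deg v + \<theta>' \<and> degb v (theta_deg v) \<theta>' \<and>
      v \<notin> vars (lead v) \<and> vars (lead v) \<subseteq> vars (theta v) \<and> vars \<theta>' \<subseteq> vars (theta v)" if "v \<in> set vs" for v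
    using that vs(1) by (intro theta_split) simp
  have "\<exists>k c g. (\<Prod>v\<in>set vs. lead v ^ k v) * f = g + (\<Sum>v\<in>set vs. c v * theta v) \<and>
    vars g \<subseteq> vars f \<union> ?V \<and> (\<forall>v\<in>set vs. vars (c v) \<subseteq> vars f \<union> ?V) \<and>
    (\<forall>v\<in>set vs. degb v (theta_deg v) g) \<and> (\<forall>w m. w \<notin> ?V \<longrightarrow> degb w m f \<longrightarrow> degb w m g)"
    by (rule tri_reduce[OF vs(2)]) (rule spl)
  then obtain k c g where kcg: "(\<Prod>v\<in>set vs. lead v ^ k v) * f = g + (\<Sum>v\<in>set vs. c v * theta v)"
    "vars g \<subseteq> vars f \<union> ?V" "\<forall>v\<in>set vs. vars (c v) \<subseteq> vars f \<union> ?V" "\<forall>v\<in>set vs. degb v (theta_deg v) g"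
    by - (elim exE conjE, rule that)
  have pr: "principal v" "v \<in> ?V" if "v \<in> set vs" for v using that vs(1) by auto
  have vg: "vars g \<subseteq> ?V" using kcg(2) f(2) by blast
  have "vars (lead v ^ k v) \<subseteq> inds n" if "v \<in> set vs" for v
    using theta_split[OF pr(1)[OF that]] vars_theta[OF pr(1)[OF that]] vars_power[of "lead v" "k v"] by blast
  then have vs': "vars (\<Prod>v\<in>set vs. lead v ^ k v) \<subseteq> inds n" by (rule vars_prod)
  have "(\<Sum>v\<in>set vs. c v * theta v) \<in> P"
  proof (rule prime_in_sum[OF P])
    fix v assume v: "v \<in> set vs"
    then have "vars (c v) \<subseteq> inds n" using kcg(3) f(2) V by blast
    then show "c v * theta v \<in> P" using prime_in_mult'[OF P theta_in_P[OF pr(1)[OF v]]] by blast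
  qed
  then have "(\<Prod>v\<in>set vs. lead v ^ k v) * f - (\<Sum>v\<in>set vs. c v * theta v) \<in> P"
    by (intro prime_in_diff[OF P] prime_in_mult'[OF P f(1) vs'])
  then have gP: "g \<in> P" using kcg(1) by simp
  have "g = 0"
  proof (rule reduced_imp_eq_0[OF P \<Lambda> gP], rule reduced_if_degb)
    show "vars g \<subseteq> inds n" using vg V by blast
    show "degb v (theta_deg v) g" if "principal v" "v \<in> vars g" for v
      using kcg(4) that vg vs(1) by blast
  qed
  then show ?thesis using kcg(1) by auto
qed

section \<open>Zeros of the chosen equations where initials and separants do not vanish\<close>

lemma H_prod_nonzero:
  fixes h :: "'a \<Rightarrow> 'c::field"
  assumes h: "rhom h" and H: "poly_eval h b (H_prod \<Lambda>) \<noteq> 0" and f: "f \<in> \<Lambda>"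
  shows "poly_eval h b (initial f) \<noteq> 0" "poly_eval h b (separant f) \<noteq> 0"
proof -
  note E = rhom_poly_eval[OF h, of b]
  have "(\<Prod>f\<in>\<Lambda>. poly_eval h b (initial f) * poly_eval h b (separant f)) \<noteq> 0"
    using H unfolding H_prod_def rhom_prod[OF E] rhom_mult[OF E] .
  then have "poly_eval h b (initial f) * poly_eval h b (separant f) \<noteq> 0"
    using finite_autoreduced[OF autoreduced] f by (simp add: prod_zero_iff)
  then show "poly_eval h b (initial f) \<noteq> 0" "poly_eval h b (separant f) \<noteq> 0" by auto
qed

lemma lead_nonzero:
  fixes h :: "'a \<Rightarrow> 'c::field"
  assumes h: "rhom h" and H: "poly_eval h b (H_prod \<Lambda>) \<noteq> 0" and v: "principal v"
  shows "poly_eval h b (lead v) \<noteq> 0"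
  using lead_cases[OF v] H_prod_nonzero[OF h H] by metis

lemma prod_lead_nonzero:
  fixes h :: "'a \<Rightarrow> 'c::field"
  assumes h: "rhom h" and H: "poly_eval h b (H_prod \<Lambda>) \<noteq> 0" and vs: "\<And>v. v \<in> A \<Longrightarrow> principal v"
  shows "poly_eval h b (\<Prod>v\<in>A. lead v ^ k v) \<noteq> 0"
proof (cases "finite A")
  case True
  note E = rhom_poly_eval[OF h, of b]
  show ?thesis
    unfolding rhom_prod[OF E] rhom_power[OF E] using True lead_nonzero[OF h H] vs by (simp add: prod_zero_iff)
qed (simp add: poly_eval_1[OF h])

text \<open>The target of \<open>h\<close> is arbitrary, since this is applied both to points of the
  base field and to points of the universal field.\<close>

lemma zero_of_theta:
  fixes h :: "'a \<Rightarrow> 'c::field"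
  assumes h: "rhom h" and H: "poly_eval h b (H_prod \<Lambda>) \<noteq> 0"
    and zero: "\<And>v. principal v \<Longrightarrow> v \<in> inds_upto n r \<Longrightarrow> poly_eval h b (theta v) = 0"
    and f: "f \<in> P" "vars f \<subseteq> inds_upto n r"
  shows "poly_eval h b f = 0"
proof -
  obtain vs where vs: "set vs = {v \<in> inds_upto n r. principal v}" "tri (inds_upto n r) vs theta"
    using ex_tri by blast
  obtain k c where kc: "(\<Prod>v\<in>set vs. lead v ^ k v) * f = (\<Sum>v\<in>set vs. c v * theta v)"
    using reduction[OF vs f] by blast
  note E = rhom_poly_eval[OF h, of b]
  have "poly_eval h b (\<Prod>v\<in>set vs. lead v ^ k v) * poly_eval h b f =
      (\<Sum>v\<in>set vs. poly_eval h b (c v) * poly_eval h b (theta v))"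
    using arg_cong[OF kc, of "poly_eval h b"] by (simp only: rhom_mult[OF E] rhom_sum[OF E])
  also have "\<dots> = 0" by (intro sum.neutral) (use zero vs(1) in auto)
  finally show ?thesis
    using prod_lead_nonzero[OF h H, of "set vs" k] vs(1) by auto
qed

text \<open>A differential zero of \<open>\<Lambda>\<close> is a zero of all derivatives of its
  elements, in particular of every \<open>theta v\<close>.\<close>

lemma zero_of_char_set:
  fixes D :: "'m \<Rightarrow> 'c::field_char_0 \<Rightarrow> 'c"
  assumes D: "differential_field D" and h: "rhom h" "\<And>k c. h (d k c) = D k (h c)"
    and H: "poly_eval h (jet D b) (H_prod \<Lambda>) \<noteq> 0"
    and zero: "\<And>f. f \<in> \<Lambda> \<Longrightarrow> poly_eval h (jet D b) f = 0" and f: "f \<in> P"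
  shows "poly_eval h (jet D b) f = 0"
proof -
  obtain r where r: "vars f \<subseteq> inds_upto n r"
    using ex_inds_upto[OF finite_vars] prime_in_vars[OF P f] by blast
  show ?thesis
  proof (rule zero_of_theta[OF h(1) H _ f r])
    fix v assume "principal v" "v \<in> inds_upto n r"
    then obtain f \<xi> where "f \<in> \<Lambda>" "theta v = iter_deriv (dpoly_deriv d) \<xi> f"
      using theta_spec[of v] unfolding theta_spec_def by blast
    then show "poly_eval h (jet D b) (theta v) = 0"
      using poly_eval_jet_iter_deriv_eq_0[OF d D h zero] by simp
  qed
qed

lemma prime_in_P_upto: "prime_in UNIV (inds_upto n r) (P \<inter> polys UNIV (inds_upto n r))"
  by (rule prime_in_contract[OF P inds_upto_subset_inds])

text \<open>Input for \<open>smooth_at_tri\<close> and \<open>large_field_tri\<close>. The bound on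
  the variables of \<open>s\<close> allows the latter to rename \<open>s\<close> together with the
  equations.\<close>

lemma tri_data:
  assumes vs: "set vs = {v \<in> inds_upto n r. principal v}" "tri (inds_upto n r) vs theta"
    and H: "poly_eval (\<lambda>c. c) a (H_prod \<Lambda>) \<noteq> 0"
  shows "v \<in> set vs \<Longrightarrow> theta v \<in> P \<inter> polys UNIV (inds_upto n r)"
    and "v \<in> set vs \<Longrightarrow> poly_eval (\<lambda>c. c) a (partial v (theta v)) \<noteq> 0"
    and "f \<in> P \<inter> polys UNIV (inds_upto n r) \<Longrightarrow>
      \<exists>s c. poly_eval (\<lambda>c. c) a s \<noteq> 0 \<and> vars s \<subseteq> inds_upto n r \<and> s * f = (\<Sum>v\<in>set vs. c v * theta v)"
proof -
  have pr: "principal v" "v \<in> inds_upto n r" if "v \<in> set vs" for v using that vs(1) by auto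
  show "theta v \<in> P \<inter> polys UNIV (inds_upto n r)" if "v \<in> set vs"
    using theta_in_P[OF pr(1)[OF that]] tri_vars[OF vs(2) that] by (simp add: polys_UNIV)
  show "poly_eval (\<lambda>c. c) a (partial v (theta v)) \<noteq> 0" if "v \<in> set vs"
    using partial_theta[OF pr(1)[OF that]] H_prod_nonzero(2)[OF rhom_id H] by auto
  assume f: "f \<in> P \<inter> polys UNIV (inds_upto n r)"
  then obtain k c where kc: "(\<Prod>v\<in>set vs. lead v ^ k v) * f = (\<Sum>v\<in>set vs. c v * theta v)"
    using reduction[OF vs, of f] polys_UNIV[of f "inds_upto n r"] by blast
  have "vars (lead v ^ k v) \<subseteq> inds_upto n r" if "v \<in> set vs" for v
    using theta_split[OF pr(1)[OF that]] tri_vars[OF vs(2) that] vars_power[of "lead v" "k v"] by blast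
  then have "vars (\<Prod>v\<in>set vs. lead v ^ k v) \<subseteq> inds_upto n r" by (rule vars_prod)
  moreover have "poly_eval (\<lambda>c. c) a (\<Prod>v\<in>set vs. lead v ^ k v) \<noteq> 0"
    by (rule prod_lead_nonzero[OF rhom_id H]) (rule pr(1))
  ultimately show "\<exists>s c. poly_eval (\<lambda>c. c) a s \<noteq> 0 \<and> vars s \<subseteq> inds_upto n r \<and> s * f = (\<Sum>v\<in>set vs. c v * theta v)"
    using kc by blast
qed

lemma smooth_at_P:
  assumes H: "poly_eval (\<lambda>c. c) a (H_prod \<Lambda>) \<noteq> 0"
    and zero: "\<And>v. principal v \<Longrightarrow> v \<in> inds_upto n r \<Longrightarrow> poly_eval (\<lambda>c. c) a (theta v) = 0"
  shows "smooth_at (inds_upto n r) (P \<inter> polys UNIV (inds_upto n r)) a"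
proof -
  obtain vs where vs: "set vs = {v \<in> inds_upto n r. principal v}" "tri (inds_upto n r) vs theta"
    using ex_tri by blast
  show ?thesis
  proof (rule smooth_at_tri[OF finite_inds_upto vs(2)])
    show "poly_eval (\<lambda>c. c) a f = 0" if "f \<in> P \<inter> polys UNIV (inds_upto n r)" for f
      by (rule zero_of_theta[OF rhom_id H zero, of r]) (use that in \<open>auto simp: polys_UNIV\<close>)
    show "\<exists>s c. poly_eval (\<lambda>c. c) a s \<noteq> 0 \<and> s * f = (\<Sum>v\<in>set vs. c v * theta v)"
      if "f \<in> P \<inter> polys UNIV (inds_upto n r)" for f
      using tri_data(3)[OF vs H that] by blast
  qed (use tri_data(1,2)[OF vs H] in auto)
qed

text \<open>The separants being nonzero at the given point, the equations for the principal
  indeterminates of order above \<open>r\<close> are linear and can be solved successively.\<close>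

lemma extend_point:
  assumes \<Lambda>r: "\<Lambda> \<subseteq> polys UNIV (inds_upto n r)"
    and H: "poly_eval (\<lambda>c. c) a (H_prod \<Lambda>) \<noteq> 0"
    and zero: "\<And>v. principal v \<Longrightarrow> v \<in> inds_upto n r \<Longrightarrow> poly_eval (\<lambda>c. c) a (theta v) = 0"
  shows "\<exists>a'. poly_eval (\<lambda>c. c) a' (H_prod \<Lambda>) \<noteq> 0 \<and>
    (\<forall>v. principal v \<and> v \<in> inds_upto n r' \<longrightarrow> poly_eval (\<lambda>c. c) a' (theta v) = 0)"
proof -
  let ?M = "{v \<in> inds_upto n r'. principal v} - inds_upto n r"
  have "finite ?M" by simp
  then obtain us where us: "set us = ?M" "sorted_wrt (\<lambda>v w. ind_less w v) us"
    using ex_descending_list by blast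
  have t: "tri (inds_upto n r') us theta"
    by (rule tri_descending[OF us(2)]) (use us(1) vars_theta_inds_upto in auto)
  have v\<Lambda>: "vars f \<subseteq> inds_upto n r" if "f \<in> \<Lambda>" for f
    using \<Lambda>r that polys_UNIV[of f "inds_upto n r"] by blast
  \<comment> \<open>The leaders of \<open>\<Lambda>\<close> have order at most \<open>r\<close>, so
    above \<open>r\<close> only the linear case of \<open>theta_spec\<close> occurs; the coefficient
    is a separant and involves only coordinates that stay unchanged.\<close>
  have lin: "\<exists>g. theta v = lead v * pvar v + g \<and> v \<notin> vars g \<and> v \<notin> inds_upto n r \<and>
      vars (lead v) \<subseteq> inds_upto n r \<and> poly_eval (\<lambda>c. c) a (lead v) \<noteq> 0" if v: "v \<in> set us" for v
  proof -
    have pr: "principal v" and nr: "v \<notin> inds_upto n r" using v us(1) by auto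
    have "v \<noteq> leader f" if "f \<in> \<Lambda>" for f
      using leader_in_vars[OF autoreduced_nonconst[OF autoreduced that]] v\<Lambda>[OF that] nr by blast
    then have "v \<notin> leader ` \<Lambda>" by blast
    then obtain f where f: "theta_deg v = 1" "f \<in> \<Lambda>" "lead v = separant f" using theta_linear[OF pr] by blast
    obtain g where "theta v = lead v * pvar v ^ theta_deg v + g" "degb v (theta_deg v) g"
      using theta_split[OF pr] by blast
    then have "theta v = lead v * pvar v + g" "v \<notin> vars g" using f(1) by (simp_all add: degb_1_iff)
    moreover have "vars (lead v) \<subseteq> inds_upto n r" using f v\<Lambda> vars_separant by fastforce
    ultimately show ?thesis using nr lead_nonzero[OF rhom_id H pr] by blast
  qed
  then have "\<forall>v. \<exists>g. v \<in> set us \<longrightarrow> theta v = lead v * pvar v + g \<and> v \<notin> vars g" by blast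
  then obtain G where G: "\<And>v. v \<in> set us \<Longrightarrow> theta v = lead v * pvar v + G v \<and> v \<notin> vars (G v)" by metis
  have "\<exists>a'. (\<forall>w\<in>inds_upto n r. a' w = a w) \<and> (\<forall>v\<in>set us. poly_eval (\<lambda>c. c) a' (theta v) = 0)"
    by (rule tri_solve_linear[OF t, where S = lead and G = G]) (use G lin in blast)
  then obtain a' where a': "\<And>w. w \<in> inds_upto n r \<Longrightarrow> a' w = a w"
    "\<And>v. v \<in> set us \<Longrightarrow> poly_eval (\<lambda>c. c) a' (theta v) = 0" by blast
  have same: "poly_eval (\<lambda>c. c) a' f = poly_eval (\<lambda>c. c) a f" if "vars f \<subseteq> inds_upto n r" for f
    by (rule poly_eval_cong) (use that a'(1) in blast)
  have "vars (H_prod \<Lambda>) \<subseteq> inds_upto n r" by (rule vars_H_prod) (rule v\<Lambda>)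
  then have "poly_eval (\<lambda>c. c) a' (H_prod \<Lambda>) \<noteq> 0" using same H by simp
  moreover have "poly_eval (\<lambda>c. c) a' (theta v) = 0" if "principal v" "v \<in> inds_upto n r'" for v
  proof (cases "v \<in> inds_upto n r")
    case True
    then have "vars (theta v) \<subseteq> inds_upto n r" using vars_theta_inds_upto[OF that(1)] by blast
    then show ?thesis using same zero[OF that(1) True] by simp
  next
    case False
    then show ?thesis using a'(2) us(1) that by blast
  qed
  ultimately show ?thesis by blast
qed

end

subsection \<open>Renaming of indeterminates\<close>

lemma poly_eval_pconst_pvar: "poly_eval pconst pvar f = (f :: ('v, 'a::comm_ring_1) mpoly)"
proof (induction f rule: mpoly_induct)
  case (const c)
  show ?case by (rule poly_eval_pconst[OF rhom_pconst])
next
  case (var v)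
  show ?case by (rule poly_eval_pvar[OF rhom_pconst])
next
  case (add f g)
  then show ?case by (simp only: poly_eval_add[OF rhom_pconst])
next
  case (mult f g)
  then show ?case by (simp only: poly_eval_mult[OF rhom_pconst])
qed

definition rename :: "('v \<Rightarrow> 'w) \<Rightarrow> ('v, 'a::comm_ring_1) mpoly \<Rightarrow> ('w, 'a) mpoly" where
  "rename \<beta> = poly_eval pconst (\<lambda>v. pvar (\<beta> v))"

lemma rhom_rename: "rhom (rename \<beta>)"
  unfolding rename_def by (rule rhom_poly_eval[OF rhom_pconst])

lemma rename_pconst: "rename \<beta> (pconst c) = pconst c"
  unfolding rename_def by (rule poly_eval_pconst[OF rhom_pconst])

lemma rename_pvar: "rename \<beta> (pvar v) = pvar (\<beta> v)"
  unfolding rename_def by (rule poly_eval_pvar[OF rhom_pconst])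

lemma vars_rename: "vars f \<subseteq> V \<Longrightarrow> vars (rename \<beta> f) \<subseteq> \<beta> ` V"
  unfolding rename_def by (erule vars_poly_eval_subst) (auto simp: vars_pvar)

lemma poly_eval_rename:
  assumes "rhom h"
  shows "poly_eval h b (rename \<beta> f) = poly_eval h (\<lambda>v. b (\<beta> v)) f"
  unfolding rename_def poly_eval_subst[OF assms] poly_eval_pvar[OF assms] ..

lemma rename_rename_inverse:
  assumes "vars f \<subseteq> V" "\<And>v. v \<in> V \<Longrightarrow> \<gamma> (\<beta> v) = v"
  shows "rename \<gamma> (rename \<beta> f) = f"
proof -
  have "rename \<gamma> (rename \<beta> f) = poly_eval pconst (\<lambda>v. pvar (\<gamma> (\<beta> v))) f"
    unfolding rename_def[of \<gamma>] by (rule poly_eval_rename[OF rhom_pconst])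
  also have "\<dots> = poly_eval pconst pvar f"
    by (rule poly_eval_cong) (use assms in \<open>metis subsetD\<close>)
  finally show ?thesis by (simp only: poly_eval_pconst_pvar)
qed

lemma partial_rename:
  assumes f: "vars f \<subseteq> V" and \<beta>: "inj_on \<beta> V" and v: "v \<in> V"
  shows "partial (\<beta> v) (rename \<beta> f) = rename \<beta> (partial v f)"
  using f
proof (induction rule: polys_induct)
  case (const c)
  show ?case by (simp only: rename_pconst partial_pconst rhom_0[OF rhom_rename])
next
  case (var w)
  then have "\<beta> v = \<beta> w \<longleftrightarrow> v = w" using \<beta> v by (simp add: inj_on_eq_iff)
  then show ?case by (simp add: rename_pvar partial_pvar rhom_0[OF rhom_rename] rhom_1[OF rhom_rename])
next
  case (add f g)
  then show ?case by (simp only: rhom_add[OF rhom_rename] partial_add)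
next
  case (mult f g)
  then show ?case by (simp only: rhom_add[OF rhom_rename] rhom_mult[OF rhom_rename] partial_mult)
qed

lemma tri_rename:
  assumes "inj_on \<beta> V" "tri V vs \<theta>" "\<And>v. v \<in> set vs \<Longrightarrow> \<theta>' (\<beta> v) = rename \<beta> (\<theta> v)"
  shows "tri (\<beta> ` V) (map \<beta> vs) \<theta>'"
  using assms
proof (induction vs arbitrary: V)
  case (Cons v vs)
  have v: "v \<in> V" "vars (\<theta> v) \<subseteq> V" "tri (V - {v}) vs \<theta>" using Cons.prems(2) by auto
  have "inj_on \<beta> (V - {v})" using Cons.prems(1) by (rule inj_on_subset) blast
  then have "tri (\<beta> ` (V - {v})) (map \<beta> vs) \<theta>'"
    by (rule Cons.IH[OF _ v(3)]) (rule Cons.prems(3), simp)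
  moreover have "\<beta> ` (V - {v}) = \<beta> ` V - {\<beta> v}"
    using Cons.prems(1) v(1) by (auto simp: inj_on_def)
  moreover have "vars (\<theta>' (\<beta> v)) \<subseteq> \<beta> ` V" using Cons.prems(3)[of v] vars_rename[OF v(2)] by simp
  ultimately show ?case using v(1) by simp
qed simp

text \<open>\<open>large_field\<close> speaks of numbered indeterminates, so ideal, equations and
  point are renamed along a bijection from \<open>V\<close> to an initial segment. There the point
  is smooth by \<open>smooth_at_tri\<close>, and a polynomial outside the prime ideal cannot vanish
  at all rational zeros.\<close>

lemma large_field_tri:
  fixes a :: "'v \<Rightarrow> 'a::field"
  assumes large: "large_field TYPE('a)" and V: "finite V" and t: "tri V vs \<theta>"
    and P: "prime_in UNIV V P"
    and in_P: "\<And>v. v \<in> set vs \<Longrightarrow> \<theta> v \<in> P"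
    and van: "\<And>f. f \<in> P \<Longrightarrow> poly_eval (\<lambda>c. c) a f = 0"
    and sep: "\<And>v. v \<in> set vs \<Longrightarrow> poly_eval (\<lambda>c. c) a (partial v (\<theta> v)) \<noteq> 0"
    and gen: "\<And>f. f \<in> P \<Longrightarrow> \<exists>s c. poly_eval (\<lambda>c. c) a s \<noteq> 0 \<and> vars s \<subseteq> V \<and> s * f = (\<Sum>v\<in>set vs. c v * \<theta> v)"
    and q: "vars q \<subseteq> V" "q \<notin> P"
  shows "\<exists>a'. (\<forall>f\<in>P. poly_eval (\<lambda>c. c) a' f = 0) \<and> poly_eval (\<lambda>c. c) a' q \<noteq> 0"
proof -
  let ?N = "card V"
  obtain \<beta> :: "'v \<Rightarrow> nat" where \<beta>: "bij_betw \<beta> V {..<?N}"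
    using ex_bij_betw_finite_nat[OF V] by (auto simp: atLeast0LessThan)
  have im: "\<beta> ` V = {..<?N}" and inj: "inj_on \<beta> V" using \<beta> by (auto simp: bij_betw_def)
  define \<gamma> where "\<gamma> = inv_into V \<beta>"
  have \<gamma>\<beta>: "\<gamma> (\<beta> v) = v" if "v \<in> V" for v unfolding \<gamma>_def using inj that by simp
  have \<gamma>V: "\<gamma> i \<in> V" "\<beta> (\<gamma> i) = i" if "i \<in> {..<?N}" for i
    unfolding \<gamma>_def using that im[symmetric] by (simp_all only: inv_into_into f_inv_into_f)
  have vs\<gamma>: "vars (rename \<gamma> g) \<subseteq> V" if "vars g \<subseteq> {..<?N}" for g :: "(nat, 'a) mpoly"
    using vars_rename[OF that, of \<gamma>] \<gamma>V(1) by blast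
  have vs\<beta>: "vars (rename \<beta> f) \<subseteq> {..<?N}" if "vars f \<subseteq> V" for f :: "('v, 'a) mpoly"
    using vars_rename[OF that, of \<beta>] im by simp
  have inv1: "rename \<gamma> (rename \<beta> f) = f" if "vars f \<subseteq> V" for f :: "('v, 'a) mpoly"
    by (rule rename_rename_inverse[OF that]) (rule \<gamma>\<beta>)
  have inv2: "rename \<beta> (rename \<gamma> g) = g" if "vars g \<subseteq> {..<?N}" for g :: "(nat, 'a) mpoly"
    by (rule rename_rename_inverse[OF that]) (rule \<gamma>V(2))
  define a1 where "a1 i = a (\<gamma> i)" for i
  let ?E = "poly_eval (\<lambda>c. c)"
  have ev: "?E a1 (rename \<beta> f) = ?E a f" if "vars f \<subseteq> V" for f
    unfolding poly_eval_rename[OF rhom_id] by (rule poly_eval_cong) (use that \<gamma>\<beta> in \<open>auto simp: a1_def\<close>)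
  define P' where "P' = rename \<beta> ` P"
  have PV: "vars f \<subseteq> V" if "f \<in> P" for f using prime_in_vars[OF P that] .
  have P'_iff: "g \<in> P' \<longleftrightarrow> vars g \<subseteq> {..<?N} \<and> rename \<gamma> g \<in> P" for g
  proof
    assume "g \<in> P'"
    then obtain f where "f \<in> P" "g = rename \<beta> f" unfolding P'_def by blast
    then show "vars g \<subseteq> {..<?N} \<and> rename \<gamma> g \<in> P" using PV vs\<beta> inv1 by simp
  next
    assume "vars g \<subseteq> {..<?N} \<and> rename \<gamma> g \<in> P"
    then show "g \<in> P'" unfolding P'_def using inv2[of g] by (metis imageI)
  qed
  have prime: "prime_in UNIV {..<?N} P'"
    unfolding prime_in_def
  proof (intro conjI ballI impI)
    show "P' \<subseteq> polys UNIV {..<?N}" using P'_iff polys_UNIV[of _ "{..<?N}"] by blast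
    show "0 \<in> P'" by (simp add: P'_iff rhom_0[OF rhom_rename] prime_in_0[OF P])
    show "1 \<notin> P'" by (simp add: P'_iff rhom_1[OF rhom_rename] prime_in_1[OF P])
    show "f + g \<in> P'" if "f \<in> P'" "g \<in> P'" for f g
      using that vars_add[of f g] prime_in_add[OF P, of "rename \<gamma> f" "rename \<gamma> g"]
      unfolding P'_iff rhom_add[OF rhom_rename[of \<gamma>]] by blast
    show "g * f \<in> P'" if "f \<in> P'" "g \<in> polys UNIV {..<?N}" for f g
      using that vars_mult[of g f] prime_in_mult'[OF P, of "rename \<gamma> f" "rename \<gamma> g"] vs\<gamma>[of g]
      unfolding P'_iff rhom_mult[OF rhom_rename[of \<gamma>]] polys_UNIV by blast
    show "f \<in> P' \<or> g \<in> P'" if "f \<in> polys UNIV {..<?N}" "g \<in> polys UNIV {..<?N}" "f * g \<in> P'" for f g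
      using that prime_in_prime'[OF P, of "rename \<gamma> f" "rename \<gamma> g"] vs\<gamma>[of f] vs\<gamma>[of g]
      unfolding P'_iff rhom_mult[OF rhom_rename[of \<gamma>]] polys_UNIV by blast
  qed
  define \<theta>' where "\<theta>' i = rename \<beta> (\<theta> (\<gamma> i))" for i
  have vsV: "set vs \<subseteq> V" by (rule tri_subset[OF t])
  have \<theta>': "\<theta>' (\<beta> v) = rename \<beta> (\<theta> v)" if "v \<in> set vs" for v
    unfolding \<theta>'_def using \<gamma>\<beta> that vsV by (metis subsetD)
  have "smooth_at {..<?N} P' a1"
  proof (rule smooth_at_tri)
    show "tri {..<?N} (map \<beta> vs) \<theta>'" using tri_rename[OF inj t \<theta>'] im by simp
    show "P' \<subseteq> polys UNIV {..<?N}" using prime_in_polys[OF prime] by blast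
    show "\<theta>' i \<in> P'" if "i \<in> set (map \<beta> vs)" for i
      using that \<theta>' in_P unfolding P'_def by auto
    show "poly_eval (\<lambda>c. c) a1 g = 0" if "g \<in> P'" for g
      using that ev van PV unfolding P'_def by auto
    show "poly_eval (\<lambda>c. c) a1 (partial i (\<theta>' i)) \<noteq> 0" if i: "i \<in> set (map \<beta> vs)" for i
    proof -
      obtain v where v: "v \<in> set vs" "i = \<beta> v" using i by auto
      have vV: "vars (\<theta> v) \<subseteq> V" "v \<in> V" using PV[OF in_P[OF v(1)]] vsV v(1) by auto
      have "partial i (\<theta>' i) = rename \<beta> (partial v (\<theta> v))"
        unfolding v(2) \<theta>'[OF v(1)] by (rule partial_rename[OF vV(1) inj vV(2)])
      then show ?thesis using ev[of "partial v (\<theta> v)"] vars_partial[of v "\<theta> v"] vV(1) sep[OF v(1)] by auto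
    qed
    show "\<exists>s c. poly_eval (\<lambda>c. c) a1 s \<noteq> 0 \<and> s * g = (\<Sum>i\<in>set (map \<beta> vs). c i * \<theta>' i)" if "g \<in> P'" for g
    proof -
      obtain f where f: "f \<in> P" "g = rename \<beta> f" using \<open>g \<in> P'\<close> unfolding P'_def by blast
      obtain s c where s: "?E a s \<noteq> 0" "vars s \<subseteq> V" "s * f = (\<Sum>v\<in>set vs. c v * \<theta> v)" using gen[OF f(1)] by blast
      have "rename \<beta> s * g = rename \<beta> (s * f)" by (simp only: f(2) rhom_mult[OF rhom_rename])
      also have "\<dots> = (\<Sum>v\<in>set vs. rename \<beta> (c v) * rename \<beta> (\<theta> v))"
        unfolding s(3) rhom_sum[OF rhom_rename] rhom_mult[OF rhom_rename] ..
      also have "\<dots> = (\<Sum>v\<in>set vs. rename \<beta> (c (\<gamma> (\<beta> v))) * \<theta>' (\<beta> v))"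
        by (rule sum.cong) (use \<theta>' \<gamma>\<beta> vsV in auto)
      also have "\<dots> = (\<Sum>i\<in>set (map \<beta> vs). rename \<beta> (c (\<gamma> i)) * \<theta>' i)"
        using inj_on_subset[OF inj vsV] by (simp add: sum.reindex)
      finally show ?thesis using s(1) ev[OF s(2)] by (intro exI[of _ "rename \<beta> s"] exI[of _ "\<lambda>i. rename \<beta> (c (\<gamma> i))"]) simp
    qed
  qed simp
  moreover have "rename \<beta> q \<in> polys UNIV {..<?N}" "rename \<beta> q \<notin> P'"
    using vs\<beta>[OF q(1)] q inv1[OF q(1)] by (auto simp: polys_UNIV P'_iff)
  ultimately have "\<not> (\<forall>a. (\<forall>f\<in>P'. ?E a f = 0) \<longrightarrow> ?E a (rename \<beta> q) = 0)"
    using large prime unfolding large_field_def primeideal_iff[OF subr_UNIV] by blast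
  then obtain a2 where a2: "\<And>f. f \<in> P' \<Longrightarrow> ?E a2 f = 0" "?E a2 (rename \<beta> q) \<noteq> 0" by blast
  have "?E (\<lambda>v. a2 (\<beta> v)) f = 0" if "f \<in> P" for f
    using a2(1)[of "rename \<beta> f"] that unfolding P'_def poly_eval_rename[OF rhom_id] by blast
  then show ?thesis using a2(2) unfolding poly_eval_rename[OF rhom_id] by blast
qed


subsection \<open>Evaluation in rings given by records\<close>

lemma ring_of_type_algebra_simps [simp]:
  "carrier (ring_of_type_algebra :: 'a::ring_1 ring) = UNIV"
  "x \<otimes>\<^bsub>ring_of_type_algebra\<^esub> y = x * y" "x \<oplus>\<^bsub>ring_of_type_algebra\<^esub> y = x + y"
  "\<one>\<^bsub>ring_of_type_algebra\<^esub> = (1 :: 'a)" "\<zero>\<^bsub>ring_of_type_algebra\<^esub> = (0 :: 'a)"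
  by (simp_all add: ring_of_type_algebra_def)

text \<open>Evaluation in a record ring as a homomorphism. The point must lie in the carrier at
  every indeterminate; points given on finitely many coordinates are extended by zero and compared
  through \<open>poly_eval_in_cong\<close>.\<close>

locale record_eval = cring R for R :: "'b ring" (structure) +
  fixes h :: "'a::comm_ring_1 \<Rightarrow> 'b" and b :: "'v \<Rightarrow> 'b"
  assumes h: "h \<in> ring_hom ring_of_type_algebra R" and b: "\<And>v. b v \<in> carrier R"
begin

lemma h_closed [simp]: "h c \<in> carrier R"
  and h_add: "h (x + y) = h x \<oplus> h y"
  and h_mult: "h (x * y) = h x \<otimes> h y"
  and h_1: "h 1 = \<one>"
  using ring_hom_closed[OF h] ring_hom_add[OF h] ring_hom_mult[OF h] ring_hom_one[OF h] by simp_all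

lemma h_0: "h 0 = \<zero>"
proof -
  have "h 0 \<oplus> h 0 = h 0 \<oplus> \<zero>" using h_add[of 0 0] by simp
  then show ?thesis by (rule add.l_cancel) simp_all
qed

definition mon_in :: "('v \<Rightarrow>\<^sub>0 nat) \<Rightarrow> 'b" where
  "mon_in t = finprod R (\<lambda>v. b v [^] lookup t v) (keys t)"

abbreviation E :: "('v, 'a) mpoly \<Rightarrow> 'b" where "E \<equiv> poly_eval_in R h b"

lemma mon_in_superset: "finite B \<Longrightarrow> keys t \<subseteq> B \<Longrightarrow> mon_in t = finprod R (\<lambda>v. b v [^] lookup t v) B"
  unfolding mon_in_def by (rule finprod_mono_neutral_cong_left) (auto simp: b in_keys_iff)

lemma mon_in_closed [simp]: "mon_in t \<in> carrier R"
  unfolding mon_in_def by (rule finprod_closed) (auto simp: b)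

lemma mon_in_add: "mon_in (s + t) = mon_in s \<otimes> mon_in t"
proof -
  let ?B = "keys s \<union> keys t"
  have "mon_in (s + t) = finprod R (\<lambda>v. b v [^] lookup (s + t) v) ?B"
    by (rule mon_in_superset) (use Poly_Mapping.keys_add[of s t] in auto)
  also have "\<dots> = finprod R (\<lambda>v. b v [^] lookup s v \<otimes> b v [^] lookup t v) ?B"
    by (simp add: lookup_add nat_pow_mult b)
  also have "\<dots> = finprod R (\<lambda>v. b v [^] lookup s v) ?B \<otimes> finprod R (\<lambda>v. b v [^] lookup t v) ?B"
    by (rule finprod_multf) (auto simp: b)
  also have "\<dots> = mon_in s \<otimes> mon_in t"
    by (simp add: mon_in_superset[of ?B s] mon_in_superset[of ?B t])
  finally show ?thesis .
qed

lemma E_superset: "finite B \<Longrightarrow> keys f \<subseteq> B \<Longrightarrow> E f = finsum R (\<lambda>t. h (lookup f t) \<otimes> mon_in t) B"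
  unfolding poly_eval_in_def mon_in_def[symmetric]
  by (rule add.finprod_mono_neutral_cong_left) (auto simp: in_keys_iff h_0)

lemma E_closed [simp]: "E f \<in> carrier R"
  by (subst E_superset[OF finite_keys order_refl]) (rule finsum_closed, simp)

lemma E_add: "E (f + g) = E f \<oplus> E g"
proof -
  let ?B = "keys f \<union> keys g"
  have "E (f + g) = finsum R (\<lambda>t. h (lookup (f + g) t) \<otimes> mon_in t) ?B"
    by (rule E_superset) (use Poly_Mapping.keys_add[of f g] in auto)
  also have "\<dots> = finsum R (\<lambda>t. h (lookup f t) \<otimes> mon_in t \<oplus> h (lookup g t) \<otimes> mon_in t) ?B"
    by (simp add: lookup_add h_add l_distr)
  also have "\<dots> = finsum R (\<lambda>t. h (lookup f t) \<otimes> mon_in t) ?B \<oplus> finsum R (\<lambda>t. h (lookup g t) \<otimes> mon_in t) ?B"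
    by (rule finsum_addf) auto
  also have "\<dots> = E f \<oplus> E g" by (simp add: E_superset[of ?B f] E_superset[of ?B g])
  finally show ?thesis .
qed

lemma E_0: "E 0 = \<zero>"
  by (simp add: poly_eval_in_def)

lemma E_single: "E (single t c) = h c \<otimes> mon_in t"
proof -
  have "E (single t c) = finsum R (\<lambda>s. h (lookup (single t c) s) \<otimes> mon_in s) {t}"
    by (rule E_superset) auto
  then show ?thesis by simp
qed

lemma E_mult: "E (f * g) = E f \<otimes> E g"
proof (induction f rule: mpoly_single_induct)
  case zero
  then show ?case by (simp add: E_0)
next
  case (add f f')
  then show ?case by (simp add: distrib_right E_add l_distr)
next
  case (single s c)
  show ?case
  proof (induction g rule: mpoly_single_induct)
    case zero
    then show ?case by (simp add: E_0)
  next
    case (add g g')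
    then show ?case by (simp add: distrib_left E_add r_distr)
  next
    case (single t c')
    show ?case by (simp add: mult_single E_single h_mult mon_in_add m_ac)
  qed
qed

lemma E_pconst: "E (pconst c) = h c"
  by (simp add: E_single mon_in_def)

lemma E_1: "E 1 = \<one>"
  using E_pconst[of 1] by (simp add: h_1)

lemma E_pvar: "E (pvar v) = b v"
proof -
  have "mon_in (single v 1) = finprod R (\<lambda>w. b w [^] lookup (single v (1 :: nat)) w) {v}"
    by (rule mon_in_superset) auto
  then have "mon_in (single v 1) = b v" using b by simp
  then show ?thesis by (simp add: pvar_def E_single h_1 b)
qed

lemma E_subst:
  assumes "record_eval R h b'" and s: "\<And>v. b v = poly_eval_in R h b' (s v)"
  shows "E f = poly_eval_in R h b' (poly_eval pconst s f)"
proof -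
  interpret E': record_eval R h b' by (rule assms)
  show ?thesis
  proof (induction f rule: mpoly_induct)
    case (const c)
    show ?case by (simp only: E_pconst E'.E_pconst poly_eval_pconst[OF rhom_pconst])
  next
    case (var v)
    show ?case by (simp only: E_pvar poly_eval_pvar[OF rhom_pconst] s[symmetric])
  next
    case (add f g)
    then show ?case by (simp only: E_add E'.E_add poly_eval_add[OF rhom_pconst])
  next
    case (mult f g)
    then show ?case by (simp only: E_mult E'.E_mult poly_eval_mult[OF rhom_pconst])
  qed
qed

text \<open>For a record whose operations are copied from a subring \<open>F\<close> of a type:
  \<open>\<phi>\<close> is assumed to be additive and multiplicative only on \<open>F\<close>, so
  the values of the evaluation have to be kept in \<open>F\<close> during the induction.\<close>

lemma E_transport:
  fixes \<phi> :: "'c::comm_ring_1 \<Rightarrow> 'b"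
  assumes F: "subr F" and \<phi>: "\<And>x y. x \<in> F \<Longrightarrow> y \<in> F \<Longrightarrow> \<phi> (x + y) = \<phi> x \<oplus> \<phi> y"
      "\<And>x y. x \<in> F \<Longrightarrow> y \<in> F \<Longrightarrow> \<phi> (x * y) = \<phi> x \<otimes> \<phi> y"
    and g: "rhom g" "\<And>c. g c \<in> F" "\<And>c. h c = \<phi> (g c)" and x: "\<And>v. x v \<in> F" "\<And>v. b v = \<phi> (x v)"
  shows "E f = \<phi> (poly_eval g x f) \<and> poly_eval g x f \<in> F"
proof (induction f rule: mpoly_induct)
  case (const c)
  show ?case by (simp only: E_pconst poly_eval_pconst[OF g(1)] g(3)[symmetric] g(2))
next
  case (var v)
  show ?case by (simp only: E_pvar poly_eval_pvar[OF g(1)] x(2)[symmetric] x(1))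
next
  case (add f f')
  then show ?case by (simp only: E_add poly_eval_add[OF g(1)] \<phi> subr_add[OF F])
next
  case (mult f f')
  then show ?case by (simp only: E_mult poly_eval_mult[OF g(1)] \<phi> subr_mult[OF F])
qed

end

lemma poly_eval_in_cong:
  assumes "cring R" and vars: "vars f \<subseteq> V" and eq: "\<And>v. v \<in> V \<Longrightarrow> b v = b' v"
    and b': "\<And>v. b' v \<in> carrier R" and h: "\<And>c. h c \<in> carrier R"
  shows "poly_eval_in R h b f = poly_eval_in R h b' f"
proof -
  interpret cring R by fact
  have 1: "finprod R (\<lambda>v. b v [^]\<^bsub>R\<^esub> lookup t v) (keys t) = finprod R (\<lambda>v. b' v [^]\<^bsub>R\<^esub> lookup t v) (keys t)"
    if "t \<in> keys f" for t
    by (rule finprod_cong') (use that vars eq b' in \<open>auto simp: vars_def\<close>)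
  show ?thesis
    unfolding poly_eval_in_def
    by (rule finsum_cong') (use 1 b' h in \<open>auto intro!: finprod_closed\<close>)
qed

text \<open>Rabinowitsch's trick.\<close>

lemma ec_field_avoid:
  fixes h :: "'a::field \<Rightarrow> 'b" and S :: "('v, 'a) mpoly set"
  assumes L: "Ring.field L" and h: "h \<in> ring_hom ring_of_type_algebra L" and ec: "ec_field_in L h"
    and V: "finite V" and S: "finite S" "\<And>f. f \<in> S \<Longrightarrow> vars f \<subseteq> V" and q: "vars q \<subseteq> V"
    and b: "\<And>v. b v \<in> carrier L" and root: "\<And>f. f \<in> S \<Longrightarrow> poly_eval_in L h b f = \<zero>\<^bsub>L\<^esub>"
    and qb: "poly_eval_in L h b q \<noteq> \<zero>\<^bsub>L\<^esub>"
  shows "\<exists>a. (\<forall>f\<in>S. poly_eval (\<lambda>c. c) a f = 0) \<and> poly_eval (\<lambda>c. c) a q \<noteq> 0"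
proof -
  interpret Ring.field L by (rule L)
  let ?N = "card V"
  obtain \<beta> :: "'v \<Rightarrow> nat" where \<beta>: "bij_betw \<beta> V {..<?N}"
    using ex_bij_betw_finite_nat[OF V] by (auto simp: atLeast0LessThan)
  have im: "\<beta> ` V = {..<?N}" and inj: "inj_on \<beta> V" using \<beta> by (auto simp: bij_betw_def)
  interpret E: record_eval L h b by unfold_locales (use h b in auto)
  have inv: "inv\<^bsub>L\<^esub> (E.E q) \<in> carrier L" "E.E q \<otimes>\<^bsub>L\<^esub> inv\<^bsub>L\<^esub> (E.E q) = \<one>\<^bsub>L\<^esub>"
    using qb field_Units Units_r_inv[of "E.E q"] Units_inv_closed[of "E.E q"] by auto
  \<comment> \<open>The additional coordinate \<open>?N\<close> carries the inverse of the value of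
    \<open>q\<close>, which solves the additional equation \<open>r\<close>.\<close>
  define b' where "b' i = (if i < ?N then b (inv_into V \<beta> i) else inv\<^bsub>L\<^esub> (E.E q))" for i
  have b': "b' i \<in> carrier L" for i by (simp add: b'_def b inv)
  interpret E': record_eval L h b' by unfold_locales (use h b' in auto)
  have b'\<beta>: "b' (\<beta> v) = b v" if "v \<in> V" for v
    using im inj that by (auto simp: b'_def)
  have ren: "E'.E (rename \<beta> f) = E.E f" if "vars f \<subseteq> V" for f
  proof -
    interpret E2: record_eval L h "\<lambda>v. b' (\<beta> v)" by unfold_locales (use h b' in auto)
    have "E2.E f = E'.E (rename \<beta> f)"
      unfolding rename_def by (rule E2.E_subst[OF E'.record_eval_axioms]) (simp only: E'.E_pvar)
    moreover have "E2.E f = E.E f"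
      by (rule poly_eval_in_cong[OF is_cring that]) (use b'\<beta> b in auto)
    ultimately show ?thesis by simp
  qed
  define r where "r = rename \<beta> q * pvar ?N - 1"
  have vr: "vars (rename \<beta> f) \<subseteq> {..<Suc ?N}" if "vars f \<subseteq> V" for f :: "('v, 'a) mpoly"
    using vars_rename[OF that, of \<beta>] im by auto
  have "vars r \<subseteq> {..<Suc ?N}"
    unfolding r_def using vars_diff[of "rename \<beta> q * pvar ?N" 1] vars_mult[of "rename \<beta> q" "pvar ?N"]
      vr[OF q] vars_pvar[of ?N, where 'a = 'a] by auto
  then have sub: "insert r (rename \<beta> ` S) \<subseteq> polys UNIV {..<Suc ?N}"
    using vr S(2) by (auto simp: polys_UNIV)
  have "E'.E (rename \<beta> q * pvar ?N) = \<one>\<^bsub>L\<^esub>"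
    using inv by (simp add: E'.E_mult E'.E_pvar ren[OF q]) (simp add: b'_def)
  moreover have "E'.E (rename \<beta> q * pvar ?N) = E'.E r \<oplus>\<^bsub>L\<^esub> \<one>\<^bsub>L\<^esub>"
    unfolding E'.E_1[symmetric] E'.E_add[symmetric] r_def by simp
  ultimately have "E'.E r \<oplus>\<^bsub>L\<^esub> \<one>\<^bsub>L\<^esub> = \<zero>\<^bsub>L\<^esub> \<oplus>\<^bsub>L\<^esub> \<one>\<^bsub>L\<^esub>" by simp
  then have "E'.E r = \<zero>\<^bsub>L\<^esub>" by (simp only: add.right_cancel[OF one_closed E'.E_closed zero_closed])
  then have z: "\<forall>f\<in>insert r (rename \<beta> ` S). E'.E f = \<zero>\<^bsub>L\<^esub>" using ren S(2) root by auto
  have "b' \<in> {..<Suc ?N} \<rightarrow> carrier L" using b' by auto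
  then have "\<exists>a. \<forall>f\<in>insert r (rename \<beta> ` S). poly_eval (\<lambda>c. c) a f = 0"
    using ec z sub S(1) unfolding ec_field_in_def by (metis finite_imageI finite_insert)
  then obtain a where a: "poly_eval (\<lambda>c. c) a r = 0" "\<And>f. f \<in> S \<Longrightarrow> poly_eval (\<lambda>c. c) a (rename \<beta> f) = 0" by blast
  note h = rhom_poly_eval[OF rhom_id, of a]
  have "poly_eval (\<lambda>c. c) a (rename \<beta> q) \<noteq> 0"
    using a(1) unfolding r_def rhom_diff[OF h] rhom_mult[OF h] rhom_1[OF h] by auto
  then show ?thesis using a(2) unfolding poly_eval_rename[OF rhom_id] by blast
qed


subsection \<open>Generic zeros\<close>

lemma rhom_ring_hom:
  "\<iota> \<in> ring_hom ring_of_type_algebra ring_of_type_algebra \<Longrightarrow> rhom \<iota>"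
  by (simp add: ring_hom_def rhom_def)

lemma prime_differential_ideal_iff:
  "prime_differential_ideal UNIV d n P \<longleftrightarrow>
    prime_in UNIV (inds n) P \<and> (\<forall>k. \<forall>f\<in>P. dpoly_deriv d k f \<in> P)"
  by (simp add: prime_differential_ideal_def primeideal_iff[OF subr_UNIV])

definition map_coeffs :: "('a \<Rightarrow> 'c) \<Rightarrow> ('v, 'a::comm_ring_1) mpoly \<Rightarrow> ('v, 'c::comm_ring_1) mpoly" where
  "map_coeffs h = poly_eval (\<lambda>c. pconst (h c)) pvar"

context
  fixes h :: "'a::comm_ring_1 \<Rightarrow> 'c::comm_ring_1"
  assumes h: "rhom h"
begin

lemma rhom_pconst_h: "rhom (\<lambda>c. pconst (h c) :: ('v, 'c) mpoly)"
  by (rule rhom_comp[OF rhom_pconst h])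

lemma rhom_map_coeffs: "rhom (map_coeffs h)"
  unfolding map_coeffs_def by (rule rhom_poly_eval[OF rhom_pconst_h])

lemma map_coeffs_pconst: "map_coeffs h (pconst c) = pconst (h c)"
  unfolding map_coeffs_def by (rule poly_eval_pconst[OF rhom_pconst_h])

lemma map_coeffs_pvar: "map_coeffs h (pvar v) = pvar v"
  unfolding map_coeffs_def by (rule poly_eval_pvar[OF rhom_pconst_h])

lemma lookup_map_coeffs: "lookup (map_coeffs h f) t = h (lookup f t)"
proof (induction f rule: mpoly_single_induct)
  case zero
  show ?case by (simp add: rhom_0[OF h] rhom_0[OF rhom_map_coeffs])
next
  case (add f g)
  then show ?case by (simp add: rhom_add[OF h] rhom_add[OF rhom_map_coeffs] lookup_add)
next
  case (single s c)
  have "map_coeffs h (single s c) = pconst (h c) * (\<Prod>v\<in>keys s. pvar v ^ lookup s v)"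
    unfolding map_coeffs_def poly_eval_single[OF rhom_pconst_h] mon_eval_def ..
  then have "map_coeffs h (single s c) = single s (h c)" by (simp only: single_eq_prod_pvar[of s])
  then show ?case by (simp add: lookup_single when_def rhom_0[OF h])
qed

lemma poly_eval_map_coeffs:
  assumes g: "rhom g"
  shows "poly_eval g b (map_coeffs h f) = poly_eval (\<lambda>c. g (h c)) b f"
  unfolding map_coeffs_def poly_eval_comp[OF rhom_pconst_h rhom_poly_eval[OF g]]
    poly_eval_pconst[OF g] poly_eval_pvar[OF g] ..

end

text \<open>Universality concerns ideals over differential subfields of the universal field. Taken
  over no additional elements it applies to the range of \<open>\<iota>\<close>, which is already a
  differential field; \<open>P\<close> is moved there and back by \<open>map_coeffs\<close>.\<close>

lemma generic_zero:
  fixes d :: "'m::{finite,linorder} \<Rightarrow> 'a::field_char_0 \<Rightarrow> 'a" and dU :: "'m \<Rightarrow> 'u::field_char_0 \<Rightarrow> 'u"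
  assumes d: "differential_field d" and U: "universal_extension d dU \<iota>"
    and P: "prime_in UNIV (inds n) P" "\<And>k f. f \<in> P \<Longrightarrow> dpoly_deriv d k f \<in> P"
  shows "\<exists>b. \<forall>f. vars f \<subseteq> inds n \<longrightarrow> (poly_eval \<iota> (jet dU b) f = 0 \<longleftrightarrow> f \<in> P)"
proof -
  have dU: "differential_field dU" and \<iota>hom: "\<iota> \<in> ring_hom ring_of_type_algebra ring_of_type_algebra"
    and \<iota>d: "\<And>k x. \<iota> (d k x) = dU k (\<iota> x)"
    using U unfolding universal_extension_def by blast+
  have \<iota>: "rhom \<iota>" by (rule rhom_ring_hom[OF \<iota>hom])
  have inj: "inj \<iota>" by (rule rhom_inj[OF \<iota>])
  let ?F = "Set.range \<iota>"
  have F: "subr ?F"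
    unfolding subr_def
  proof (intro conjI ballI)
    show "1 \<in> ?F" using rhom_1[OF \<iota>] by (metis rangeI)
    show "x + y \<in> ?F" "x * y \<in> ?F" if "x \<in> ?F" "y \<in> ?F" for x y
      using that rhom_add[OF \<iota>, symmetric] rhom_mult[OF \<iota>, symmetric] by auto
    show "- x \<in> ?F" if "x \<in> ?F" for x using that rhom_uminus[OF \<iota>, symmetric] by auto
  qed
  have "subfield ?F (ring_of_type_algebra :: 'u ring)"
  proof -
    interpret hom: ring_hom_ring ring_of_type_algebra ring_of_type_algebra \<iota>
      by (intro ring_hom_ringI2 ring_from_type_algebra \<iota>hom)
    interpret K: Ring.field "ring_of_type_algebra :: 'a ring" by (rule field_from_type_algebra)
    show ?thesis using hom.img_is_subfield(2)[OF K.carrier_is_subfield] by simp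
  qed
  moreover have "\<forall>k. \<forall>x\<in>?F. dU k x \<in> ?F" using \<iota>d[symmetric] by auto
  ultimately have "differential_subfield dU ?F" unfolding differential_subfield_def by blast
  then have gen: "diff_generated dU (?F \<union> {}) = ?F" unfolding diff_generated_def by auto
  let ?M = "map_coeffs \<iota> :: ('m, 'a) dpoly \<Rightarrow> _"
  have M: "rhom ?M" by (rule rhom_map_coeffs[OF \<iota>])
  note lM = lookup_map_coeffs[OF \<iota>]
  have injM: "f = g" if "?M f = ?M g" for f g
  proof (rule poly_mapping_eqI)
    fix t
    have "\<iota> (lookup f t) = \<iota> (lookup g t)" using that lM by metis
    then show "lookup f t = lookup g t" using inj by (simp add: inj_eq)
  qed
  have keysM: "keys (?M f) = keys f" for f
    by (auto simp: in_keys_iff lM rhom_field_eq_0_iff[OF \<iota>])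
  have varsM: "vars (?M f) = vars f" for f unfolding vars_def keysM ..
  have surjM: "\<exists>f. vars f \<subseteq> inds n \<and> g = ?M f" if g: "g \<in> polys ?F (inds n)" for g
  proof -
    define f where "f = Poly_Mapping.map (inv_into UNIV \<iota>) g"
    have "inv_into UNIV \<iota> 0 = 0" using inv_f_f[OF inj, of 0] rhom_0[OF \<iota>] by simp
    then have "lookup f t = inv_into UNIV \<iota> (lookup g t)" for t by (simp add: f_def map.rep_eq when_def)
    then have "?M f = g"
      using g by (intro poly_mapping_eqI) (auto simp: lM polys_def f_inv_into_f)
    then show ?thesis using varsM[of f] g by (auto simp: polys_def)
  qed
  have inM: "?M f \<in> polys ?F (inds n) \<longleftrightarrow> vars f \<subseteq> inds n" for f
    by (simp add: polys_def varsM lM)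
  have MP: "?M f \<in> ?M ` P \<longleftrightarrow> f \<in> P" for f using injM by blast
  have prime: "prime_in ?F (inds n) (?M ` P)"
    unfolding prime_in_def
  proof (intro conjI ballI impI)
    show "?M ` P \<subseteq> polys ?F (inds n)" using inM prime_in_vars[OF P(1)] by blast
    show "0 \<in> ?M ` P" using MP[of 0] rhom_0[OF M] prime_in_0[OF P(1)] by simp
    show "1 \<notin> ?M ` P" using MP[of 1] rhom_1[OF M] prime_in_1[OF P(1)] by simp
    show "f + g \<in> ?M ` P" if fg: "f \<in> ?M ` P" "g \<in> ?M ` P" for f g
    proof -
      obtain f' g' where "f' \<in> P" "g' \<in> P" "f = ?M f'" "g = ?M g'" using fg by blast
      then show ?thesis using MP[of "f' + g'"] prime_in_add[OF P(1)] by (simp add: rhom_add[OF M])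
    qed
    show "g * f \<in> ?M ` P" if fg: "f \<in> ?M ` P" "g \<in> polys ?F (inds n)" for f g
    proof -
      obtain f' g' where "f' \<in> P" "vars g' \<subseteq> inds n" "f = ?M f'" "g = ?M g'" using fg surjM by blast
      then show ?thesis using MP[of "g' * f'"] prime_in_mult'[OF P(1)] by (simp add: rhom_mult[OF M])
    qed
    show "f \<in> ?M ` P \<or> g \<in> ?M ` P"
      if fg: "f \<in> polys ?F (inds n)" "g \<in> polys ?F (inds n)" "f * g \<in> ?M ` P" for f g
    proof -
      obtain f' g' where fg': "vars f' \<subseteq> inds n" "vars g' \<subseteq> inds n" "f = ?M f'" "g = ?M g'"
        using fg surjM by metis
      then have "f' * g' \<in> P" using fg(3) MP[of "f' * g'"] by (simp add: rhom_mult[OF M])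
      then show ?thesis using prime_in_prime'[OF P(1) _ fg'(1,2)] fg'(3,4) by blast
    qed
  qed
  have "dpoly_deriv dU k (?M f) = ?M (dpoly_deriv d k f)" for k f
  proof (induction f rule: mpoly_induct)
    case (const c)
    show ?case by (simp only: map_coeffs_pconst[OF \<iota>] dpoly_deriv_pconst[OF dU] dpoly_deriv_pconst[OF d] \<iota>d)
  next
    case (var v)
    show ?case by (simp only: map_coeffs_pvar[OF \<iota>] dpoly_deriv_pvar[OF dU] dpoly_deriv_pvar[OF d])
  next
    case (add f g)
    then show ?case by (simp only: rhom_add[OF M] dpoly_deriv_add[OF dU] dpoly_deriv_add[OF d])
  next
    case (mult f g)
    then show ?case
      by (simp only: rhom_add[OF M] rhom_mult[OF M] dpoly_deriv_mult[OF dU] dpoly_deriv_mult[OF d])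
  qed
  then have "prime_differential_ideal ?F dU n (?M ` P)"
    unfolding prime_differential_ideal_def primeideal_iff[OF F] using prime P(2) by auto
  then obtain b where b: "\<And>f. f \<in> polys ?F (inds n) \<Longrightarrow> poly_eval (\<lambda>c. c) (jet dU b) f = 0 \<longleftrightarrow> f \<in> ?M ` P"
    using U gen unfolding universal_extension_def by (metis finite.emptyI)
  have "poly_eval \<iota> (jet dU b) f = 0 \<longleftrightarrow> f \<in> P" if "vars f \<subseteq> inds n" for f
    using b[of "?M f"] inM MP that poly_eval_map_coeffs[OF \<iota> rhom_id] by metis
  then show ?thesis by blast
qed

subsection \<open>The axiom scheme implies differential largeness\<close>

lemma poly_eval_hom:
  assumes "rhom h"
  shows "poly_eval h (\<lambda>v. h (a v)) f = h (poly_eval (\<lambda>c. c) a f)"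
  by (rule poly_eval_comp[OF rhom_id assms, symmetric])

lemma poly_eval_restrict:
  "vars f \<subseteq> V \<Longrightarrow> poly_eval h (restrict b V) f = poly_eval h b f"
  by (rule poly_eval_cong) auto

lemma poly_eval_jet_restrict:
  fixes d :: "'m::{finite,linorder} \<Rightarrow> 'a::field_char_0 \<Rightarrow> 'a" and dU :: "'m \<Rightarrow> 'u::field_char_0 \<Rightarrow> 'u"
  assumes h: "rhom h" "\<And>k c. h (d k c) = dU k (h c)" and f: "vars f \<subseteq> inds n"
  shows "poly_eval h (jet dU (restrict (\<lambda>i. h (a i)) {..<n})) f = h (poly_eval (\<lambda>c. c) (jet d a) f)"
proof -
  have "h (iter_deriv d \<xi> x) = iter_deriv dU \<xi> (h x)" for \<xi> x
    by (rule iter_deriv_hom[of UNIV]) (simp_all add: h(2))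
  then have "jet dU (restrict (\<lambda>i. h (a i)) {..<n}) v = h (jet d a v)" if "v \<in> inds n" for v
    using that by (auto simp: jet_def inds_def)
  then have "poly_eval h (jet dU (restrict (\<lambda>i. h (a i)) {..<n})) f = poly_eval h (\<lambda>v. h (jet d a v)) f"
    by (intro poly_eval_cong) (use f in blast)
  then show ?thesis by (simp only: poly_eval_hom[OF h(1)])
qed

lemma universal_extensionD:
  assumes "universal_extension d dU \<iota>"
  shows "differential_field dU" "rhom \<iota>" "\<iota> (d k x) = dU k (\<iota> x)"
  using assms rhom_ring_hom unfolding universal_extension_def by blast+

context prime_char_set
begin

text \<open>One inclusion is \<open>zero_of_theta\<close>. For the other, the jet of a generic zero
  of \<open>P\<close>, truncated at order \<open>r\<close>, lies in the locally closed set because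
  \<open>H_prod \<Lambda>\<close> is outside \<open>P\<close>; a polynomial of order at most
  \<open>r\<close> vanishing there is in \<open>P\<close>.\<close>

lemma vanishing_ideal_eq:
  fixes dU :: "'m \<Rightarrow> 'u::field_char_0 \<Rightarrow> 'u"
  assumes U: "universal_extension d dU \<iota>" and \<Lambda>r: "\<Lambda> \<subseteq> polys UNIV (inds_upto n r)"
  shows "vanishing_ideal \<iota> (inds_upto n r) (alg_zeros \<iota> (inds_upto n r) (prolongation d n r \<Lambda>)
      - alg_zeros \<iota> (inds_upto n r) {H_prod \<Lambda>}) = P \<inter> polys UNIV (inds_upto n r)" (is "vanishing_ideal \<iota> ?V ?Z = _")
proof (intro equalityI subsetI)
  note \<iota> = universal_extensionD(2)[OF U]
  have Hn: "vars (H_prod \<Lambda>) \<subseteq> ?V" by (rule vars_H_prod) (use \<Lambda>r polys_UNIV[of _ ?V] in blast)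
  fix f
  {
    assume f: "f \<in> P \<inter> polys UNIV ?V"
    then have vf: "vars f \<subseteq> ?V" by (simp add: polys_UNIV)
    have "poly_eval \<iota> b f = 0" if b: "b \<in> ?Z" for b
    proof (rule zero_of_theta[OF \<iota> _ _ _ vf])
      show "poly_eval \<iota> b (H_prod \<Lambda>) \<noteq> 0" using b by (auto simp: alg_zeros_def)
      show "poly_eval \<iota> b (theta v) = 0" if "principal v" "v \<in> ?V" for v
        using b theta_in_prolongation[OF that] by (auto simp: alg_zeros_def)
    qed (use f in blast)
    then show "f \<in> vanishing_ideal \<iota> ?V ?Z" using f by (auto simp: vanishing_ideal_def)
  next
    assume f: "f \<in> vanishing_ideal \<iota> ?V ?Z"
    then have vf: "vars f \<subseteq> ?V" by (simp add: vanishing_ideal_def polys_UNIV)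
    obtain b where b: "\<And>f. vars f \<subseteq> inds n \<Longrightarrow> poly_eval \<iota> (jet dU b) f = 0 \<longleftrightarrow> f \<in> P"
      using generic_zero[OF d U P deriv_P] by blast
    let ?b = "restrict (jet dU b) ?V"
    have bV: "poly_eval \<iota> ?b g = 0 \<longleftrightarrow> g \<in> P" if "vars g \<subseteq> ?V" for g
      using b[of g] that inds_upto_subset_inds[of n r] poly_eval_restrict[OF that, of \<iota> "jet dU b"] by auto
    have "poly_eval \<iota> ?b g = 0" if "g \<in> prolongation d n r \<Lambda>" for g
      using bV[of g] prolongation_subset[of r] that polys_UNIV[of g ?V] by blast
    moreover have "poly_eval \<iota> ?b (H_prod \<Lambda>) \<noteq> 0" using bV[OF Hn] H_prod_notin[OF P \<Lambda>] by blast
    ultimately have "?b \<in> ?Z" by (auto simp: alg_zeros_def)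
    then have "poly_eval \<iota> ?b f = 0" using f by (simp add: vanishing_ideal_def)
    then show "f \<in> P \<inter> polys UNIV ?V" using bV[OF vf] vf by (simp add: polys_UNIV)
  }
qed

lemma ex_order_bound: "\<exists>r. \<Lambda> \<subseteq> polys UNIV (inds_upto n r)"
proof -
  have "finite (\<Union>f\<in>\<Lambda>. vars f)" using finite_autoreduced[OF autoreduced] by simp
  moreover have "(\<Union>f\<in>\<Lambda>. vars f) \<subseteq> inds n" using autoreduced_vars[OF autoreduced] by blast
  ultimately obtain r where "(\<Union>f\<in>\<Lambda>. vars f) \<subseteq> inds_upto n r" using ex_inds_upto by blast
  then show ?thesis using polys_UNIV[of _ "inds_upto n r"] by blast
qed

lemma smooth_rational_pointI:
  fixes dU :: "'m \<Rightarrow> 'u::field_char_0 \<Rightarrow> 'u"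
  assumes U: "universal_extension d dU \<iota>" and \<Lambda>r: "\<Lambda> \<subseteq> polys UNIV (inds_upto n r)"
    and H: "poly_eval (\<lambda>c. c) a (H_prod \<Lambda>) \<noteq> 0"
    and zero: "\<And>v. principal v \<Longrightarrow> v \<in> inds_upto n r \<Longrightarrow> poly_eval (\<lambda>c. c) a (theta v) = 0"
  shows "smooth_rational_point \<iota> (inds_upto n r) (alg_zeros \<iota> (inds_upto n r) (prolongation d n r \<Lambda>)
      - alg_zeros \<iota> (inds_upto n r) {H_prod \<Lambda>}) a"
proof -
  let ?V = "inds_upto n r"
  note \<iota> = universal_extensionD(2)[OF U]
  have Hn: "vars (H_prod \<Lambda>) \<subseteq> ?V" by (rule vars_H_prod) (use \<Lambda>r polys_UNIV[of _ ?V] in blast)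
  let ?b = "restrict (\<lambda>v. \<iota> (a v)) ?V"
  have b: "poly_eval \<iota> ?b f = \<iota> (poly_eval (\<lambda>c. c) a f)" if "vars f \<subseteq> ?V" for f
    unfolding poly_eval_restrict[OF that] by (rule poly_eval_hom[OF \<iota>])
  have "poly_eval \<iota> ?b f = 0" if "f \<in> prolongation d n r \<Lambda>" for f
  proof -
    have f: "f \<in> P" "vars f \<subseteq> ?V" using that prolongation_subset[of r] polys_UNIV[of f ?V] by auto
    then show ?thesis using b[OF f(2)] zero_of_theta[OF rhom_id H zero f] rhom_0[OF \<iota>] by simp
  qed
  moreover have "poly_eval \<iota> ?b (H_prod \<Lambda>) \<noteq> 0"
    unfolding b[OF Hn] rhom_field_eq_0_iff[OF \<iota>] by (rule H)
  ultimately have "?b \<in> alg_zeros \<iota> ?V (prolongation d n r \<Lambda>) - alg_zeros \<iota> ?V {H_prod \<Lambda>}"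
    by (auto simp: alg_zeros_def)
  then show ?thesis
    unfolding smooth_rational_point_def vanishing_ideal_eq[OF U \<Lambda>r] using smooth_at_P[OF H zero] by blast
qed

end

lemma diff_zerosD:
  fixes d :: "'m::{finite,linorder} \<Rightarrow> 'a::field_char_0 \<Rightarrow> 'a" and dU :: "'m \<Rightarrow> 'u::field_char_0 \<Rightarrow> 'u"
  assumes h: "rhom h" "\<And>k c. h (d k c) = dU k (h c)"
    and S: "\<And>f. f \<in> S \<Longrightarrow> vars f \<subseteq> inds n"
  shows "restrict (\<lambda>i. h (a i)) {..<n} \<in> diff_zeros dU h n S \<longleftrightarrow> (\<forall>f\<in>S. poly_eval (\<lambda>c. c) (jet d a) f = 0)"
proof -
  have "poly_eval h (jet dU (restrict (\<lambda>i. h (a i)) {..<n})) f = 0 \<longleftrightarrow> poly_eval (\<lambda>c. c) (jet d a) f = 0"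
    if "f \<in> S" for f
    unfolding poly_eval_jet_restrict[where d = d and dU = dU and h = h, OF h S[OF that]]
    by (rule rhom_field_eq_0_iff[OF h(1)])
  then show ?thesis by (auto simp: diff_zeros_def)
qed

lemma differential_extensionD:
  assumes "differential_extension d L D h"
  shows "Ring.field L" "x \<in> carrier L \<Longrightarrow> D k x \<in> carrier L"
    "x \<in> carrier L \<Longrightarrow> y \<in> carrier L \<Longrightarrow> D k (x \<oplus>\<^bsub>L\<^esub> y) = D k x \<oplus>\<^bsub>L\<^esub> D k y"
    "x \<in> carrier L \<Longrightarrow> y \<in> carrier L \<Longrightarrow>
      D k (x \<otimes>\<^bsub>L\<^esub> y) = (D k x \<otimes>\<^bsub>L\<^esub> y) \<oplus>\<^bsub>L\<^esub> (x \<otimes>\<^bsub>L\<^esub> D k y)"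
    "x \<in> carrier L \<Longrightarrow> D k (D l x) = D l (D k x)"
    "h \<in> ring_hom ring_of_type_algebra L" "h (d k c) = D k (h c)"
  using assms unfolding differential_extension_def by blast+

lemma UC_imp_ec_differential:
  fixes d :: "'m::{finite,linorder} \<Rightarrow> 'a::field_char_0 \<Rightarrow> 'a" and dU :: "'m \<Rightarrow> 'u::field_char_0 \<Rightarrow> 'u"
    and L :: "'b ring"
  assumes d: "differential_field d" and U: "universal_extension d dU \<iota>" and UC: "UC d dU \<iota>"
    and ext: "differential_extension d L D h" and ec: "ec_field_in L h"
  shows "ec_differential_in d L D h"
  unfolding ec_differential_in_def
proof (intro allI impI)
  fix n :: nat and S :: "('m, 'a) dpoly set"
  assume S: "finite S" "S \<subseteq> polys UNIV (inds n)"
    and "\<exists>b\<in>{..<n} \<rightarrow> carrier L. \<forall>f\<in>S. poly_eval_in L h (jet D b) f = \<zero>\<^bsub>L\<^esub>"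
  then obtain b0 where b0: "b0 \<in> {..<n} \<rightarrow> carrier L" "\<And>f. f \<in> S \<Longrightarrow> poly_eval_in L h (jet D b0) f = \<zero>\<^bsub>L\<^esub>" by blast
  interpret Ring.field L by (rule differential_extensionD(1)[OF ext])
  note D = differential_extensionD(2-7)[OF ext]
  note \<iota> = universal_extensionD(2,3)[OF U]
  define b where "b i = (if i < n then b0 i else \<zero>\<^bsub>L\<^esub>)" for i
  have b: "b i \<in> carrier L" for i using b0(1) by (auto simp: b_def)
  have jb: "jet D b v \<in> carrier L" for v
    unfolding jet_def case_prod_unfold by (rule iter_deriv_closed) (use D(1) b in auto)
  interpret E: record_eval L h "jet D b" by unfold_locales (use D(5) jb in auto)
  have S0: "E.E f = \<zero>\<^bsub>L\<^esub>" if "f \<in> S" for f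
  proof -
    have "vars f \<subseteq> inds n" using S(2) that polys_UNIV[of f "inds n"] by blast
    moreover have "jet D b0 v = jet D b v" if "v \<in> inds n" for v
      using that by (auto simp: jet_def b_def inds_def)
    ultimately have "poly_eval_in L h (jet D b0) f = E.E f"
      by (intro poly_eval_in_cong[OF is_cring, of f "inds n"]) (simp_all add: jb)
    then show ?thesis using b0(2)[OF that] by simp
  qed
  have der: "E.E (dpoly_deriv d k f) = D k (E.E f)" for k f
  proof (induction f rule: mpoly_induct)
    case (const c)
    show ?case by (simp only: dpoly_deriv_pconst[OF d] E.E_pconst D(6))
  next
    case (var v)
    have "jet D b (ind_deriv k v) = D k (jet D b v)"
      by (rule jet_ind_deriv[of "carrier L"]) (use D(1,4) b in auto)
    then show ?case by (simp only: dpoly_deriv_pvar[OF d] E.E_pvar)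
  next
    case (add f g)
    then show ?case by (simp only: dpoly_deriv_add[OF d] E.E_add D(2)[OF E.E_closed E.E_closed])
  next
    case (mult f g)
    then show ?case by (simp only: dpoly_deriv_mult[OF d] E.E_add E.E_mult D(3)[OF E.E_closed E.E_closed])
  qed
  have D0: "D k \<zero>\<^bsub>L\<^esub> = \<zero>\<^bsub>L\<^esub>" for k
    using der[of k 0] by (simp add: E.E_0 dpoly_deriv_0[OF d])
  define P where "P = {f \<in> polys UNIV (inds n). E.E f = \<zero>\<^bsub>L\<^esub>}"
  have P: "prime_in UNIV (inds n) P"
  proof -
    note s = subr_polys[OF subr_UNIV, of "inds n"]
    show ?thesis
      unfolding prime_in_def P_def
      using subr_0[OF s] subr_add[OF s] subr_mult[OF s] integral
      by (auto simp: E.E_0 E.E_1 E.E_add E.E_mult)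
  qed
  have dP: "dpoly_deriv d k f \<in> P" if "f \<in> P" for k f
  proof -
    have "vars (dpoly_deriv d k f) \<subseteq> inds n"
      using vars_dpoly_deriv[OF d, of k f] prime_in_vars[OF P that] ind_deriv_inds[of k n]
        image_mono[of "vars f" "inds n" "ind_deriv k"] by blast
    then show ?thesis using that by (simp add: P_def polys_UNIV der D0)
  qed
  have "P \<subseteq> polys UNIV (inds n)" by (auto simp: P_def)
  then obtain \<Lambda> where \<Lambda>: "characteristic_set n P \<Lambda>" using ex_characteristic_set by blast
  interpret prime_char_set d n P \<Lambda> by unfold_locales (use d P dP \<Lambda> in auto)
  obtain r where r: "\<Lambda> \<subseteq> polys UNIV (inds_upto n r)" using ex_order_bound by blast
  let ?V = "inds_upto n r" and ?S = "theta ` {v \<in> inds_upto n r. principal v}"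
  have v\<Lambda>: "vars f \<subseteq> ?V" if "f \<in> \<Lambda>" for f using r that polys_UNIV[of f ?V] by blast
  have Hn: "vars (H_prod \<Lambda>) \<subseteq> ?V" by (rule vars_H_prod) (rule v\<Lambda>)
  \<comment> \<open>In \<open>L\<close> the jet of the solution satisfies all equations
    \<open>theta v\<close>, and \<open>H_prod \<Lambda>\<close> is nonzero at it because it is not
    in \<open>P\<close>. Up to order \<open>r\<close> these are finitely many algebraic
    conditions.\<close>
  have "\<exists>a. (\<forall>f\<in>?S. poly_eval (\<lambda>c. c) a f = 0) \<and> poly_eval (\<lambda>c. c) a (H_prod \<Lambda>) \<noteq> 0"
  proof (rule ec_field_avoid[OF differential_extensionD(1)[OF ext] D(5) ec finite_inds_upto])
    show "finite ?S" by simp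
    show "vars f \<subseteq> ?V" if "f \<in> ?S" for f using that vars_theta_inds_upto by blast
    show "vars (H_prod \<Lambda>) \<subseteq> ?V" by (rule Hn)
    show "jet D b v \<in> carrier L" for v by (rule jb)
    show "E.E f = \<zero>\<^bsub>L\<^esub>" if "f \<in> ?S" for f using that theta_in_P by (auto simp: P_def)
    show "E.E (H_prod \<Lambda>) \<noteq> \<zero>\<^bsub>L\<^esub>"
      using H_prod_notin[OF P \<Lambda>] Hn inds_upto_subset_inds[of n r] by (auto simp: P_def polys_UNIV)
  qed
  then obtain a where a: "\<And>v. principal v \<Longrightarrow> v \<in> ?V \<Longrightarrow> poly_eval (\<lambda>c. c) a (theta v) = 0"
    "poly_eval (\<lambda>c. c) a (H_prod \<Lambda>) \<noteq> 0" by blast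
  have "prime_differential_ideal UNIV d n P" unfolding prime_differential_ideal_iff using P dP by blast
  then have "\<exists>a. restrict (\<lambda>i. \<iota> (a i)) {..<n} \<in> diff_zeros dU \<iota> n \<Lambda> - diff_zeros dU \<iota> n {H_prod \<Lambda>}"
    using UC \<Lambda> r smooth_rational_pointI[OF U r a(2,1)] unfolding UC_def by blast
  then obtain c where c: "restrict (\<lambda>i. \<iota> (c i)) {..<n} \<in> diff_zeros dU \<iota> n \<Lambda>"
    "restrict (\<lambda>i. \<iota> (c i)) {..<n} \<notin> diff_zeros dU \<iota> n {H_prod \<Lambda>}" by blast
  have "vars (H_prod \<Lambda>) \<subseteq> inds n" using Hn inds_upto_subset_inds[of n r] by blast
  then have "restrict (\<lambda>i. \<iota> (c i)) {..<n} \<in> diff_zeros dU \<iota> n {H_prod \<Lambda>} \<longleftrightarrow>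
      (\<forall>f\<in>{H_prod \<Lambda>}. poly_eval (\<lambda>c. c) (jet d c) f = 0)"
    by (intro diff_zerosD[where h = \<iota> and d = d and dU = dU, OF \<iota>(1)] \<iota>(2)) simp
  then have "poly_eval (\<lambda>c. c) (jet d c) (H_prod \<Lambda>) \<noteq> 0" using c(2) by simp
  moreover have "restrict (\<lambda>i. \<iota> (c i)) {..<n} \<in> diff_zeros dU \<iota> n \<Lambda> \<longleftrightarrow>
      (\<forall>f\<in>\<Lambda>. poly_eval (\<lambda>c. c) (jet d c) f = 0)"
    by (rule diff_zerosD[where h = \<iota> and d = d and dU = dU, OF \<iota>(1)])
       (rule \<iota>(2), rule autoreduced_vars[OF autoreduced])
  then have "poly_eval (\<lambda>c. c) (jet d c) f = 0" if "f \<in> \<Lambda>" for f using c(1) that by blast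
  ultimately have "poly_eval (\<lambda>c. c) (jet d c) f = 0" if "f \<in> P" for f
    by (intro zero_of_char_set[OF d rhom_id _ _ _ that]) auto
  moreover have "S \<subseteq> P" using S S0 by (auto simp: P_def)
  ultimately show "\<exists>a. \<forall>f\<in>S. poly_eval (\<lambda>c. c) (jet d a) f = 0" by blast
qed


subsection \<open>Injections into an infinite type\<close>

lemma inj_pair:
  assumes "infinite (UNIV :: 'a set)"
  shows "\<exists>\<pi> :: 'a \<times> 'a \<Rightarrow> 'a. inj \<pi>"
proof -
  have "\<exists>\<pi>. bij_betw \<pi> ((UNIV :: 'a set) \<times> (UNIV :: 'a set)) (UNIV :: 'a set)"
    using card_of_Times_same_infinite[OF assms] card_of_ordIso by blast
  then show ?thesis by (auto simp: bij_betw_def)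
qed

text \<open>The length is coded separately, so iterated pairing has to separate only lists of equal
  length.\<close>

lemma inj_list:
  assumes "infinite (UNIV :: 'a set)"
  shows "\<exists>c :: 'a list \<Rightarrow> 'a. inj c"
proof -
  obtain \<pi> :: "'a \<times> 'a \<Rightarrow> 'a" where \<pi>: "inj \<pi>" using inj_pair[OF assms] by blast
  obtain \<nu> :: "nat \<Rightarrow> 'a" where \<nu>: "inj \<nu>" using infinite_countable_subset[OF assms] by blast
  define g where "g xs = foldr (\<lambda>x y. \<pi> (x, y)) xs (\<nu> 0)" for xs
  have "xs = ys" if "length xs = length ys" "g xs = g ys" for xs ys
    using that by (induction xs ys rule: list_induct2) (auto simp: g_def inj_eq[OF \<pi>])
  then have "inj (\<lambda>xs. \<pi> (\<nu> (length xs), g xs))"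
    by (intro injI) (simp add: inj_eq[OF \<pi>] inj_eq[OF \<nu>])
  then show ?thesis by blast
qed

text \<open>A finitely supported function is determined by the pairs of keys and values on its
  support, and these are listed in some arbitrary order.\<close>

lemma inj_poly_mapping:
  fixes i :: "'k \<Rightarrow> 'a" and j :: "'z::zero \<Rightarrow> 'a"
  assumes inf: "infinite (UNIV :: 'a set)" and i: "inj i" and j: "inj j"
  shows "\<exists>c :: ('k \<Rightarrow>\<^sub>0 'z) \<Rightarrow> 'a. inj c"
proof -
  obtain \<pi> :: "'a \<times> 'a \<Rightarrow> 'a" where \<pi>: "inj \<pi>" using inj_pair[OF inf] by blast
  obtain c :: "'a list \<Rightarrow> 'a" where c: "inj c" using inj_list[OF inf] by blast
  define l where "l f = (SOME xs. set xs = (\<lambda>k. \<pi> (i k, j (lookup f k))) ` keys f)" for f :: "'k \<Rightarrow>\<^sub>0 'z"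
  have l: "set (l f) = (\<lambda>k. \<pi> (i k, j (lookup f k))) ` keys f" for f
    unfolding l_def by (rule someI_ex) (rule finite_list, simp)
  have sub: "lookup f k = lookup g k" if eq: "l f = l g" and k: "k \<in> keys f" for f g k
  proof -
    have "\<pi> (i k, j (lookup f k)) \<in> set (l g)" using k eq[symmetric] l[of f] by auto
    then obtain k' where "\<pi> (i k, j (lookup f k)) = \<pi> (i k', j (lookup g k'))" using l[of g] by auto
    then have "i k = i k'" "j (lookup f k) = j (lookup g k')" by (simp_all add: inj_eq[OF \<pi>])
    then show ?thesis by (simp add: inj_eq[OF i] inj_eq[OF j])
  qed
  have "f = g" if "l f = l g" for f g
  proof (rule poly_mapping_eqI)
    fix k
    show "lookup f k = lookup g k"
    proof (cases "k \<in> keys f")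
      case True
      then show ?thesis by (rule sub[OF that])
    next
      case f: False
      show ?thesis
      proof (cases "k \<in> keys g")
        case True
        then show ?thesis by (rule sub[OF that[symmetric], symmetric])
      next
        case False
        then show ?thesis using f by (simp add: in_keys_iff)
      qed
    qed
  qed
  then have "inj (\<lambda>f. c (l f))" by (intro injI) (simp add: inj_eq[OF c])
  then show ?thesis by blast
qed

text \<open>The coding is applied to multi-indices, then to monomials, then to polynomials. It
  bounds the size of the field generated by a generic zero.\<close>

lemma inj_dpoly:
  assumes inf: "infinite (UNIV :: 'a::zero set)"
  shows "\<exists>c :: ('m::finite, 'a) dpoly \<Rightarrow> 'a. inj c"
proof -
  obtain \<pi> :: "'a \<times> 'a \<Rightarrow> 'a" where \<pi>: "inj \<pi>" using inj_pair[OF inf] by blast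
  obtain \<nu> :: "nat \<Rightarrow> 'a" where \<nu>: "inj \<nu>" using infinite_countable_subset[OF inf] by blast
  obtain \<mu> :: "'m \<Rightarrow> nat" where \<mu>: "inj \<mu>" using finite_imp_inj_to_nat_seg[of "UNIV :: 'm set"] by auto
  have "inj (\<lambda>k. \<nu> (\<mu> k))" by (intro injI) (simp add: inj_eq[OF \<nu>] inj_eq[OF \<mu>])
  from inj_poly_mapping[OF inf this \<nu>] obtain c1 :: "('m \<Rightarrow>\<^sub>0 nat) \<Rightarrow> 'a" where c1: "inj c1" by blast
  have "inj (\<lambda>v :: 'm ind. \<pi> (\<nu> (fst v), c1 (snd v)))" 
    by (intro injI) (simp add: inj_eq[OF \<pi>] inj_eq[OF \<nu>] inj_eq[OF c1] prod_eq_iff)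
  from inj_poly_mapping[OF inf this \<nu>] obtain c2 :: "('m ind \<Rightarrow>\<^sub>0 nat) \<Rightarrow> 'a" where c2: "inj c2" by blast
  show ?thesis by (rule inj_poly_mapping[OF inf c2]) (rule inj_on_id2)
qed


subsection \<open>Transport of a subfield along an injection\<close>

text \<open>Copies a subfield of the universal field into the type over which
  \<open>differentially_large\<close> quantifies; that type carries no operations of its
  own.\<close>

definition transport_ring :: "'u::field set \<Rightarrow> ('u \<Rightarrow> 'b) \<Rightarrow> 'b ring" where
  "transport_ring F e = \<lparr>carrier = e ` F,
     monoid.mult = (\<lambda>x y. e (inv_into F e x * inv_into F e y)), one = e 1, ring.zero = e 0,
     add = (\<lambda>x y. e (inv_into F e x + inv_into F e y))\<rparr>"

lemma field_transport_ring:
  assumes F: "subr F" "\<And>x. x \<in> F \<Longrightarrow> inverse x \<in> F" and e: "inj_on e F"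
  shows "Ring.field (transport_ring F e)"
proof -
  let ?L = "transport_ring F e"
  have g: "inv_into F e (e x) = x" if "x \<in> F" for x using e that by simp
  note cl = subr_0[OF F(1)] subr_1[OF F(1)] subr_add[OF F(1)] subr_mult[OF F(1)]
  interpret cring ?L
  proof (intro cringI abelian_groupI comm_monoidI)
    fix x assume "x \<in> carrier ?L"
    then obtain u where u: "u \<in> F" "x = e u" by (auto simp: transport_ring_def)
    then show "\<exists>y\<in>carrier ?L. y \<oplus>\<^bsub>?L\<^esub> x = \<zero>\<^bsub>?L\<^esub>"
      using subr_uminus[OF F(1) u(1)] by (intro bexI[of _ "e (- u)"]) (auto simp: transport_ring_def g)
  qed (auto simp: transport_ring_def g cl algebra_simps)
  show ?thesis
  proof (rule cring_fieldI2)
    have "e 0 \<noteq> e 1" using inj_on_eq_iff[OF e cl(1,2)] by simp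
    then show "\<zero>\<^bsub>?L\<^esub> \<noteq> \<one>\<^bsub>?L\<^esub>" by (simp add: transport_ring_def)
    fix x assume x: "x \<in> carrier ?L" "x \<noteq> \<zero>\<^bsub>?L\<^esub>"
    then obtain u where u: "u \<in> F" "x = e u" "u \<noteq> 0" by (auto simp: transport_ring_def)
    then show "\<exists>y\<in>carrier ?L. x \<otimes>\<^bsub>?L\<^esub> y = \<one>\<^bsub>?L\<^esub>"
      using F(2)[OF u(1)] by (intro bexI[of _ "e (inverse u)"]) (auto simp: transport_ring_def g)
  qed
qed


subsection \<open>Differential largeness implies the axiom scheme\<close>

text \<open>One and the same \<open>G\<close> serves all points of the base field and the point
  \<open>b\<close> in the larger field. An equation satisfied by fractions at a generic zero can
  thus be passed on to rational points.\<close>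

lemma clear_denominators:
  fixes Q :: "('w, 'a::field) mpoly" and h :: "'a \<Rightarrow> 'c::field" and f :: "('v, 'a) mpoly"
  assumes h: "rhom h" and f: "vars f \<subseteq> V" and p: "\<And>i. i \<in> V \<Longrightarrow> vars (p i) \<subseteq> W" and Q: "vars Q \<subseteq> W"
  shows "\<exists>N G. vars G \<subseteq> W \<and>
    (\<forall>a. poly_eval (\<lambda>c. c) a Q \<noteq> 0 \<longrightarrow> poly_eval (\<lambda>c. c) a G =
      poly_eval (\<lambda>c. c) a Q ^ N * poly_eval (\<lambda>c. c) (\<lambda>i. poly_eval (\<lambda>c. c) a (p i) / poly_eval (\<lambda>c. c) a Q) f) \<and>
    (poly_eval h b Q \<noteq> 0 \<longrightarrow> poly_eval h b G =
      poly_eval h b Q ^ N * poly_eval h (\<lambda>i. poly_eval h b (p i) / poly_eval h b Q) f)"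
proof -
  define E where "E = (\<lambda>a. poly_eval (\<lambda>c :: 'a. c) (a :: 'w \<Rightarrow> 'a))"
  define E' where "E' = poly_eval h b"
  have E: "rhom (E a)" "E a (pconst c) = c" for a c
    unfolding E_def by (rule rhom_poly_eval[OF rhom_id], rule poly_eval_pconst[OF rhom_id])
  have E': "rhom E'" "E' (pconst c) = h c" for c
    unfolding E'_def by (rule rhom_poly_eval[OF h], rule poly_eval_pconst[OF h])
  define Fa where "Fa = (\<lambda>a. poly_eval (\<lambda>c. c) (\<lambda>i. E a (p i) / E a Q))"
  define F' where "F' = poly_eval h (\<lambda>i. E' (p i) / E' Q)"
  have Fa: "rhom (Fa a)" "Fa a (pconst c) = c" "Fa a (pvar i) = E a (p i) / E a Q" for a c i
    unfolding Fa_def by (rule rhom_poly_eval[OF rhom_id], rule poly_eval_pconst[OF rhom_id],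
      rule poly_eval_pvar[OF rhom_id])
  have F': "rhom F'" "F' (pconst c) = h c" "F' (pvar i) = E' (p i) / E' Q" for c i
    unfolding F'_def by (rule rhom_poly_eval[OF h], rule poly_eval_pconst[OF h], rule poly_eval_pvar[OF h])
  have "\<exists>N G. vars G \<subseteq> W \<and> (\<forall>a. E a Q \<noteq> 0 \<longrightarrow> E a G = E a Q ^ N * Fa a f) \<and>
    (E' Q \<noteq> 0 \<longrightarrow> E' G = E' Q ^ N * F' f)"
    using f
  proof (induction rule: polys_induct)
    case (const c)
    show ?case by (rule exI[of _ 0], rule exI[of _ "pconst c"]) (simp add: E E' Fa F')
  next
    case (var i)
    show ?case by (rule exI[of _ 1], rule exI[of _ "p i"]) (simp add: Fa F' p[OF var])
  next
    case (add f g)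
    then obtain N G N' G' where G: "vars G \<subseteq> W" "\<And>a. E a Q \<noteq> 0 \<Longrightarrow> E a G = E a Q ^ N * Fa a f"
      "E' Q \<noteq> 0 \<Longrightarrow> E' G = E' Q ^ N * F' f" and G': "vars G' \<subseteq> W"
      "\<And>a. E a Q \<noteq> 0 \<Longrightarrow> E a G' = E a Q ^ N' * Fa a g" "E' Q \<noteq> 0 \<Longrightarrow> E' G' = E' Q ^ N' * F' g" by metis
    have "vars (G * Q ^ N' + G' * Q ^ N) \<subseteq> W"
      using vars_add[of "G * Q ^ N'" "G' * Q ^ N"] vars_mult[of G "Q ^ N'"] vars_mult[of G' "Q ^ N"]
        vars_power[of Q N] vars_power[of Q N'] G(1) G'(1) Q by blast
    then show ?case
      by (intro exI[of _ "N + N'"] exI[of _ "G * Q ^ N' + G' * Q ^ N"])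
         (simp add: G(2,3) G'(2,3) rhom_add[OF E(1)] rhom_mult[OF E(1)] rhom_power[OF E(1)]
           rhom_add[OF E'(1)] rhom_mult[OF E'(1)] rhom_power[OF E'(1)]
           rhom_add[OF Fa(1)] rhom_add[OF F'(1)] power_add algebra_simps)
  next
    case (mult f g)
    then obtain N G N' G' where G: "vars G \<subseteq> W" "\<And>a. E a Q \<noteq> 0 \<Longrightarrow> E a G = E a Q ^ N * Fa a f"
      "E' Q \<noteq> 0 \<Longrightarrow> E' G = E' Q ^ N * F' f" and G': "vars G' \<subseteq> W"
      "\<And>a. E a Q \<noteq> 0 \<Longrightarrow> E a G' = E a Q ^ N' * Fa a g" "E' Q \<noteq> 0 \<Longrightarrow> E' G' = E' Q ^ N' * F' g" by metis
    have "vars (G * G') \<subseteq> W" using vars_mult[of G G'] G(1) G'(1) by blast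
    then show ?case
      by (intro exI[of _ "N + N'"] exI[of _ "G * G'"])
         (simp add: G(2,3) G'(2,3) rhom_mult[OF E(1)] rhom_mult[OF E'(1)]
           rhom_mult[OF Fa(1)] rhom_mult[OF F'(1)] power_add algebra_simps)
  qed
  then show ?thesis unfolding E_def E'_def Fa_def F'_def .
qed

context prime_char_set
begin

text \<open>The orders of \<open>S\<close> and \<open>q\<close> may exceed \<open>r\<close>; the
  point is first extended to an order \<open>r'\<close> that bounds them, and largeness is applied
  to the part of \<open>P\<close> of order at most \<open>r'\<close>.\<close>

lemma dense_points:
  assumes large: "large_field TYPE('a)" and \<Lambda>r: "\<Lambda> \<subseteq> polys UNIV (inds_upto n r)"
    and H: "poly_eval (\<lambda>c. c) a (H_prod \<Lambda>) \<noteq> 0"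
    and zero: "\<And>v. principal v \<Longrightarrow> v \<in> inds_upto n r \<Longrightarrow> poly_eval (\<lambda>c. c) a (theta v) = 0"
    and S: "finite S" "S \<subseteq> P" and q: "vars q \<subseteq> inds n" "q \<notin> P"
  shows "\<exists>a'. (\<forall>f\<in>S. poly_eval (\<lambda>c. c) a' f = 0) \<and> poly_eval (\<lambda>c. c) a' q \<noteq> 0"
proof -
  have "finite (\<Union>f\<in>insert q S. vars f)" using S(1) by simp
  moreover have "(\<Union>f\<in>insert q S. vars f) \<subseteq> inds n" using S(2) q(1) prime_in_vars[OF P] by blast
  ultimately obtain r' where r': "(\<Union>f\<in>insert q S. vars f) \<subseteq> inds_upto n r'" using ex_inds_upto by blast
  let ?V = "inds_upto n r'" let ?P = "P \<inter> polys UNIV ?V"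
  obtain a1 where a1: "poly_eval (\<lambda>c. c) a1 (H_prod \<Lambda>) \<noteq> 0"
    "\<And>v. principal v \<Longrightarrow> v \<in> ?V \<Longrightarrow> poly_eval (\<lambda>c. c) a1 (theta v) = 0"
    using extend_point[OF \<Lambda>r H zero] by blast
  obtain vs where vs: "set vs = {v \<in> ?V. principal v}" "tri ?V vs theta" using ex_tri by blast
  have "\<exists>a'. (\<forall>f\<in>?P. poly_eval (\<lambda>c. c) a' f = 0) \<and> poly_eval (\<lambda>c. c) a' q \<noteq> 0"
  proof (rule large_field_tri[OF large finite_inds_upto vs(2) prime_in_P_upto])
    show "poly_eval (\<lambda>c. c) a1 f = 0" if "f \<in> ?P" for f
      by (rule zero_of_theta[OF rhom_id a1, of r']) (use that in \<open>auto simp: polys_UNIV\<close>)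
    show "vars q \<subseteq> ?V" using r' by simp
    show "q \<notin> ?P" using q(2) by blast
  qed (use tri_data[OF vs a1(1)] in blast)+
  moreover have "S \<subseteq> ?P" using S(2) r' polys_UNIV[of _ ?V] by blast
  ultimately show ?thesis by blast
qed

lemma ex_differential_point:
  fixes dU :: "'m \<Rightarrow> 'u::field_char_0 \<Rightarrow> 'u" and e :: "'a \<Rightarrow> 'b"
  assumes U: "universal_extension d dU \<iota>" and e: "inj e" and dl: "differentially_large TYPE('b) d"
    and \<Lambda>r: "\<Lambda> \<subseteq> polys UNIV (inds_upto n r)"
    and H: "poly_eval (\<lambda>c. c) a (H_prod \<Lambda>) \<noteq> 0"
    and zero: "\<And>v. principal v \<Longrightarrow> v \<in> inds_upto n r \<Longrightarrow> poly_eval (\<lambda>c. c) a (theta v) = 0"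
  shows "\<exists>c. (\<forall>f\<in>\<Lambda>. poly_eval (\<lambda>c. c) (jet d c) f = 0) \<and> poly_eval (\<lambda>c. c) (jet d c) (H_prod \<Lambda>) \<noteq> 0"
proof -
  have dU: "differential_field dU" and \<iota>: "rhom \<iota>" and \<iota>d: "\<And>k x. \<iota> (d k x) = dU k (\<iota> x)"
    using universal_extensionD[OF U] by auto
  have large: "large_field TYPE('a)" using dl by (simp add: differentially_large_def)
  obtain b where b: "\<And>f. vars f \<subseteq> inds n \<Longrightarrow> poly_eval \<iota> (jet dU b) f = 0 \<longleftrightarrow> f \<in> P"
    using generic_zero[OF d U P deriv_P] by blast
  define ev where "ev = poly_eval \<iota> (jet dU b)"
  have ev: "rhom ev" unfolding ev_def by (rule rhom_poly_eval[OF \<iota>])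
  have ev_deriv: "ev (dpoly_deriv d k f) = dU k (ev f)" for k f
  proof -
    have "jet dU b (ind_deriv k v) = dU k (jet dU b v)" for v
      by (rule jet_ind_deriv[of UNIV dU b v k]) (simp, rule deriv_comm[OF dU], simp)
    then show ?thesis
      unfolding ev_def by (intro poly_eval_dpoly_deriv[where d = d and D = dU and h = \<iota>, OF d dU \<iota> \<iota>d])
  qed
  \<comment> \<open>The differential field generated over the range of \<open>\<iota>\<close> by the
    generic zero, written as fractions of values. It is closed under the derivations by the quotient
    rule and \<open>ev_deriv\<close>.\<close>
  define F where "F = {ev p / ev q | p q. vars p \<subseteq> inds n \<and> vars q \<subseteq> inds n \<and> ev q \<noteq> 0}"
  have FI: "x \<in> F" if "x = ev p / ev q" "vars p \<subseteq> inds n" "vars q \<subseteq> inds n" "ev q \<noteq> 0" for x p q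
    using that unfolding F_def by blast
  have FE: "\<exists>p q. x = ev p / ev q \<and> vars p \<subseteq> inds n \<and> vars q \<subseteq> inds n \<and> ev q \<noteq> 0" if "x \<in> F" for x
    using that unfolding F_def by blast
  have v2: "vars (p * q) \<subseteq> inds n" "vars (p + q) \<subseteq> inds n" "vars (p - q) \<subseteq> inds n" "vars (- p) \<subseteq> inds n"
    if "vars p \<subseteq> inds n" "vars q \<subseteq> inds n" for p q :: "('m, 'a) dpoly"
    using that vars_mult[of p q] vars_add[of p q] vars_diff[of p q] by auto
  have vd: "vars (dpoly_deriv d k p) \<subseteq> inds n" if "vars p \<subseteq> inds n" for k p
    using that vars_dpoly_deriv[OF d, of k p] ind_deriv_inds[of k n] image_mono[OF that, of "ind_deriv k"] by blast
  have Fev: "ev p \<in> F" if "vars p \<subseteq> inds n" for p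
    by (rule FI[of _ p 1]) (use that in \<open>simp_all add: rhom_1[OF ev]\<close>)
  have F\<iota>: "\<iota> c \<in> F" for c
    using Fev[of "pconst c"] by (simp add: ev_def poly_eval_pconst[OF \<iota>])
  have Finv: "inverse x \<in> F" if x: "x \<in> F" for x
  proof (cases "x = 0")
    case True
    then show ?thesis using Fev[of 0] rhom_0[OF ev] by simp
  next
    case False
    obtain p q where pq: "x = ev p / ev q" "vars p \<subseteq> inds n" "vars q \<subseteq> inds n" "ev q \<noteq> 0" using FE[OF x] by blast
    then show ?thesis using False by (intro FI[of _ q p]) auto
  qed
  have F: "subr F"
    unfolding subr_def
  proof (intro conjI ballI)
    show "1 \<in> F" using Fev[of 1] rhom_1[OF ev] by simp
    fix x y assume "x \<in> F" "y \<in> F"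
    then obtain p q p' q' where pq: "x = ev p / ev q" "vars p \<subseteq> inds n" "vars q \<subseteq> inds n" "ev q \<noteq> 0"
      "y = ev p' / ev q'" "vars p' \<subseteq> inds n" "vars q' \<subseteq> inds n" "ev q' \<noteq> 0" using FE by metis
    show "x * y \<in> F"
      by (rule FI[of _ "p * p'" "q * q'"]) (use pq v2 in \<open>simp_all add: rhom_mult[OF ev]\<close>)
    show "x + y \<in> F"
      by (rule FI[of _ "p * q' + p' * q" "q * q'"])
         (use pq v2 in \<open>simp_all add: rhom_mult[OF ev] rhom_add[OF ev] add_frac_eq\<close>)
  next
    fix x assume "x \<in> F"
    then obtain p q where "x = ev p / ev q" "vars p \<subseteq> inds n" "vars q \<subseteq> inds n" "ev q \<noteq> 0" using FE by blast
    then show "- x \<in> F" by (intro FI[of _ "- p" q]) (simp_all add: rhom_uminus[OF ev])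
  qed
  have Fd: "dU k x \<in> F" if x: "x \<in> F" for k x
  proof -
    obtain p q where pq: "x = ev p / ev q" "vars p \<subseteq> inds n" "vars q \<subseteq> inds n" "ev q \<noteq> 0" using FE[OF x] by blast
    let ?\<delta> = "dpoly_deriv d k"
    have "dU k x = dU k (ev p) * inverse (ev q) + ev p * (- dU k (ev q) * inverse (ev q) * inverse (ev q))"
      unfolding pq(1) divide_inverse deriv_mult[OF dU] deriv_inverse[OF dU pq(4)] ..
    also have "\<dots> = (dU k (ev p) * ev q - ev p * dU k (ev q)) / (ev q * ev q)"
      using pq(4) by (simp add: field_simps)
    also have "\<dots> = ev (?\<delta> p * q - p * ?\<delta> q) / ev (q * q)"
      by (simp only: rhom_mult[OF ev] rhom_diff[OF ev] ev_deriv)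
    finally show ?thesis
      by (rule FI) (use pq v2 vd in \<open>simp_all add: rhom_mult[OF ev]\<close>)
  qed
  \<comment> \<open>An element of \<open>F\<close> is coded by a numerator and a denominator.
    Differential polynomials inject into \<open>'a\<close>, hence so do such pairs, and
    \<open>e\<close> carries the code into \<open>'b\<close>.\<close>
  obtain e0 :: "'u \<Rightarrow> 'b" where e0: "inj_on e0 F"
  proof -
    have inf: "infinite (UNIV :: 'a set)" by (rule infinite_UNIV_char_0)
    obtain c :: "('m, 'a) dpoly \<Rightarrow> 'a" where c: "inj c" using inj_dpoly[OF inf] by blast
    obtain \<pi> :: "'a \<times> 'a \<Rightarrow> 'a" where \<pi>: "inj \<pi>" using inj_pair[OF inf] by blast
    have "\<forall>x. \<exists>pq. x \<in> F \<longrightarrow> x = ev (fst pq) / ev (snd pq)" using FE by (metis fst_conv snd_conv)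
    then obtain pq where pq: "\<And>x. x \<in> F \<Longrightarrow> x = ev (fst (pq x)) / ev (snd (pq x))" by metis
    have "inj_on (\<lambda>x. e (\<pi> (c (fst (pq x)), c (snd (pq x))))) F"
    proof (rule inj_onI)
      fix x y assume xy: "x \<in> F" "y \<in> F"
        "e (\<pi> (c (fst (pq x)), c (snd (pq x)))) = e (\<pi> (c (fst (pq y)), c (snd (pq y))))"
      then have "fst (pq x) = fst (pq y)" "snd (pq x) = snd (pq y)"
        by (simp_all add: inj_eq[OF e] inj_eq[OF \<pi>] inj_eq[OF c])
      then show "x = y" using pq[OF xy(1)] pq[OF xy(2)] by simp
    qed
    then show thesis by (rule that)
  qed
  define L where "L = transport_ring F e0"
  define g where "g = inv_into F e0"
  define D where "D k x = e0 (dU k (g x))" for k x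
  define h where "h c = e0 (\<iota> c)" for c
  have g: "g (e0 x) = x" if "x \<in> F" for x unfolding g_def using e0 that by simp
  have L: "carrier L = e0 ` F" "x \<otimes>\<^bsub>L\<^esub> y = e0 (g x * g y)" "x \<oplus>\<^bsub>L\<^esub> y = e0 (g x + g y)"
    "\<one>\<^bsub>L\<^esub> = e0 1" "\<zero>\<^bsub>L\<^esub> = e0 0" for x y
    by (simp_all add: L_def transport_ring_def g_def)
  have gF: "g x \<in> F" "e0 (g x) = x" if "x \<in> carrier L" for x using that g by (auto simp: L)
  have fieldL: "Ring.field L" unfolding L_def by (rule field_transport_ring[OF F Finv e0])
  interpret L: Ring.field L by (rule fieldL)
  note Fcl = subr_0[OF F] subr_1[OF F] subr_add[OF F] subr_mult[OF F]
  have hom: "h \<in> ring_hom ring_of_type_algebra L"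
    by (rule ring_hom_memI) (auto simp: h_def L g F\<iota> rhom_add[OF \<iota>] rhom_mult[OF \<iota>] rhom_1[OF \<iota>])
  have ext: "differential_extension d L D h"
    unfolding differential_extension_def
  proof (intro conjI allI ballI)
    fix k l x assume "x \<in> carrier L"
    then obtain u where u: "u \<in> F" "x = e0 u" by (auto simp: L)
    then show "D k x \<in> carrier L" "D k (D l x) = D l (D k x)"
      by (simp_all add: D_def L g Fd deriv_comm[OF dU, of k l])
    fix y assume "y \<in> carrier L"
    then obtain w where w: "w \<in> F" "y = e0 w" by (auto simp: L)
    show "D k (x \<oplus>\<^bsub>L\<^esub> y) = D k x \<oplus>\<^bsub>L\<^esub> D k y"
      using u w by (simp add: D_def L g Fd Fcl deriv_add[OF dU])
    show "D k (x \<otimes>\<^bsub>L\<^esub> y) = (D k x \<otimes>\<^bsub>L\<^esub> y) \<oplus>\<^bsub>L\<^esub> (x \<otimes>\<^bsub>L\<^esub> D k y)"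
      using u w by (simp add: D_def L g Fd Fcl deriv_mult[OF dU])
  qed (use fieldL hom in \<open>simp_all add: h_def D_def g F\<iota> \<iota>d\<close>)
  have eval_L: "poly_eval_in L h \<beta> f = e0 (poly_eval \<iota> (\<lambda>v. g (\<beta> v)) f) \<and> poly_eval \<iota> (\<lambda>v. g (\<beta> v)) f \<in> F"
    if \<beta>: "\<And>v. \<beta> v \<in> carrier L" for \<beta> :: "'v \<Rightarrow> 'b" and f
  proof -
    interpret E: record_eval L h \<beta> by unfold_locales (use hom \<beta> in auto)
    show ?thesis
      by (rule E.E_transport[OF F, where \<phi> = e0]) (use gF \<beta> F\<iota> \<iota> in \<open>auto simp: L g h_def\<close>)
  qed
  have e0_0: "x = 0" if "e0 x = e0 0" "x \<in> F" for x using inj_onD[OF e0 that(1,2) Fcl(1)] .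
  have "ec_field_in L h"
    unfolding ec_field_in_def
  proof (intro allI impI)
    fix n0 :: nat and S :: "(nat, 'a) mpoly set"
    assume S: "finite S" "S \<subseteq> polys UNIV {..<n0}"
      and "\<exists>\<beta>\<in>{..<n0} \<rightarrow> carrier L. \<forall>f\<in>S. poly_eval_in L h \<beta> f = \<zero>\<^bsub>L\<^esub>"
    then obtain \<beta>0 where \<beta>0: "\<beta>0 \<in> {..<n0} \<rightarrow> carrier L" "\<And>f. f \<in> S \<Longrightarrow> poly_eval_in L h \<beta>0 f = \<zero>\<^bsub>L\<^esub>" by blast
    have vS: "vars f \<subseteq> {..<n0}" if "f \<in> S" for f using S(2) that polys_UNIV[of f "{..<n0}"] by blast
    define \<beta> where "\<beta> i = (if i < n0 then \<beta>0 i else \<zero>\<^bsub>L\<^esub>)" for i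
    have \<beta>: "\<beta> i \<in> carrier L" for i using \<beta>0(1) by (auto simp: \<beta>_def)
    have root: "poly_eval \<iota> (\<lambda>i. g (\<beta> i)) f = 0" if f: "f \<in> S" for f
    proof -
      have "poly_eval_in L h \<beta>0 f = poly_eval_in L h \<beta> f"
        by (rule poly_eval_in_cong[OF L.is_cring vS[OF f]]) (use \<beta> F\<iota> in \<open>auto simp: \<beta>_def h_def L\<close>)
      then have "e0 (poly_eval \<iota> (\<lambda>i. g (\<beta> i)) f) = e0 0" using \<beta>0(2)[OF f] eval_L[of \<beta> f] \<beta> by (simp add: L)
      then show ?thesis using e0_0 eval_L[of \<beta> f] \<beta> by blast
    qed
    have "\<forall>i. \<exists>p q. g (\<beta> i) = ev p / ev q \<and> vars p \<subseteq> inds n \<and> vars q \<subseteq> inds n \<and> ev q \<noteq> 0"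
      using FE gF(1)[OF \<beta>] by blast
    then obtain p q where pq: "\<And>i. g (\<beta> i) = ev (p i) / ev (q i)" "\<And>i. vars (p i) \<subseteq> inds n"
      "\<And>i. vars (q i) \<subseteq> inds n" "\<And>i. ev (q i) \<noteq> 0" by metis
    \<comment> \<open>A common denominator of the coordinates \<open>i < n0\<close> of the given
      solution; the \<open>p' i\<close> are the matching numerators.\<close>
    define Q where "Q = (\<Prod>j<n0. q j)"
    define p' where "p' i = p i * (\<Prod>j\<in>{..<n0} - {i}. q j)" for i
    have vQ: "vars Q \<subseteq> inds n" unfolding Q_def by (rule vars_prod) (rule pq(3))
    have vp': "vars (p' i) \<subseteq> inds n" for i
      unfolding p'_def by (rule v2(1)[OF pq(2) vars_prod]) (rule pq(3))
    have evQ: "ev Q \<noteq> 0" unfolding Q_def rhom_prod[OF ev] using pq(4) by (simp add: prod_zero_iff)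
    have quot: "ev (p' i) / ev Q = g (\<beta> i)" if "i < n0" for i
    proof -
      have "Q = q i * (\<Prod>j\<in>{..<n0} - {i}. q j)" unfolding Q_def by (rule prod.remove) (use that in auto)
      then have "ev Q = ev (q i) * ev (\<Prod>j\<in>{..<n0} - {i}. q j)" by (simp add: rhom_mult[OF ev])
      then show ?thesis using evQ by (simp add: p'_def rhom_mult[OF ev] pq(1))
    qed
    have clearS: "\<exists>N G. vars G \<subseteq> inds n \<and>
      (\<forall>a. poly_eval (\<lambda>c. c) a Q \<noteq> 0 \<longrightarrow> poly_eval (\<lambda>c. c) a G =
        poly_eval (\<lambda>c. c) a Q ^ N * poly_eval (\<lambda>c. c) (\<lambda>i. poly_eval (\<lambda>c. c) a (p' i) / poly_eval (\<lambda>c. c) a Q) f) \<and>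
      (ev Q \<noteq> 0 \<longrightarrow> ev G = ev Q ^ N * poly_eval \<iota> (\<lambda>i. ev (p' i) / ev Q) f)" if "f \<in> S" for f
      unfolding ev_def by (rule clear_denominators[OF \<iota> vS[OF that] vp' vQ])
    \<comment> \<open>At the generic zero \<open>G\<close> is a power of \<open>Q\<close> times the
      value of \<open>f\<close> at the given solution, hence zero. Genericity then puts
      \<open>G\<close> into \<open>P\<close>.\<close>
    have "\<forall>f. \<exists>G. f \<in> S \<longrightarrow> G \<in> P \<and> (\<forall>a. poly_eval (\<lambda>c. c) a Q \<noteq> 0 \<longrightarrow> poly_eval (\<lambda>c. c) a G = 0 \<longrightarrow>
        poly_eval (\<lambda>c. c) (\<lambda>i. poly_eval (\<lambda>c. c) a (p' i) / poly_eval (\<lambda>c. c) a Q) f = 0)"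
    proof (intro allI)
      fix f
      show "\<exists>G. f \<in> S \<longrightarrow> G \<in> P \<and> (\<forall>a. poly_eval (\<lambda>c. c) a Q \<noteq> 0 \<longrightarrow> poly_eval (\<lambda>c. c) a G = 0 \<longrightarrow>
        poly_eval (\<lambda>c. c) (\<lambda>i. poly_eval (\<lambda>c. c) a (p' i) / poly_eval (\<lambda>c. c) a Q) f = 0)"
      proof (cases "f \<in> S")
        case True
        obtain N G where G: "vars G \<subseteq> inds n" "\<And>a. poly_eval (\<lambda>c. c) a Q \<noteq> 0 \<Longrightarrow> poly_eval (\<lambda>c. c) a G =
            poly_eval (\<lambda>c. c) a Q ^ N * poly_eval (\<lambda>c. c) (\<lambda>i. poly_eval (\<lambda>c. c) a (p' i) / poly_eval (\<lambda>c. c) a Q) f"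
          "ev G = ev Q ^ N * poly_eval \<iota> (\<lambda>i. ev (p' i) / ev Q) f"
          using clearS[OF True] evQ by blast
        have "poly_eval \<iota> (\<lambda>i. ev (p' i) / ev Q) f = poly_eval \<iota> (\<lambda>i. g (\<beta> i)) f"
          by (rule poly_eval_cong) (use vS[OF True] quot in blast)
        then have "ev G = 0" using G(3) root[OF True] by simp
        then have "G \<in> P" using b[OF G(1)] by (simp add: ev_def)
        then show ?thesis using G(2) by (intro exI[of _ G]) auto
      qed blast
    qed
    then obtain G where G: "\<And>f. f \<in> S \<Longrightarrow> G f \<in> P"
      "\<And>f a. f \<in> S \<Longrightarrow> poly_eval (\<lambda>c. c) a Q \<noteq> 0 \<Longrightarrow> poly_eval (\<lambda>c. c) a (G f) = 0 \<Longrightarrow>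
        poly_eval (\<lambda>c. c) (\<lambda>i. poly_eval (\<lambda>c. c) a (p' i) / poly_eval (\<lambda>c. c) a Q) f = 0" by metis
    \<comment> \<open>Density provides a rational zero of the finitely many \<open>G f\<close> at
      which \<open>Q\<close> does not vanish; there the fractions \<open>p' i / Q\<close> are
      defined and solve the system.\<close>
    have "Q \<notin> P" using b[OF vQ] evQ by (simp add: ev_def)
    moreover have "finite (G ` S)" "G ` S \<subseteq> P" using S(1) G(1) by auto
    ultimately obtain a' where "\<And>f. f \<in> S \<Longrightarrow> poly_eval (\<lambda>c. c) a' (G f) = 0" "poly_eval (\<lambda>c. c) a' Q \<noteq> 0"
      using dense_points[OF large \<Lambda>r H zero, of "G ` S" Q] vQ by blast
    then show "\<exists>a. \<forall>f\<in>S. poly_eval (\<lambda>c. c) a f = 0" using G(2) by blast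
  qed
  then have ec: "ec_differential_in d L D h" using dl ext by (simp add: differentially_large_def)
  have vH: "vars (H_prod \<Lambda>) \<subseteq> inds n" by (rule vars_H_prod) (rule autoreduced_vars[OF autoreduced])
  have evH: "ev (H_prod \<Lambda>) \<noteq> 0" using b[OF vH] H_prod_notin[OF P \<Lambda>] by (simp add: ev_def)
  \<comment> \<open>Existential closedness allows equations only. A new differential indeterminate
    with index \<open>n\<close>, used in order 0 alone, stands for the inverse of
    \<open>H_prod \<Lambda>\<close>.\<close>
  let ?r = "H_prod \<Lambda> * pvar (n, 0) - 1"
  have sub: "inds n \<subseteq> (inds (Suc n) :: 'm ind set)" by (auto simp: inds_def)
  have nn: "(n, 0) \<in> (inds (Suc n) :: 'm ind set)" by (simp add: inds_def)
  have "vars ?r \<subseteq> vars (H_prod \<Lambda>) \<union> {(n, 0)}"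
    using vars_diff[of "H_prod \<Lambda> * pvar (n, 0)" 1] vars_mult[of "H_prod \<Lambda>" "pvar (n, 0)"]
    by (simp add: vars_pvar)
  then have "vars ?r \<subseteq> inds (Suc n)" using vH sub nn by blast
  moreover have "vars f \<subseteq> inds (Suc n)" if "f \<in> \<Lambda>" for f
    using autoreduced_vars[OF autoreduced that] sub by blast
  ultimately have S: "insert ?r \<Lambda> \<subseteq> polys UNIV (inds (Suc n))"
    using polys_UNIV[of _ "inds (Suc n) :: 'm ind set"] by blast
  have finS: "finite (insert ?r \<Lambda>)" using finite_autoreduced[OF autoreduced] by simp
  have bF: "b i \<in> F" if "i < n" for i
  proof -
    have "ev (pvar (i, 0)) = b i" by (simp add: ev_def poly_eval_pvar[OF \<iota>] jet_def)
    then show ?thesis using Fev[of "pvar (i, 0)"] that by (simp add: vars_pvar inds_def)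
  qed
  \<comment> \<open>The generic zero, prolonged by the inverse of the value of
    \<open>H_prod \<Lambda>\<close>; all coordinates lie in \<open>F\<close>, so the point can be
    carried to \<open>L\<close>.\<close>
  define x where "x i = (if i < n then b i else inverse (ev (H_prod \<Lambda>)))" for i
  have xF: "x i \<in> F" for i using bF Finv[OF Fev[OF vH]] by (simp add: x_def)
  define \<beta> where "\<beta> i = e0 (x i)" for i
  have \<beta>: "\<beta> i \<in> carrier L" for i using xF by (simp add: \<beta>_def L)
  have Dcl: "D k y \<in> carrier L" if "y \<in> carrier L" for k y using differential_extensionD(2)[OF ext that] .
  have jcl: "jet D \<beta> v \<in> carrier L" for v
    unfolding jet_def case_prod_unfold by (rule iter_deriv_closed) (use Dcl \<beta> in auto)
  have gjet: "g (jet D \<beta> v) = jet dU x v" for v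
  proof -
    have "g (iter_deriv D (snd v) (\<beta> (fst v))) = iter_deriv dU (snd v) (g (\<beta> (fst v)))"
      by (rule iter_deriv_hom[of "carrier L"]) (use Dcl \<beta> gF Fd in \<open>auto simp: D_def g\<close>)
    then show ?thesis by (simp add: jet_def case_prod_unfold \<beta>_def g xF)
  qed
  have evx: "poly_eval \<iota> (jet dU x) f = ev f" if "vars f \<subseteq> inds n" for f
    unfolding ev_def by (rule poly_eval_cong) (use that in \<open>auto simp: jet_def x_def inds_def\<close>)
  have "poly_eval \<iota> (jet dU x) ?r = 0"
  proof -
    have "jet dU x (n, 0) = inverse (ev (H_prod \<Lambda>))" by (simp add: jet_def x_def)
    then show ?thesis
      using evH by (simp add: rhom_diff[OF rhom_poly_eval[OF \<iota>]] rhom_1[OF rhom_poly_eval[OF \<iota>]]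
        poly_eval_mult[OF \<iota>] poly_eval_pvar[OF \<iota>] evx[OF vH])
  qed
  moreover have "poly_eval \<iota> (jet dU x) f = 0" if "f \<in> \<Lambda>" for f
  proof -
    have "vars f \<subseteq> inds n" "f \<in> P" using that autoreduced_vars[OF autoreduced] characteristic_set_subset[OF \<Lambda>] by auto
    then show ?thesis using evx b by (simp add: ev_def)
  qed
  ultimately have "\<forall>f\<in>insert ?r \<Lambda>. poly_eval_in L h (jet D \<beta>) f = \<zero>\<^bsub>L\<^esub>"
    using eval_L[of "jet D \<beta>", OF jcl] by (simp add: L gjet)
  moreover have "\<beta> \<in> {..<Suc n} \<rightarrow> carrier L" using \<beta> by blast
  ultimately obtain c where c: "\<forall>f\<in>insert ?r \<Lambda>. poly_eval (\<lambda>c. c) (jet d c) f = 0"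
    using ec finS S unfolding ec_differential_in_def by blast
  note h' = rhom_poly_eval[OF rhom_id, of "jet d c"]
  have "poly_eval (\<lambda>c. c) (jet d c) (H_prod \<Lambda>) \<noteq> 0"
    using c by (auto simp: rhom_diff[OF h'] rhom_mult[OF h'] rhom_1[OF h'])
  then show ?thesis using c by blast
qed

end

theorem proposition4p7:
  fixes d :: "'m::{finite,linorder} \<Rightarrow> 'a::field_char_0 \<Rightarrow> 'a"
    and dU :: "'m \<Rightarrow> 'u::field_char_0 \<Rightarrow> 'u"
    and \<iota> :: "'a \<Rightarrow> 'u"
  assumes "differential_field d"
    and "large_field TYPE('a)"
    and "universal_extension d dU \<iota>"
    and "\<exists>e :: 'a \<Rightarrow> 'b. inj e"
  shows "differentially_large TYPE('b) d \<longleftrightarrow> UC d dU \<iota>"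
proof
  assume "UC d dU \<iota>"
  then show "differentially_large TYPE('b) d"
    using assms(2) UC_imp_ec_differential[OF assms(1,3)] unfolding differentially_large_def by blast
next
  assume dl: "differentially_large TYPE('b) d"
  obtain e :: "'a \<Rightarrow> 'b" where e: "inj e" using assms(4) by blast
  note \<iota> = universal_extensionD(2,3)[OF assms(3)]
  show "UC d dU \<iota>"
    unfolding UC_def
  proof (intro allI impI)
    fix n and P \<Lambda> :: "('m, 'a) dpoly set"
    assume P: "prime_differential_ideal UNIV d n P" and \<Lambda>: "characteristic_set n P \<Lambda>"
      and "\<exists>r. \<Lambda> \<subseteq> polys UNIV (inds_upto n r) \<and>
             (\<exists>a. smooth_rational_point \<iota> (inds_upto n r)
                (alg_zeros \<iota> (inds_upto n r) (prolongation d n r \<Lambda>)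
                  - alg_zeros \<iota> (inds_upto n r) {H_prod \<Lambda>}) a)"
    then obtain r a where r: "\<Lambda> \<subseteq> polys UNIV (inds_upto n r)"
      and a: "restrict (\<lambda>v. \<iota> (a v)) (inds_upto n r) \<in> alg_zeros \<iota> (inds_upto n r) (prolongation d n r \<Lambda>)
                  - alg_zeros \<iota> (inds_upto n r) {H_prod \<Lambda>}"
      unfolding smooth_rational_point_def by blast
    interpret prime_char_set d n P \<Lambda>
      using P \<Lambda> assms(1) by unfold_locales (auto simp: prime_differential_ideal_iff)
    let ?V = "inds_upto n r"
    have v\<Lambda>: "vars f \<subseteq> ?V" if "f \<in> \<Lambda>" for f using r that polys_UNIV[of f ?V] by blast
    have ev: "poly_eval \<iota> (restrict (\<lambda>v. \<iota> (a v)) ?V) f = 0 \<longleftrightarrow> poly_eval (\<lambda>c. c) a f = 0" if "vars f \<subseteq> ?V" for f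
      unfolding poly_eval_restrict[OF that] poly_eval_hom[OF \<iota>(1)] by (rule rhom_field_eq_0_iff[OF \<iota>(1)])
    have Hn: "vars (H_prod \<Lambda>) \<subseteq> ?V" by (rule vars_H_prod) (rule v\<Lambda>)
    have "poly_eval (\<lambda>c. c) a (H_prod \<Lambda>) \<noteq> 0"
      using a ev[OF Hn] by (auto simp: alg_zeros_def)
    moreover have "poly_eval (\<lambda>c. c) a (theta v) = 0" if "principal v" "v \<in> ?V" for v
      using a ev[of "theta v"] theta_in_prolongation[OF that] vars_theta_inds_upto[OF that]
      by (auto simp: alg_zeros_def)
    ultimately obtain c where c: "\<And>f. f \<in> \<Lambda> \<Longrightarrow> poly_eval (\<lambda>c. c) (jet d c) f = 0"
      "poly_eval (\<lambda>c. c) (jet d c) (H_prod \<Lambda>) \<noteq> 0"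
      using ex_differential_point[OF assms(3) e dl r] by blast
    have "vars (H_prod \<Lambda>) \<subseteq> inds n" using Hn inds_upto_subset_inds[of n r] by blast
    then have "restrict (\<lambda>i. \<iota> (c i)) {..<n} \<in> diff_zeros dU \<iota> n {H_prod \<Lambda>} \<longleftrightarrow>
        (\<forall>f\<in>{H_prod \<Lambda>}. poly_eval (\<lambda>c. c) (jet d c) f = 0)"
      by (intro diff_zerosD[where h = \<iota> and d = d and dU = dU, OF \<iota>(1)] \<iota>(2)) simp
    then have "restrict (\<lambda>i. \<iota> (c i)) {..<n} \<notin> diff_zeros dU \<iota> n {H_prod \<Lambda>}" using c(2) by simp
    moreover have "restrict (\<lambda>i. \<iota> (c i)) {..<n} \<in> diff_zeros dU \<iota> n \<Lambda> \<longleftrightarrow>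
        (\<forall>f\<in>\<Lambda>. poly_eval (\<lambda>c. c) (jet d c) f = 0)"
      by (rule diff_zerosD[where h = \<iota> and d = d and dU = dU, OF \<iota>(1)])
       (rule \<iota>(2), rule autoreduced_vars[OF autoreduced])
    then have "restrict (\<lambda>i. \<iota> (c i)) {..<n} \<in> diff_zeros dU \<iota> n \<Lambda>" using c(1) by blast
    ultimately show "\<exists>a. restrict (\<lambda>i. \<iota> (a i)) {..<n} \<in>
               diff_zeros dU \<iota> n \<Lambda> - diff_zeros dU \<iota> n {H_prod \<Lambda>}" by blast
  qed
qed

end
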